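(* Let $0<p\le q<\infty$, $\omega\in\mathcal{B}_\infty(\widehat{\mathcal{D}})$ and let $\mu$ be a positive Borel measure on $\mathbb{D}$. Then the following statements are equivalent: (i) $\mu$ is a $q$-Carleson measure for $A^p_\omega$; (ii) the operator $\varphi\mapsto[M_\omega(|\varphi|^{1/\alpha})]^{\alpha}$, denoted $[M_\omega((\cdot)^{1/\alpha})]^\alpha$, is bounded from $L^p_\omega$ to $L^q_\mu$ for each $\alpha>\frac1p$; (iii) $\displaystyle\sup_S\frac{\mu(S)}{(\omega(S))^{q/p}}<\infty$, where the supremum runs over all the Carleson squares $S$ in $\mathbb{D}$. Moreover, for each $\alpha>\frac1p$, $$\|I_d\|^q_{A^p_\omega\to L^q_\mu}\asymp\|[M_\omega((\cdot)^{1/\alpha})]^\alpha\|^q_{L^p_\omega\to L^q_\mu}\asymp\sup_S\frac{\mu(S)}{(\omega(S))^{q/p}}.$$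
   Context: $\mathbb{D}$ is the open unit disc in $\mathbb{C}$, $\mathcal{H}(\mathbb{D})$ the space of analytic functions in $\mathbb{D}$, and $dA=\frac{dx\,dy}{\pi}$. A weight is a nonnegative function on $\mathbb{D}$ integrable with respect to $dA$; it is radial if $\omega(z)=\omega(|z|)$ for all $z\in\mathbb{D}$ and $\int_0^1\omega(s)\,ds<\infty$. Write $\omega(E)=\int_E\omega\,dA$ and $\mu(E)=\int_E d\mu$. For a weight $\omega$, $\|f\|_{A^p_\omega}^p=\int_{\mathbb{D}}|f|^p\omega\,dA$ and $A^p_\omega=\{f\in\mathcal{H}(\mathbb{D}):\|f\|_{A^p_\omega}<\infty\}$. $L^p_\omega=L^p(\omega\,dA)$ and $L^q_\mu=L^q(d\mu)$. For $a\in\mathbb{D}\setminus\{0\}$ let $I_a=\{e^{i\theta}:|\arg(ae^{-i\theta})|\le\frac{1-|a|}{2}\}$; the Carleson square induced by $a$ is $S(a)=\{re^{it}\in\mathbb{D}:r\ge|a|,\ e^{it}\in I_a\}$; in addition $S(0)=\mathbb{D}$. The Carleson squares are the sets $S(a)$, $a\in\mathbb{D}$. All weights are assumed to satisfy $\omega(S(a))>0$ for all $a\in\mathbb{D}\setminus\{0\}$. For a radial weight $\nu$ put $\widehat{\nu}(r)=\int_r^1\nu(s)\,ds$. Then $\nu\in\widehat{\mathcal{D}}$ if there is $C>1$ with $\widehat{\nu}(r)\le C\widehat{\nu}(\frac{1+r}{2})$ for all $0\le r<1$. For $1<s<\infty$, $s'=\frac{s}{s-1}$, and a weight $\nu$,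 a function $W\ge0$ with $W\nu$ integrable belongs to $B_s(\nu)$ if $$\sup_S\frac{\left(\int_S W\nu\,dA\right)^{1/s}\left(\int_S W^{-s'/s}\nu\,dA\right)^{1/s'}}{\int_S\nu\,dA}<\infty,$$ the supremum being over all Carleson squares $S$. Thus, for a weight $\omega$, $\frac{\omega}{\nu}\in B_s(\nu)$ means $\left(\int_S\omega\,dA\right)^{1/s}\left(\int_S(\nu\,\omega^{-1/s})^{s'}dA\right)^{1/s'}\le C\nu(S)$ for all $S$, where the integrand in the second integral is taken to be $0$ where $\nu=0$ and $+\infty$ where $\omega=0<\nu$. Set $\mathcal{B}_\infty(\nu)=\bigcup_{1<s<\infty}\{\omega:\frac{\omega}{\nu}\in B_s(\nu)\}$ and $\mathcal{B}_\infty(\widehat{\mathcal{D}})=\bigcup_{\nu\in\widehat{\mathcal{D}}}\mathcal{B}_\infty(\nu)$. For $\varphi\in L^1_\omega$ the Hörmander-type maximal function is $$M_\omega(\varphi)(z)=\sup_{z\in S}\frac{1}{\omega(S)}\int_S|\varphi(\zeta)|\omega(\zeta)\,dA(\zeta),\quad z\in\mathbb{D},$$ the supremum being over Carleson squares $S$ containing $z$. $\mu$ is a $q$-Carleson measure for $A^p_\omega$ if the identity operator $I_d:A^p_\omega\to L^q_\mu$ is bounded. For an operator $T:X\to Y$ (possibly sublinear), $\|T\|_{X\to Y}$ is the least constant $C$ with $\|Tf\|_Y\le C\|f\|_X$ for all $f\in X$. $X\asymp Y$ means two-sided inequalities with positive constants independent of $\mu$ (depending only on $p,q,\alpha,\omega$).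 *)

theory Defs
  imports "HOL-Analysis.Analysis"
begin

(* Functions on the disc are total functions on complex; their values outside the disc
   are never used. Integrals and norms take values in ennreal. *)

abbreviation disc :: "complex set" where
  "disc \<equiv> ball 0 1"

definition dA :: "complex measure" where
  "dA = density (lebesgue_on disc) (\<lambda>_. ennreal (1 / pi))"

definition carleson_arc :: "complex \<Rightarrow> complex set" where
  "carleson_arc a = {cis \<theta> | \<theta>. \<bar>Arg (a * cis (- \<theta>))\<bar> \<le> (1 - norm a) / 2}"

definition carleson_square :: "complex \<Rightarrow> complex set" where
  "carleson_square a =
     (if a = 0 then disc
      else {of_real r * cis t | r t. norm a \<le> r \<and> r < 1 \<and> cis t \<in> carleson_arc a})"

definition carleson_squares :: "complex set set" where
  "carleson_squares = carleson_square ` disc"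

(* The measure omega dA; thus omega(E) is emeasure (weighted omega) E. *)
definition weighted :: "(complex \<Rightarrow> real) \<Rightarrow> complex measure" where
  "weighted \<omega> = density dA (\<lambda>z. ennreal (\<omega> z))"

definition weight :: "(complex \<Rightarrow> real) \<Rightarrow> bool" where
  "weight \<omega> \<longleftrightarrow> (\<forall>z\<in>disc. 0 \<le> \<omega> z) \<and> integrable dA \<omega> \<and>
     (\<forall>a\<in>disc - {0}. 0 < emeasure (weighted \<omega>) (carleson_square a))"

definition radial_weight :: "(complex \<Rightarrow> real) \<Rightarrow> bool" where
  "radial_weight \<nu> \<longleftrightarrow> weight \<nu> \<and> (\<forall>z\<in>disc. \<nu> z = \<nu> (of_real (norm z))) \<and>
     set_integrable lebesgue {0..<1} (\<lambda>s. \<nu> (of_real s))"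

definition weight_tail :: "(complex \<Rightarrow> real) \<Rightarrow> real \<Rightarrow> real" where
  "weight_tail \<nu> r = (LINT s:{r..<1}|lebesgue. \<nu> (of_real s))"

definition D_hat :: "(complex \<Rightarrow> real) set" where
  "D_hat = {\<nu>. radial_weight \<nu> \<and>
     (\<exists>C>1. \<forall>r. 0 \<le> r \<and> r < 1 \<longrightarrow> weight_tail \<nu> r \<le> C * weight_tail \<nu> ((1 + r) / 2))}"

(* x to the power a, only used for a > 0. *)
definition epowr :: "ennreal \<Rightarrow> real \<Rightarrow> ennreal" where
  "epowr x a = (if x = \<infinity> then \<infinity> else ennreal (enn2real x powr a))"

(* (nu omega^(-1/s))^(s'), read as 0 where nu = 0 and as infinity where omega = 0 < nu. *)
definition dual_integrand ::
    "real \<Rightarrow> (complex \<Rightarrow> real) \<Rightarrow> (complex \<Rightarrow> real) \<Rightarrow> complex \<Rightarrow> ennreal" where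
  "dual_integrand s \<nu> \<omega> z =
     (if \<nu> z = 0 then 0 else if \<omega> z = 0 then \<infinity>
      else ennreal ((\<nu> z * \<omega> z powr (- 1 / s)) powr (s / (s - 1))))"

(* omega / nu belongs to B_s(nu); the quotient itself is not formed since nu may vanish. *)
definition quotient_in_B ::
    "real \<Rightarrow> (complex \<Rightarrow> real) \<Rightarrow> (complex \<Rightarrow> real) \<Rightarrow> bool" where
  "quotient_in_B s \<nu> \<omega> \<longleftrightarrow>
     (\<exists>C::real. \<forall>S\<in>carleson_squares.
        epowr (emeasure (weighted \<omega>) S) (1 / s)
          * epowr (\<integral>\<^sup>+z\<in>S. dual_integrand s \<nu> \<omega> z \<partial>dA) (1 / (s / (s - 1)))
        \<le> ennreal C * emeasure (weighted \<nu>) S)"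

definition B_infty :: "(complex \<Rightarrow> real) \<Rightarrow> (complex \<Rightarrow> real) set" where
  "B_infty \<nu> = (\<Union>s\<in>{1<..}. {\<omega>. weight \<omega> \<and> quotient_in_B s \<nu> \<omega>})"

definition B_infty_D_hat :: "(complex \<Rightarrow> real) set" where
  "B_infty_D_hat = (\<Union>\<nu>\<in>D_hat. B_infty \<nu>)"

definition eLp_norm :: "'a measure \<Rightarrow> real \<Rightarrow> ('a \<Rightarrow> ennreal) \<Rightarrow> ennreal" where
  "eLp_norm M p u = epowr (\<integral>\<^sup>+x. epowr (u x) p \<partial>M) (1 / p)"

definition eLp :: "'a measure \<Rightarrow> real \<Rightarrow> ('a \<Rightarrow> ennreal) set" where
  "eLp M p = {u \<in> borel_measurable M. eLp_norm M p u < \<infinity>}"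

definition Lp_norm :: "'a measure \<Rightarrow> real \<Rightarrow> ('a \<Rightarrow> complex) \<Rightarrow> ennreal" where
  "Lp_norm M p f = eLp_norm M p (\<lambda>x. ennreal (norm (f x)))"

definition Lp :: "'a measure \<Rightarrow> real \<Rightarrow> ('a \<Rightarrow> complex) set" where
  "Lp M p = {f \<in> borel_measurable M. Lp_norm M p f < \<infinity>}"

definition bergman :: "real \<Rightarrow> (complex \<Rightarrow> real) \<Rightarrow> (complex \<Rightarrow> complex) set" where
  "bergman p \<omega> = {f. f holomorphic_on disc \<and> Lp_norm (weighted \<omega>) p f < \<infinity>}"

definition bounded_operator ::
    "'f set \<Rightarrow> ('f \<Rightarrow> ennreal) \<Rightarrow> 'g set \<Rightarrow> ('g \<Rightarrow> ennreal) \<Rightarrow> ('f \<Rightarrow> 'g) \<Rightarrow> bool" where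
  "bounded_operator X norm_X Y norm_Y T \<longleftrightarrow>
     T ` X \<subseteq> Y \<and> (\<exists>C::real. \<forall>f\<in>X. norm_Y (T f) \<le> ennreal C * norm_X f)"

(* Infinite when no finite constant is admissible. *)
definition operator_norm ::
    "'f set \<Rightarrow> ('f \<Rightarrow> ennreal) \<Rightarrow> ('g \<Rightarrow> ennreal) \<Rightarrow> ('f \<Rightarrow> 'g) \<Rightarrow> ennreal" where
  "operator_norm X norm_X norm_Y T = Inf {C. \<forall>f\<in>X. norm_Y (T f) \<le> C * norm_X f}"

definition carleson_measure ::
    "real \<Rightarrow> real \<Rightarrow> (complex \<Rightarrow> real) \<Rightarrow> complex measure \<Rightarrow> bool" where
  "carleson_measure q p \<omega> \<mu> \<longleftrightarrow>
     bounded_operator (bergman p \<omega>) (Lp_norm (weighted \<omega>) p) (Lp \<mu> q) (Lp_norm \<mu> q) id"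

definition embedding_norm ::
    "real \<Rightarrow> real \<Rightarrow> (complex \<Rightarrow> real) \<Rightarrow> complex measure \<Rightarrow> ennreal" where
  "embedding_norm q p \<omega> \<mu> =
     operator_norm (bergman p \<omega>) (Lp_norm (weighted \<omega>) p) (Lp_norm \<mu> q) id"

definition hormander_maximal ::
    "(complex \<Rightarrow> real) \<Rightarrow> (complex \<Rightarrow> 'b::real_normed_vector) \<Rightarrow> complex \<Rightarrow> ennreal" where
  "hormander_maximal \<omega> \<phi> z =
     (SUP S\<in>{S \<in> carleson_squares. z \<in> S}.
        (\<integral>\<^sup>+\<zeta>\<in>S. ennreal (norm (\<phi> \<zeta>)) \<partial>weighted \<omega>) / emeasure (weighted \<omega>) S)"

definition maximal_operator ::
    "(complex \<Rightarrow> real) \<Rightarrow> real \<Rightarrow> (complex \<Rightarrow> complex) \<Rightarrow> complex \<Rightarrow> ennreal" where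
  "maximal_operator \<omega> \<alpha> \<phi> z =
     epowr (hormander_maximal \<omega> (\<lambda>\<zeta>. norm (\<phi> \<zeta>) powr (1 / \<alpha>)) z) \<alpha>"

definition maximal_bounded ::
    "real \<Rightarrow> real \<Rightarrow> (complex \<Rightarrow> real) \<Rightarrow> real \<Rightarrow> complex measure \<Rightarrow> bool" where
  "maximal_bounded q p \<omega> \<alpha> \<mu> \<longleftrightarrow>
     bounded_operator (Lp (weighted \<omega>) p) (Lp_norm (weighted \<omega>) p)
       (eLp \<mu> q) (eLp_norm \<mu> q) (maximal_operator \<omega> \<alpha>)"

definition maximal_norm ::
    "real \<Rightarrow> real \<Rightarrow> (complex \<Rightarrow> real) \<Rightarrow> real \<Rightarrow> complex measure \<Rightarrow> ennreal" where
  "maximal_norm q p \<omega> \<alpha> \<mu> =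
     operator_norm (Lp (weighted \<omega>) p) (Lp_norm (weighted \<omega>) p)
       (eLp_norm \<mu> q) (maximal_operator \<omega> \<alpha>)"

definition carleson_sup ::
    "real \<Rightarrow> real \<Rightarrow> (complex \<Rightarrow> real) \<Rightarrow> complex measure \<Rightarrow> ennreal" where
  "carleson_sup q p \<omega> \<mu> =
     (SUP S\<in>carleson_squares. emeasure \<mu> S / epowr (emeasure (weighted \<omega>) S) (q / p))"

definition disc_borel_measures :: "complex measure set" where
  "disc_borel_measures = {\<mu>. sets \<mu> = sets (restrict_space borel disc)}"

definition comparable_on :: "'m set \<Rightarrow> ('m \<Rightarrow> ennreal) \<Rightarrow> ('m \<Rightarrow> ennreal) \<Rightarrow> bool" where
  "comparable_on A X Y \<longleftrightarrow>
     (\<exists>c>0. \<exists>C>0. \<forall>\<mu>\<in>A. ennreal c * Y \<mu> \<le> X \<mu> \<and> X \<mu> \<le> ennreal C * Y \<mu>)"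

end

theory Submission
  imports Defs "HOL-Complex_Analysis.Complex_Analysis"
begin

text \<open>
  The three quantities bound each other in a cycle: the embedding norm is at most a constant times
  the norm of the maximal operator, the q-th power of that norm is at most a constant times the
  supremum of \<open>\<mu>(S) / \<omega>(S)^(q/p)\<close>, and this supremum is at most a constant times the q-th power of
  the embedding norm. The equivalences and both comparabilities follow by going round the cycle.
  The weight \<open>\<omega>\<close> is related to a radial weight \<open>\<nu>\<close> whose tails lose at most a factor \<open>c\<close> when the
  distance to the boundary is halved; it is this geometric growth that every argument has to beat.

  \<^emph>\<open>Embedding by maximal operator.\<close> For every \<open>\<gamma> > 0\<close> a holomorphic \<open>f\<close> satisfies
  \<open>|f|^\<gamma> \<le> C M(|f|^\<gamma>)\<close> pointwise (\<open>B_infty_pointwise_estimate\<close>). Cauchy's formula bounds \<open>|f(z)|^b\<close> by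
  the average of \<open>|f|^b\<close> over a circle against the kernel \<open>(1-|z|)^N / |w-z|^(N+1)\<close>, with \<open>N\<close>
  arbitrary (\<open>powr_norm_le_circle_average\<close>). As \<open>\<nu>\<close> is invariant under rotations, integrating the
  circle estimate against \<open>\<nu>\<close> turns circles into an annulus. Cut into dyadic Carleson squares around
  \<open>z\<close>, the kernel decays like \<open>2^(-nN)\<close>, which for large \<open>N\<close> beats the growth of the \<open>\<nu>\<close>-masses; so
  \<open>|f|^b \<le> C M_\<nu>(|f|^b)\<close> (\<open>radial_pointwise_estimate\<close>). The \<open>B_s\<close> condition and the inequality of
  Hoelder replace \<open>\<nu>\<close>-means by \<open>\<omega>\<close>-means (\<open>quotient_in_B_transfer\<close>).

  \<^emph>\<open>Maximal operator by supremum.\<close> The same transfer, applied to indicator functions, shows that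
  \<open>\<omega>\<close> is doubling on Carleson squares (\<open>B_infty_tent_doubling\<close>). Hence the covering lemma of Vitali
  gives a weak type bound from \<open>\<omega>\<close> to \<open>\<mu>\<close>, in which \<open>q \<ge> p\<close> enters through
  \<open>\<Sum> x^(q/p) \<le> (\<Sum> x)^(q/p)\<close> (\<open>hormander_maximal_weak_type\<close>). Truncation and the layer cake formula
  improve it to a strong type bound at the exponent \<open>p \<alpha> > 1\<close> (\<open>hormander_maximal_strong_type\<close>).

  \<^emph>\<open>Supremum by embedding.\<close> The functions \<open>((1-|a|) / (1 - cnj a z))^N\<close> are of size one on the
  square \<open>S(a)\<close>, and for large \<open>N\<close> the doubling of \<open>\<omega>\<close> bounds their norms by \<open>\<omega>(S(a))^(1/p)\<close>
  (\<open>carleson_sup_le_embedding_norm\<close>).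
\<close>

section \<open>Powers of holomorphic functions on circles\<close>

text \<open>Because \<open>z * cnj z = 1\<close> on the unit circle, powers of \<open>z\<close> cancel against powers of \<open>cnj z\<close>. This is
  what makes the real parts of polynomials closed under multiplication there.\<close>

lemma poly_times_cnj_poly_on_circle:
  "\<exists>a b. \<forall>z. norm z = 1 \<longrightarrow> poly p z * cnj (poly q z) = poly a z + cnj (poly b z)"
  for p q :: "complex poly"
proof (induction p arbitrary: q)
  case 0
  show ?case by (rule exI[of _ 0], rule exI[of _ 0]) simp
next
  case (pCons c p)
  obtain d q' where q: "q = pCons d q'" by (cases q)
  obtain a b where ab: "\<And>z. norm z = 1 \<Longrightarrow> poly p z * cnj (poly q' z) = poly a z + cnj (poly b z)"
    using pCons.IH by blast
  have "poly (pCons c p) z * cnj (poly q z) =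
      poly (a + pCons (c * cnj d) (smult (cnj d) p)) z + cnj (poly (b + pCons 0 (smult (cnj c) q')) z)"
    if "norm z = 1" for z
  proof -
    have "z * cnj z = 1" using that by (simp add: complex_norm_square[symmetric])
    then have "(c + z * P) * cnj (d + z * Q) =
        P * cnj Q + (c * cnj d + z * (cnj d * P)) + cnj (z * (cnj c * Q))" for P Q
      by (simp add: algebra_simps)
    then show ?thesis using ab[OF that] by (simp add: q)
  qed
  then show ?case by blast
qed

text \<open>The theorem of Stone and Weierstrass for the algebra of real parts of polynomials; \<open>Re z\<close> and
  \<open>Im z = Re (- \<i> z)\<close> separate points.\<close>

lemma Re_poly_dense_on_circle:
  fixes u :: "complex \<Rightarrow> real"
  assumes "continuous_on (sphere 0 1) u" "0 < e"
  obtains p where "\<And>z. norm z = 1 \<Longrightarrow> \<bar>u z - Re (poly p z)\<bar> < e"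
proof -
  define P where "P f \<longleftrightarrow> (\<exists>p. \<forall>z\<in>sphere 0 1. f z = Re (poly p z))" for f :: "complex \<Rightarrow> real"
  have "\<exists>g. P g \<and> (\<forall>x\<in>sphere 0 1. \<bar>u x - g x\<bar> < e)"
  proof (rule Stone_Weierstrass_HOL)
    show "P (\<lambda>x. c)" for c
      unfolding P_def by (rule exI[of _ "[:of_real c:]"]) simp
    show "continuous_on (sphere 0 1) f" if Pf: "P f" for f
    proof -
      obtain p where p: "\<And>z. z \<in> sphere 0 1 \<Longrightarrow> f z = Re (poly p z)" using Pf P_def by blast
      have "continuous_on (sphere 0 1) (\<lambda>z. Re (poly p z))" by (intro continuous_intros)
      then show ?thesis by (rule continuous_on_eq) (use p in metis)
    qed
    show "P (\<lambda>x. f x + g x)" if "P f \<and> P g" for f g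
    proof -
      from that obtain p r where "\<forall>z\<in>sphere 0 1. f z = Re (poly p z)" "\<forall>z\<in>sphere 0 1. g z = Re (poly r z)"
        unfolding P_def by blast
      then show ?thesis unfolding P_def by (intro exI[of _ "p + r"]) simp
    qed
    show "P (\<lambda>x. f x * g x)" if "P f \<and> P g" for f g
    proof -
      from that obtain p r where p: "\<And>z. z\<in>sphere 0 1 \<Longrightarrow> f z = Re (poly p z)"
        and r: "\<And>z. z\<in>sphere 0 1 \<Longrightarrow> g z = Re (poly r z)"
        unfolding P_def by blast
      obtain a b where ab: "\<And>z. norm z = 1 \<Longrightarrow> poly p z * cnj (poly r z) = poly a z + cnj (poly b z)"
        using poly_times_cnj_poly_on_circle by blast
      have "f z * g z = Re (poly (smult (1/2) (p * r + a + b)) z)" if z: "z \<in> sphere 0 1" for z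
      proof -
        have "norm z = 1" using z by simp
        from arg_cong[OF ab[OF this], of Re] have "Re (poly p z * cnj (poly r z)) = Re (poly a z) + Re (poly b z)"
          by (simp del: complex_cnj)
        moreover have "Re x * Re y = (Re (x * y) + Re (x * cnj y)) / 2" for x y by simp
        ultimately have "f z * g z = (Re (poly p z * poly r z) + (Re (poly a z) + Re (poly b z))) / 2"
          using p[OF z] r[OF z] by (simp del: times_complex.simps)
        then show ?thesis by simp
      qed
      then show ?thesis unfolding P_def by blast
    qed
    show "\<exists>f. P f \<and> f x \<noteq> f y" if "x \<in> sphere 0 1 \<and> y \<in> sphere 0 1 \<and> x \<noteq> y" for x y
    proof (cases "Re x = Re y")
      case True
      then have "Im x \<noteq> Im y" using that complex_eqI by blast
      moreover have "P Im" unfolding P_def by (rule exI[of _ "[:0, -\<i>:]"]) simp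
      ultimately show ?thesis by blast
    next
      case False
      moreover have "P Re" unfolding P_def by (rule exI[of _ "[:0, 1:]"]) simp
      ultimately show ?thesis by blast
    qed
  qed (use assms in auto)
  then show ?thesis using that unfolding P_def by force
qed

text \<open>Powers of a holomorphic function with zeros are not holomorphic, but those of \<open>exp p\<close> are. Here
  \<open>Re p\<close> approximates \<open>ln (|F| + e)\<close> from above on the circle, and the maximum principle for
  \<open>F exp (- p)\<close> carries the majorization into the disc.\<close>

lemma zero_free_majorant:
  assumes contF: "continuous_on (cball 0 1) F" and holF: "F holomorphic_on (ball 0 1)" and e: "0 < e"
  obtains p :: "complex poly" where
    "\<And>z. norm z < 1 \<Longrightarrow> norm (F z) \<le> exp (Re (poly p z))"
    "\<And>z. norm z = 1 \<Longrightarrow> exp (Re (poly p z)) \<le> (1 + e) * (norm (F z) + e)"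
proof -
  define d where "d = ln (1 + e) / 2"
  have d: "d > 0" "exp (2*d) = 1 + e" using e by (auto simp: d_def ln_gt_zero)
  have "continuous_on (sphere 0 1) (\<lambda>z. ln (norm (F z) + e) + d)"
    using e by (intro continuous_intros continuous_on_subset[OF contF]) (auto simp: add_nonneg_eq_0_iff)
  from Re_poly_dense_on_circle[OF this d(1)] obtain p where
    p: "\<And>z. norm z = 1 \<Longrightarrow> \<bar>ln (norm (F z) + e) + d - Re (poly p z)\<bar> < d" by blast
  have lo: "norm (F z) \<le> exp (Re (poly p z))" if "norm z = 1" for z
  proof -
    have "ln (norm (F z) + e) \<le> Re (poly p z)" using p[OF that] by linarith
    then have "exp (ln (norm (F z) + e)) \<le> exp (Re (poly p z))" by simp
    moreover have "norm (F z) + e > 0" using e by (simp add: add_nonneg_pos)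
    ultimately show ?thesis using e by simp
  qed
  have hi: "exp (Re (poly p z)) \<le> (1 + e) * (norm (F z) + e)" if "norm z = 1" for z
  proof -
    have "Re (poly p z) \<le> 2*d + ln (norm (F z) + e)" using p[OF that] by linarith
    then have "exp (Re (poly p z)) \<le> exp (2*d + ln (norm (F z) + e))" by simp
    also have "\<dots> = (1 + e) * (norm (F z) + e)" using e d by (simp add: exp_add add_nonneg_pos)
    finally show ?thesis .
  qed
  have "norm (F z) \<le> exp (Re (poly p z))" if z: "norm z < 1" for z
  proof -
    define g where "g w = F w * exp (- poly p w)" for w
    have "norm (g z) \<le> 1"
    proof (rule maximum_modulus_frontier[of g "cball 0 1"])
      show "g holomorphic_on interior (cball 0 1)" using holF unfolding g_def
        by (auto intro!: holomorphic_intros)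
      show "continuous_on (closure (cball 0 1)) g" using contF unfolding g_def
        by (auto intro!: continuous_intros)
      show "norm (g w) \<le> 1" if "w \<in> frontier (cball 0 1)" for w
      proof -
        have "norm w = 1" using that by simp
        from lo[OF this] show ?thesis by (simp add: g_def norm_mult norm_divide exp_minus divide_simps)
      qed
    qed (use z in auto)
    then show ?thesis by (simp add: g_def norm_mult norm_divide exp_minus divide_simps)
  qed
  then show ?thesis using hi that by blast
qed

lemma norm_le_circle_integral:
  assumes contG: "continuous_on (cball 0 1) G" and holG: "G holomorphic_on (ball 0 1)" and z: "norm z < 1"
  shows "norm (G z) \<le> integral {0..1} (\<lambda>t. norm (G (cis (2*pi*t))) / norm (cis (2*pi*t) - z))"
proof -
  have nz: "cis s \<noteq> z" for s using z by (metis norm_cis less_irrefl)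
  have "((\<lambda>u. G u/(u-z)) has_contour_integral (2 * of_real pi * \<i> * G z)) (circlepath 0 1)"
    by (rule Cauchy_integral_circlepath) (use assms in auto)
  then have hi: "((\<lambda>t. 2 * of_real pi * \<i> * (G (cis (2*pi*t)) / (cis (2*pi*t) - z) * cis (2*pi*t)))
      has_integral (2 * of_real pi * \<i> * G z)) {0..1}"
    unfolding has_contour_integral_def
  proof (rule has_integral_eq[rotated])
    fix t :: real assume "t \<in> {0..1}"
    moreover have "circlepath 0 1 t = cis (2*pi*t)"
      by (simp add: circlepath cis_conv_exp mult_ac)
    ultimately show "G (circlepath 0 1 t) / (circlepath 0 1 t - z) * vector_derivative (circlepath 0 1) (at t within {0..1}) =
        2 * of_real pi * \<i> * (G (cis (2*pi*t)) / (cis (2*pi*t) - z) * cis (2*pi*t))"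
      by (simp add: vector_derivative_circlepath01 cis_conv_exp mult_ac)
  qed
  have cont: "continuous_on {0..1} (\<lambda>t. G (cis (2*pi*t)) / (cis (2*pi*t) - z) * cis (2*pi*t))"
    using nz by (intro continuous_intros continuous_on_compose2[OF contG]) auto
  have cont': "continuous_on {0..1} (\<lambda>t. norm (G (cis (2*pi*t))) / norm (cis (2*pi*t) - z))"
    using nz by (intro continuous_intros continuous_on_compose2[OF contG]) auto
  from has_integral_mult_right[OF hi, of "1/(2 * of_real pi * \<i>)"]
  have "((\<lambda>t. G (cis (2*pi*t)) / (cis (2*pi*t) - z) * cis (2*pi*t)) has_integral G z) {0..1}"
    by simp
  then have "G z = integral {0..1} (\<lambda>t. G (cis (2*pi*t)) / (cis (2*pi*t) - z) * cis (2*pi*t))"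
    by (simp add: integral_unique)
  also have "norm \<dots> \<le> integral {0..1} (\<lambda>t. norm (G (cis (2*pi*t))) / norm (cis (2*pi*t) - z))"
  proof (rule integral_norm_bound_integral)
    show "(\<lambda>t. G (cis (2*pi*t)) / (cis (2*pi*t) - z) * cis (2*pi*t)) integrable_on {0..1}"
      using cont by (rule integrable_continuous_real)
    show "(\<lambda>t. norm (G (cis (2*pi*t))) / norm (cis (2*pi*t) - z)) integrable_on {0..1}"
      using cont' by (rule integrable_continuous_real)
  qed (simp add: norm_mult norm_divide)
  finally show ?thesis .
qed

text \<open>A kernel that decays to any prescribed order takes the place of the Poisson kernel. The factor
  \<open>((1 - |z|^2) / (1 - cnj z w))^N\<close> equals one at \<open>w = z\<close>, and on the circle, where
  \<open>|1 - cnj z w| = |w - z|\<close>, it has the modulus that appears in the kernel. Cauchy's formula at \<open>z\<close> is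
  applied to its product with the \<open>b\<close>-th power of a zero-free majorant of \<open>F\<close>.\<close>

lemma powr_norm_le_kernel_integral:
  assumes contF: "continuous_on (cball 0 1) F" and holF: "F holomorphic_on (ball 0 1)"
    and z: "norm z < 1" and b: "0 < b"
  shows "norm (F z) powr b \<le> integral {0..1} (\<lambda>t. norm (F (cis (2*pi*t))) powr b *
           ((1 - (norm z)\<^sup>2)^N / norm (cis (2*pi*t) - z)^(N+1)))"
proof -
  have nz: "cis s \<noteq> z" for s using z by (metis norm_cis less_irrefl)
  define K where "K t = (1 - (norm z)\<^sup>2)^N / norm (cis (2*pi*t) - z)^(N+1)" for t
  have K0: "0 \<le> K t" for t unfolding K_def using z by (intro divide_nonneg_nonneg zero_le_power) (auto simp: power_le_one)
  have contK: "continuous_on A K" for A unfolding K_def using nz by (intro continuous_intros) auto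
  \<comment> \<open>\<open>F\<close> may vanish on the circle, so the logarithm forces \<open>e > 0\<close>; the bound \<open>J e\<close> extends continuously
    to \<open>e = 0\<close>.\<close>
  define J where "J e = integral {0..1} (\<lambda>t. ((1 + e) * (norm (F (cis (2*pi*t))) + e)) powr b * K t)" for e
  have le: "norm (F z) powr b \<le> J e" if e: "0 < e" for e
  proof -
    obtain p where p1: "\<And>z. norm z < 1 \<Longrightarrow> norm (F z) \<le> exp (Re (poly p z))"
      and p2: "\<And>z. norm z = 1 \<Longrightarrow> exp (Re (poly p z)) \<le> (1 + e) * (norm (F z) + e)"
      using zero_free_majorant[OF contF holF e] by blast
    define G where "G w = exp (of_real b * poly p w) * ((1 - (norm z)\<^sup>2) / (1 - cnj z * w))^N" for w
    have nz': "1 - cnj z * w \<noteq> 0" if "norm w \<le> 1" for w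
    proof
      assume "1 - cnj z * w = 0"
      then have "norm (cnj z * w) = 1" by (metis eq_iff_diff_eq_0 norm_one)
      moreover have "norm (cnj z * w) \<le> norm z * 1"
        unfolding norm_mult using that by (intro mult_mono) auto
      ultimately show False using z by simp
    qed
    have "norm (G z) = norm (exp (of_real b * poly p z))"
    proof -
      have "1 - cnj z * z = of_real (1 - (norm z)\<^sup>2)"
        by (simp only: of_real_diff complex_norm_square) (simp add: mult.commute)
      moreover have "1 - (norm z)\<^sup>2 \<noteq> 0" using z by (metis abs_norm_cancel abs_square_less_1 eq_iff_diff_eq_0 less_irrefl)
      ultimately have "of_real (1 - (norm z)\<^sup>2) / (1 - cnj z * z) = (1::complex)"
        by (metis divide_self_if of_real_eq_0_iff)
      then show ?thesis by (simp add: G_def)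
    qed
    also have "\<dots> = exp (Re (poly p z)) powr b" by (simp add: exp_powr_real mult.commute)
    also have "\<dots> \<ge> norm (F z) powr b" using p1[OF z] b by (intro powr_mono2) auto
    finally have "norm (F z) powr b \<le> norm (G z)" .
    also have "norm (G z) \<le> integral {0..1} (\<lambda>t. norm (G (cis (2*pi*t))) / norm (cis (2*pi*t) - z))"
    proof (rule norm_le_circle_integral[OF _ _ z])
      show "continuous_on (cball 0 1) G" unfolding G_def using nz' by (intro continuous_intros) auto
      show "G holomorphic_on ball 0 1" unfolding G_def using nz' by (intro holomorphic_intros) auto
    qed
    also have "\<dots> \<le> J e" unfolding J_def
    proof (rule integral_le)
      show "(\<lambda>t. norm (G (cis (2*pi*t))) / norm (cis (2*pi*t) - z)) integrable_on {0..1}"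
        using nz nz' unfolding G_def by (intro integrable_continuous_real continuous_intros) auto
      show "(\<lambda>t. ((1 + e) * (norm (F (cis (2*pi*t))) + e)) powr b * K t) integrable_on {0..1}"
        using e b by (intro integrable_continuous_real continuous_intros contK continuous_on_compose2[OF contF] continuous_on_powr')
          auto
      fix t :: real assume "t \<in> {0..1}"
      define w where "w = cis (2*pi*t)"
      have w: "norm w = 1" by (simp add: w_def)
      have "norm (1 - cnj z * w) = norm (cnj w - cnj z)"
      proof -
        have "1 - cnj z * w = w * (cnj w - cnj z)"
          using w by (simp add: algebra_simps complex_norm_square[symmetric])
        then show ?thesis using w by (simp add: norm_mult)
      qed
      also have "\<dots> = norm (w - z)" by (metis complex_cnj_diff complex_mod_cnj)
      finally have nw: "norm (1 - cnj z * w) = norm (w - z)" .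
      have "norm (of_real (1 - (norm z)\<^sup>2) :: complex) = 1 - (norm z)\<^sup>2"
        unfolding norm_of_real using z by (simp add: power_le_one)
      then have "norm (G w) = exp (Re (poly p w)) powr b * ((1 - (norm z)\<^sup>2)^N / norm (w - z)^N)"
        unfolding G_def norm_mult norm_power norm_divide nw by (simp only: power_divide) (simp add: exp_powr_real mult.commute)
      then have "norm (G w) / norm (w - z) = exp (Re (poly p w)) powr b * K t"
        by (simp add: K_def w_def)
      also have "\<dots> \<le> ((1 + e) * (norm (F w) + e)) powr b * K t"
        using p2[OF w] b K0 by (intro mult_right_mono powr_mono2) auto
      finally show "norm (G (cis (2*pi*t))) / norm (cis (2*pi*t) - z) \<le>
          ((1 + e) * (norm (F (cis (2*pi*t))) + e)) powr b * K t" by (simp add: w_def)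
    qed
    finally show ?thesis .
  qed
  have "continuous_on {0..1} (\<lambda>e. integral (cbox 0 1)
      (\<lambda>t. ((1 + e) * (norm (F (cis (2*pi*t))) + e)) powr b * K t))"
  proof (rule integral_continuous_on_param)
    show "continuous_on ({0..1} \<times> cbox 0 1) (\<lambda>(e, t). ((1 + e) * (norm (F (cis (2*pi*t))) + e)) powr b * K t)"
      unfolding case_prod_unfold using b
      by (intro continuous_intros continuous_on_compose2[OF contK] continuous_on_compose2[OF contF] continuous_on_powr')
        auto
  qed
  then have "continuous_on {0..1} J" by (simp add: J_def[abs_def])
  then have "(J \<longlongrightarrow> J 0) (at 0 within {0..1})" by (simp add: continuous_on_def)
  then have "(J \<longlongrightarrow> J 0) (at_right 0)"
    by (simp add: at_within_Icc_at_right)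
  moreover have "\<forall>\<^sub>F e in at_right 0. norm (F z) powr b \<le> J e"
    using eventually_at_right_less[of 0] by eventually_elim (use le in auto)
  ultimately have "norm (F z) powr b \<le> J 0"
    by (intro tendsto_lowerbound) auto
  then show ?thesis by (simp add: J_def K_def)
qed

text \<open>The circle appears here as the orbit of a point \<open>\<zeta>\<close> under rotations, which is the form that can be
  integrated against a radial weight. The constant comes from
  \<open>1 - |z|^2 / |\<zeta>|^2 \<le> 1 - |z|^2 \<le> 2 (1 - |z|)\<close>.\<close>

lemma powr_norm_le_circle_average:
  assumes hol: "f holomorphic_on disc" and z: "norm z < norm \<zeta>" "norm \<zeta> < 1" and b: "0 < b"
  shows "ennreal (norm (f z) powr b) \<le> (\<integral>\<^sup>+t\<in>{0..1}. ennreal (norm (f (\<zeta> * cis (2*pi*t))) powr b *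
           ((2 * (1 - norm z))^N / norm (\<zeta> * cis (2*pi*t) - z)^(N+1))) \<partial>lborel)"
proof -
  have \<zeta>: "\<zeta> \<noteq> 0" using z by auto
  have nz: "\<zeta> * cis s \<noteq> z" for s using z by (auto simp: norm_mult)
  define F where "F w = f (\<zeta> * w)" for w
  have sub: "(\<lambda>w. \<zeta> * w) ` cball 0 1 \<subseteq> disc"
  proof
    fix x assume "x \<in> (\<lambda>w. \<zeta> * w) ` cball 0 1"
    then obtain w where "x = \<zeta> * w" "norm w \<le> 1" by (metis imageE mem_cball_0)
    then have "norm x \<le> norm \<zeta> * 1" unfolding \<open>x = _\<close> norm_mult by (intro mult_left_mono) auto
    then show "x \<in> disc" using z by simp
  qed
  have holF: "F holomorphic_on cball 0 1"
    unfolding F_def using holomorphic_on_compose_gen[OF _ hol, of "\<lambda>w. \<zeta> * w" "cball 0 1"] sub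
    by (auto simp: o_def intro!: holomorphic_intros)
  have contF: "continuous_on (cball 0 1) F" using holF holomorphic_on_imp_continuous_on by blast
  have z1: "norm (z / \<zeta>) < 1" using z \<zeta> by (simp add: norm_divide)
  have c: "continuous_on {0..1} (\<lambda>t. norm (f (\<zeta> * cis (2*pi*t))) powr b *
           ((2 * (1 - norm z))^N / norm (\<zeta> * cis (2*pi*t) - z)^(N+1)))"
  proof -
    have "continuous_on {0..1} (\<lambda>t. F (cis (2*pi*t)))"
      by (intro continuous_on_compose2[OF contF] continuous_intros) auto
    then show ?thesis unfolding F_def using nz b
      by (intro continuous_intros continuous_on_powr') auto
  qed
  have "norm (F (z/\<zeta>)) powr b \<le> integral {0..1} (\<lambda>t. norm (F (cis (2*pi*t))) powr b *
           ((1 - (norm (z/\<zeta>))\<^sup>2)^N / norm (cis (2*pi*t) - z/\<zeta>)^(N+1)))"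
    by (rule powr_norm_le_kernel_integral[OF contF _ z1 b]) (rule holomorphic_on_subset[OF holF], auto)
  also have "\<dots> \<le> integral {0..1} (\<lambda>t. norm (f (\<zeta> * cis (2*pi*t))) powr b *
           ((2 * (1 - norm z))^N / norm (\<zeta> * cis (2*pi*t) - z)^(N+1)))"
  proof (rule integral_le)
    have nz2: "cis s \<noteq> z/\<zeta>" for s using nz[of s] \<zeta> by (auto simp: field_simps)
    show "(\<lambda>t. norm (F (cis (2*pi*t))) powr b *
           ((1 - (norm (z/\<zeta>))\<^sup>2)^N / norm (cis (2*pi*t) - z/\<zeta>)^(N+1))) integrable_on {0..1}"
      using nz2 b by (intro integrable_continuous_real continuous_intros continuous_on_compose2[OF contF] continuous_on_powr') auto
    show "(\<lambda>t. norm (f (\<zeta> * cis (2*pi*t))) powr b *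
           ((2 * (1 - norm z))^N / norm (\<zeta> * cis (2*pi*t) - z)^(N+1))) integrable_on {0..1}"
      using c by (rule integrable_continuous_real)
    fix t :: real assume "t \<in> {0..1}"
    define w where "w = cis (2*pi*t)"
    have e: "norm (\<zeta> * w - z) = norm \<zeta> * norm (w - z/\<zeta>)"
      using \<zeta> by (simp add: norm_mult[symmetric] right_diff_distrib)
    have pos: "norm (\<zeta> * w - z) > 0" using nz by (simp add: w_def)
    have "(norm z)\<^sup>2 \<le> (norm (z/\<zeta>))\<^sup>2"
      using z \<zeta> by (intro power_mono) (auto simp: norm_divide field_simps mult_left_le_one_le mult_left_le)
    moreover have "1 - (norm z)\<^sup>2 \<le> 2 * (1 - norm z)"
      using zero_le_power2[of "1 - norm z"] by (simp add: power2_eq_square algebra_simps)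
    ultimately have 1: "1 - (norm (z/\<zeta>))\<^sup>2 \<le> 2 * (1 - norm z)" by linarith
    have 2: "0 \<le> 1 - (norm (z/\<zeta>))\<^sup>2" using z1 by (simp add: power_le_one)
    have "norm (\<zeta> * w - z) ^ (N+1) \<le> norm (w - z/\<zeta>) ^ (N+1)"
      unfolding e using z by (intro power_mono mult_left_le_one_le) auto
    then have "(1 - (norm (z/\<zeta>))\<^sup>2)^N / norm (w - z/\<zeta>)^(N+1) \<le> (2 * (1 - norm z))^N / norm (\<zeta> * w - z)^(N+1)"
    proof (rule frac_le[rotated 3])
      show "(1 - (norm (z/\<zeta>))\<^sup>2)^N \<le> (2 * (1 - norm z))^N" using 1 2 by (rule power_mono)
      show "0 \<le> (2 * (1 - norm z))^N" using z by (intro zero_le_power) auto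
      show "0 < norm (\<zeta> * w - z)^(N+1)" using pos by (rule zero_less_power)
    qed
    then show "norm (F (cis (2*pi*t))) powr b * ((1 - (norm (z/\<zeta>))\<^sup>2)^N / norm (cis (2*pi*t) - z/\<zeta>)^(N+1))
       \<le> norm (f (\<zeta> * cis (2*pi*t))) powr b * ((2 * (1 - norm z))^N / norm (\<zeta> * cis (2*pi*t) - z)^(N+1))"
      unfolding F_def w_def by (intro mult_left_mono) auto
  qed
  finally have "ennreal (norm (F (z/\<zeta>)) powr b) \<le> ennreal (integral {0..1} (\<lambda>t. norm (f (\<zeta> * cis (2*pi*t))) powr b *
           ((2 * (1 - norm z))^N / norm (\<zeta> * cis (2*pi*t) - z)^(N+1))))" by (rule ennreal_leI)
  also have "ennreal (integral {0..1} (\<lambda>t. norm (f (\<zeta> * cis (2*pi*t))) powr b *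
           ((2 * (1 - norm z))^N / norm (\<zeta> * cis (2*pi*t) - z)^(N+1)))) = (\<integral>\<^sup>+t\<in>{0..1}. ennreal (norm (f (\<zeta> * cis (2*pi*t))) powr b *
           ((2 * (1 - norm z))^N / norm (\<zeta> * cis (2*pi*t) - z)^(N+1))) \<partial>lborel)"
    (is "ennreal (integral _ ?h) = _")
  proof -
    have h0: "0 \<le> ?h t" for t using z
      by (intro mult_nonneg_nonneg divide_nonneg_nonneg zero_le_power) auto
    have "set_integrable lborel {0..1} ?h"
      using c by (intro borel_integrable_atLeastAtMost') auto
    from set_borel_integral_eq_integral[OF this] this
    have e1: "integral {0..1} ?h = (LINT t:{0..1}|lborel. ?h t)" by simp
    have e2: "ennreal (LINT t:{0..1}|lborel. ?h t) = (\<integral>\<^sup>+t. ennreal (indicator {0..1} t *\<^sub>R ?h t) \<partial>lborel)"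
      using \<open>set_integrable lborel {0..1} ?h\<close>
      unfolding set_lebesgue_integral_def set_integrable_def
      by (intro nn_integral_eq_integral[symmetric] AE_I2 scaleR_nonneg_nonneg h0) (assumption, simp)
    have e3: "(\<integral>\<^sup>+t. ennreal (indicator {0..1} t *\<^sub>R ?h t) \<partial>lborel) = (\<integral>\<^sup>+t\<in>{0..1}. ennreal (?h t) \<partial>lborel)"
    proof (rule nn_integral_cong)
      fix t :: real
      have "ennreal (indicator {0..1} t *\<^sub>R y) = ennreal y * indicator {0..1} t" for y :: real
        by (cases "t \<in> {0..1}") simp_all
      then show "ennreal (indicator {0..1} t *\<^sub>R ?h t) = ennreal (?h t) * indicator {0..1} t" .
    qed
    show ?thesis by (simp only: e1 e2 e3)
  qed
  moreover have "F (z/\<zeta>) = f z" using \<zeta> by (simp add: F_def)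
  ultimately show ?thesis by (simp only:)
qed

section \<open>Geometry of Carleson squares\<close>

lemma abs_Arg_cis_le: "\<bar>Arg (cis t)\<bar> \<le> \<bar>t\<bar>"
proof (cases "t \<in> {-pi<..pi}")
  case True
  then show ?thesis by (simp add: Arg_cis)
next
  case False
  then have "pi \<le> \<bar>t\<bar>" by auto
  then show ?thesis using Arg_bounded[of "cis t"] by linarith
qed

lemma mem_carleson_square_iff:
  assumes "a \<noteq> 0"
  shows "z \<in> carleson_square a \<longleftrightarrow>
    norm a \<le> norm z \<and> norm z < 1 \<and> \<bar>Arg (a * cnj z)\<bar> \<le> (1 - norm a) / 2"
proof
  assume "z \<in> carleson_square a"
  then obtain r t \<theta> where z: "z = of_real r * cis t" "norm a \<le> r" "r < 1" "cis t = cis \<theta>"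
    and th: "\<bar>Arg (a * cis (- \<theta>))\<bar> \<le> (1 - norm a) / 2"
    using assms by (auto simp: carleson_square_def carleson_arc_def)
  have r: "0 < r" using z(2) assms by (smt (verit) zero_less_norm_iff)
  have "a * cnj z = a * cis (-\<theta>) * of_real r"
    using z(1,4) by (simp add: cis_cnj[symmetric])
  then have "Arg (a * cnj z) = Arg (a * cis (-\<theta>))" using r by (metis Arg_times_of_real2)
  then show "norm a \<le> norm z \<and> norm z < 1 \<and> \<bar>Arg (a * cnj z)\<bar> \<le> (1 - norm a) / 2"
    using z th r by (simp add: norm_mult)
next
  assume z: "norm a \<le> norm z \<and> norm z < 1 \<and> \<bar>Arg (a * cnj z)\<bar> \<le> (1 - norm a) / 2"
  have nz: "norm z > 0" using z assms by (smt (verit) zero_less_norm_iff)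
  have zz: "z = of_real (norm z) * cis (Arg z)" using rcis_cmod_Arg[of z] by (simp add: rcis_def)
  have "a * cnj z = a * cis (- Arg z) * of_real (norm z)"
    by (subst (1) zz) (simp add: cis_cnj)
  then have "Arg (a * cis (- Arg z)) = Arg (a * cnj z)" using nz by (metis Arg_times_of_real2)
  then show "z \<in> carleson_square a"
    using assms z zz unfolding carleson_square_def carleson_arc_def mem_Collect_eq if_not_P[OF assms]
    by metis
qed

lemma carleson_square_0 [simp]: "carleson_square 0 = disc"
  by (simp add: carleson_square_def)

lemma carleson_square_subset_disc: "carleson_square a \<subseteq> disc"
  by (cases "a = 0") (auto simp: mem_carleson_square_iff)

lemma norm_le_of_mem_carleson_square: "z \<in> carleson_square a \<Longrightarrow> norm a \<le> norm z"
  by (cases "a = 0") (auto simp: mem_carleson_square_iff)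

text \<open>The argument jumps on the negative real axis; its cosine does not. So the right-hand side is a
  closed condition, from which Borel measurability of the squares is read off.\<close>

lemma abs_Arg_le_iff_cos:
  assumes "w \<noteq> 0" "0 \<le> c" "c \<le> pi"
  shows "\<bar>Arg w\<bar> \<le> c \<longleftrightarrow> norm w * cos c \<le> Re w"
proof -
  have "Re w = norm w * cos (Arg w)" using rcis_cmod_Arg[of w] by (metis Re_rcis)
  also have "cos (Arg w) = cos \<bar>Arg w\<bar>" by simp
  finally have "Re w = norm w * cos \<bar>Arg w\<bar>" .
  moreover have "\<bar>Arg w\<bar> \<le> pi" using Arg_bounded[of w] by linarith
  then have "cos c \<le> cos \<bar>Arg w\<bar> \<longleftrightarrow> \<bar>Arg w\<bar> \<le> c"
    using assms by (intro cos_mono_le_eq) auto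
  ultimately show ?thesis using assms by simp
qed

lemma mem_carleson_square_iff_Re:
  assumes "a \<in> disc"
  shows "z \<in> carleson_square a \<longleftrightarrow>
    norm a \<le> norm z \<and> norm z < 1 \<and> (a = 0 \<or> norm a * norm z * cos ((1 - norm a) / 2) \<le> Re (a * cnj z))"
proof (cases "a = 0")
  case False
  show ?thesis
  proof (cases "norm a \<le> norm z")
    case True
    then have "a * cnj z \<noteq> 0" using False by auto
    moreover have "(1 - norm a) / 2 \<le> 1" using norm_ge_zero[of a] by (simp del: norm_ge_zero)
    then have "(1 - norm a) / 2 \<le> pi" using pi_gt3 by linarith
    moreover have "0 \<le> (1 - norm a) / 2" using assms by simp
    ultimately have "\<bar>Arg (a * cnj z)\<bar> \<le> (1 - norm a) / 2 \<longleftrightarrow>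
        norm a * norm z * cos ((1 - norm a) / 2) \<le> Re (a * cnj z)"
      using abs_Arg_le_iff_cos[of "a * cnj z" "(1 - norm a) / 2"]
      by (simp add: norm_mult del: times_complex.sel)
    then show ?thesis unfolding mem_carleson_square_iff[OF False] using False by blast
  qed (simp add: mem_carleson_square_iff False)
qed (auto simp: assms)

lemma borel_carleson_square:
  assumes "a \<in> disc" shows "carleson_square a \<in> sets borel"
proof (cases "a = 0")
  case False
  have "carleson_square a = {z. norm a \<le> norm z} \<inter> ball 0 1 \<inter>
      {z. norm a * norm z * cos ((1 - norm a) / 2) \<le> Re (a * cnj z)}"
    using False by (auto simp: mem_carleson_square_iff_Re[OF assms])
  moreover have "closed {z. norm a \<le> norm z}" "closed {z. norm a * norm z * cos ((1 - norm a) / 2) \<le> Re (a * cnj z)}"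
    by (intro closed_Collect_le continuous_intros)+
  ultimately show ?thesis by (auto intro!: sets.Int)
qed simp

text \<open>Moving \<open>a\<close> towards the origin relaxes the radial and the angular condition strictly, hence an open
  set fits between the two squares. Semicontinuity of the maximal function rests on this.\<close>

lemma carleson_square_scale_interior:
  assumes a: "a \<in> disc" "a \<noteq> 0" and t: "0 < t" "t < 1"
  obtains U where "open U" "carleson_square a \<subseteq> U" "U \<subseteq> carleson_square (of_real t * a)"
proof -
  let ?b = "of_real t * a :: complex"
  have nb: "norm ?b = t * norm a" using t by (simp add: norm_mult)
  have tl: "t * norm a < norm a" using a t by simp
  have b: "?b \<in> disc" using less_trans[OF tl, of 1] a nb by simp
  define U where "U = {z. t * norm a < norm z} \<inter> ball 0 1 \<inter>
      {z. norm a * norm z * cos ((1 - t * norm a) / 2) < Re (a * cnj z)}"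
  show ?thesis
  proof
    have "open {z. t * norm a < norm z}" "open {z. norm a * norm z * cos ((1 - t * norm a) / 2) < Re (a * cnj z)}"
      by (intro open_Collect_less continuous_intros)+
    then show "open U" unfolding U_def by (intro open_Int) auto
    show "U \<subseteq> carleson_square ?b"
    proof
      fix z assume "z \<in> U"
      then have z: "t * norm a < norm z" "norm z < 1"
          "norm a * norm z * cos ((1 - t * norm a) / 2) < Re (a * cnj z)" by (auto simp: U_def)
      have "t * (norm a * norm z * cos ((1 - t * norm a) / 2)) \<le> t * Re (a * cnj z)"
        using z(3) t by (intro mult_left_mono) auto
      then have "norm ?b * norm z * cos ((1 - norm ?b) / 2) \<le> Re (?b * cnj z)"
      proof -
        have "Re (?b * cnj z) = t * Re (a * cnj z)" by (simp add: algebra_simps)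
        then show ?thesis using \<open>t * (norm a * norm z * _) \<le> _\<close> by (simp only: nb mult.assoc)
      qed
      then show "z \<in> carleson_square ?b"
        unfolding mem_carleson_square_iff_Re[OF b] using z by (simp add: nb)
    qed
    show "carleson_square a \<subseteq> U"
    proof
      fix z assume z: "z \<in> carleson_square a"
      then have z: "norm a \<le> norm z" "norm z < 1" "norm a * norm z * cos ((1 - norm a) / 2) \<le> Re (a * cnj z)"
        using a by (auto simp: mem_carleson_square_iff_Re)
      have "(1 - t * norm a) / 2 \<le> pi" 
      proof -
        have "0 \<le> t * norm a" using t by simp
        then have "(1 - t * norm a) / 2 \<le> 1" by simp
        then show ?thesis using pi_gt3 by linarith
      qed
      then have "cos ((1 - t * norm a) / 2) < cos ((1 - norm a) / 2)"
        using tl a by (intro cos_monotone_0_pi) auto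
      moreover have "norm a * norm z > 0" using a z(1) by (smt (verit) zero_less_norm_iff mult_pos_pos)
      ultimately have "norm a * norm z * cos ((1 - t * norm a) / 2) < norm a * norm z * cos ((1 - norm a) / 2)"
        by (rule mult_strict_left_mono)
      then show "z \<in> U" unfolding U_def using z tl by auto
    qed
  qed
qed

lemma INT_carleson_square_scale:
  assumes a: "a \<in> disc" "a \<noteq> 0"
  shows "(\<Inter>n. carleson_square (of_real (1 - 1 / (real n + 2)) * a)) = carleson_square a"
proof
  let ?t = "\<lambda>n. 1 - 1 / (real n + 2)"
  have t: "0 < ?t n" "?t n < 1" for n by (auto simp: field_simps)
  show "carleson_square a \<subseteq> (\<Inter>n. carleson_square (of_real (?t n) * a))"
    using carleson_square_scale_interior[OF a t] by blast
  show "(\<Inter>n. carleson_square (of_real (?t n) * a)) \<subseteq> carleson_square a"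
  proof
    fix z assume z: "z \<in> (\<Inter>n. carleson_square (of_real (?t n) * a))"
    have na: "norm (of_real (?t n) * a) = ?t n * norm a" for n
      unfolding norm_mult norm_of_real using t(1)[of n] by simp
    have "norm (of_real (?t n) * a) \<le> norm z \<and> norm z < 1 \<and> \<bar>Arg (of_real (?t n) * a * cnj z)\<bar> \<le> (1 - norm (of_real (?t n) * a)) / 2" for n
      using z a t(1)[of n] by (subst mem_carleson_square_iff[symmetric]) (auto simp del: of_real_diff)
    then have z: "?t n * norm a \<le> norm z" "norm z < 1" "\<bar>Arg (of_real (?t n) * (a * cnj z))\<bar> \<le> (1 - ?t n * norm a) / 2" for n
      unfolding na mult.assoc by auto
    have lim: "?t \<longlonglongrightarrow> 1" by real_asymp
    have "norm a \<le> norm z"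
      by (rule LIMSEQ_le_const2[of "\<lambda>n. ?t n * norm a"]) (use tendsto_mult_right[OF lim, of "norm a"] z(1) in auto)
    moreover have "\<bar>Arg (a * cnj z)\<bar> \<le> (1 - norm a) / 2"
    proof (rule LIMSEQ_le_const[of "\<lambda>n. (1 - ?t n * norm a) / 2"])
      show "(\<lambda>n. (1 - ?t n * norm a) / 2) \<longlonglongrightarrow> (1 - norm a) / 2"
        using tendsto_divide[OF tendsto_diff[OF tendsto_const tendsto_mult_right[OF lim, of "norm a"]] tendsto_const, of 2 1] by simp
      show "\<exists>N. \<forall>n\<ge>N. \<bar>Arg (a * cnj z)\<bar> \<le> (1 - ?t n * norm a) / 2"
        using z(3) t(1) by (metis Arg_times_of_real)
    qed
    ultimately show "z \<in> carleson_square a" using a z(2) by (simp add: mem_carleson_square_iff)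
  qed
qed

lemma norm_1_minus_cis_le: "norm (1 - cis t) \<le> \<bar>t\<bar>"
proof -
  have "norm (1 - cis t) = 2 * \<bar>sin (t/2)\<bar>"
    using dist_exp_i_1[of t] by (simp add: cis_conv_exp norm_minus_commute)
  also have "\<dots> \<le> 2 * \<bar>t/2\<bar>" using abs_sin_le_one abs_sin_x_le_abs_x[of "t/2"] by linarith
  finally show ?thesis by simp
qed

text \<open>Together with the converse inclusion for tents below, this compares Carleson squares with
  Euclidean balls about the boundary point \<open>a / |a|\<close>, to which the covering lemma of Vitali applies.
  For \<open>a = 0\<close> the boundary point is 1, since \<open>Arg 0 = 0\<close>.\<close>

lemma carleson_square_subset_cball:
  assumes "a \<in> disc" shows "carleson_square a \<subseteq> cball (cis (Arg a)) (2 * (1 - norm a))"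
proof
  fix z assume z: "z \<in> carleson_square a"
  show "z \<in> cball (cis (Arg a)) (2 * (1 - norm a))"
  proof (cases "a = 0")
    case True
    then have "norm z < 1" using z by simp
    moreover have "norm (1 - z) \<le> 1 + norm z" by (metis norm_one norm_triangle_ineq4)
    ultimately show ?thesis using True by (simp add: Arg_zero dist_norm)
  next
    case False
    then have z: "norm a \<le> norm z" "norm z < 1" "\<bar>Arg (a * cnj z)\<bar> \<le> (1 - norm a) / 2"
      using z by (auto simp: mem_carleson_square_iff)
    have nz: "z \<noteq> 0" using z False by auto
    have "sgn z * cnj (sgn z) = 1" using nz complex_norm_square[of "sgn z"] by (simp add: norm_sgn)
    then have "sgn z - sgn a = sgn z * (1 - sgn a * cnj (sgn z)) "
      by (simp add: algebra_simps)
    then have "norm (sgn z - sgn a) = norm (1 - sgn a * cnj (sgn z))"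
      using nz by (simp add: norm_mult norm_sgn)
    also have "sgn a * cnj (sgn z) = sgn (a * cnj z)"
      by (simp add: sgn_eq norm_mult)
    also have "\<dots> = cis (Arg (a * cnj z))" using nz False by (simp add: cis_Arg)
    also have "norm (1 - \<dots>) \<le> (1 - norm a) / 2" using norm_1_minus_cis_le z(3) order_trans by blast
    finally have 1: "norm (sgn z - sgn a) \<le> (1 - norm a) / 2" .
    have "z - sgn z = of_real (norm z - 1) * sgn z" using nz by (simp add: sgn_eq left_diff_distrib divide_simps)
    then have 2: "norm (z - sgn z) = 1 - norm z" using nz z by (simp only: norm_mult norm_sgn norm_of_real) simp
    have "norm (z - sgn a) \<le> (1 - norm z) + (1 - norm a) / 2"
      by (rule norm_diff_triangle_le[OF eq_refl[OF 2] 1])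
    moreover have "dist (cis (Arg a)) z = norm (z - sgn a)"
      by (metis cis_Arg[OF False] dist_norm dist_commute)
    moreover have "norm a < 1" using assms by simp
    ultimately have "dist (cis (Arg a)) z \<le> 2 * (1 - norm a)" using z(1) by argo
    then show ?thesis by (simp only: mem_cball)
  qed
qed

text \<open>A Carleson square large enough to hold all points of the disc within distance \<open>d\<close> of the boundary
  point \<open>a / |a|\<close>. The factor 4 leaves room for the angle, which may reach \<open>2 d\<close>.\<close>

definition tent :: "complex \<Rightarrow> real \<Rightarrow> complex set" where
  "tent a d = (if 4 * d < 1 then carleson_square (of_real (1 - 4 * d) * cis (Arg a)) else disc)"

lemma abs_Arg_le_near_1:
  assumes "norm (w - 1) \<le> d" "4 * d < 1"
  shows "\<bar>Arg w\<bar> \<le> 2 * d"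
proof -
  have "\<bar>Re (w - 1)\<bar> \<le> d" "\<bar>Im (w - 1)\<bar> \<le> d"
    using assms abs_Re_le_cmod abs_Im_le_cmod order_trans by blast+
  then have w: "Re w \<ge> 3/4" "\<bar>Im w\<bar> \<le> d" using assms by auto
  have d0: "0 \<le> d" using w by linarith
  have "Arg w = arctan (Im w / Re w)"
    using w by (subst arg_conv_arctan) auto
  then have "\<bar>Arg w\<bar> \<le> \<bar>Im w / Re w\<bar>" by (metis abs_arctan_le)
  also have "\<dots> \<le> d / (3/4)" unfolding abs_divide using w d0 by (intro frac_le) auto
  also have "\<dots> \<le> 2 * d" using d0 by simp
  finally show ?thesis .
qed

lemma disc_Int_cball_subset_tent:
  assumes "0 < d" shows "disc \<inter> cball (cis (Arg a)) d \<subseteq> tent a d"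
proof
  fix z assume z: "z \<in> disc \<inter> cball (cis (Arg a)) d"
  show "z \<in> tent a d"
  proof (cases "4 * d < 1")
    case True
    let ?e = "cis (Arg a)"
    have ze: "norm (?e - z) \<le> d" using z by (simp add: dist_norm)
    have "?e * cnj z - 1 = ?e * cnj (z - ?e)"
      using complex_norm_square[of ?e] by (simp add: algebra_simps)
    then have "norm (?e * cnj z - 1) \<le> d"
      using ze by (simp add: norm_mult norm_minus_commute del: complex_cnj_diff)
    from abs_Arg_le_near_1[OF this True] have A: "\<bar>Arg (?e * cnj z)\<bar> \<le> 2 * d" .
    have nb: "norm (of_real (1 - 4 * d) * ?e) = 1 - 4 * d"
      unfolding norm_mult norm_of_real using True by simp
    have "norm z \<ge> 1 - d" using ze norm_triangle_ineq3[of ?e z] by simp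
    moreover have "Arg (of_real (1 - 4 * d) * ?e * cnj z) = Arg (?e * cnj z)"
      using True unfolding mult.assoc by (intro Arg_times_of_real) auto
    moreover have "of_real (1 - 4 * d) * ?e \<noteq> 0" using nb True by (metis norm_zero diff_gt_0_iff_gt less_irrefl)
    ultimately have "z \<in> carleson_square (of_real (1 - 4 * d) * ?e)"
      using A assms z by (subst mem_carleson_square_iff) (auto simp: nb simp del: of_real_diff)
    then show ?thesis using True by (simp add: tent_def)
  qed (use z in \<open>simp add: tent_def\<close>)
qed

lemma tent_eq_carleson_square:
  assumes "0 < d"
  obtains b where "b \<in> disc" "tent a d = carleson_square b" "norm b = max 0 (1 - 4 * d)"
proof (cases "4 * d < 1")
  case True
  have nb: "norm (of_real (1 - 4 * d) * cis (Arg a)) = 1 - 4 * d"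
    unfolding norm_mult norm_of_real using True by simp
  show ?thesis by (rule that[of "of_real (1 - 4 * d) * cis (Arg a)"])
    (use True assms in \<open>auto simp: tent_def nb simp del: of_real_diff\<close>)
next
  case False
  show ?thesis by (rule that[of 0]) (use False in \<open>auto simp: tent_def\<close>)
qed

section \<open>Rotation invariance and averaging\<close>

lemma nn_integral_lborel_translate:
  fixes g :: "'a::euclidean_space \<Rightarrow> ennreal"
  assumes [measurable]: "g \<in> borel_measurable borel"
  shows "(\<integral>\<^sup>+z. g (c + z) \<partial>lborel) = (\<integral>\<^sup>+z. g z \<partial>lborel)"
  by (subst (2) lborel_distr_plus[symmetric, of c]) (simp add: nn_integral_distr)

text \<open>Uniqueness of translation invariant measures, specialized to rotations. The double integral of
  \<open>g (c y + x)\<close> over \<open>x\<close> in the plane and \<open>y\<close> in the unit ball is computed twice. Integrating over \<open>x\<close>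
  first gives the integral of \<open>g\<close> times the area of the ball. Substituting \<open>y - x / c\<close> for \<open>y\<close> first
  gives the integral of \<open>g (c y)\<close> times the same area, because \<open>y - x / c\<close> lies in the unit ball
  exactly if \<open>x\<close> lies in the unit ball about \<open>c y\<close>.\<close>

lemma nn_integral_lborel_rotate:
  fixes g :: "complex \<Rightarrow> ennreal"
  assumes [measurable]: "g \<in> borel_measurable borel" and c: "norm c = 1"
  shows "(\<integral>\<^sup>+z. g (c * z) \<partial>lborel) = (\<integral>\<^sup>+z. g z \<partial>lborel)"
proof -
  define B where "B = emeasure lborel (ball 0 1 :: complex set)"
  have B: "B \<noteq> 0" "B \<noteq> \<infinity>" unfolding B_def using content_ball_pos[of 1 "0::complex"]
    by (auto simp: emeasure_ball unit_ball_vol_2)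
  define b where "b = (indicator (ball 0 1) :: complex \<Rightarrow> ennreal)"
  have [measurable]: "b \<in> borel_measurable borel"
    unfolding b_def by (intro borel_measurable_indicator borel_open open_ball)
  have "(\<integral>\<^sup>+x. g x \<partial>lborel) * B = (\<integral>\<^sup>+y. (\<integral>\<^sup>+x. g x \<partial>lborel) * b y \<partial>lborel)"
    unfolding B_def b_def by (rule nn_integral_cmult_indicator[symmetric]) simp
  also have "\<dots> = (\<integral>\<^sup>+y. (\<integral>\<^sup>+x. g (c * y + x) * b y \<partial>lborel) \<partial>lborel)"
    by (simp add: nn_integral_lborel_translate nn_integral_multc)
  also have "\<dots> = (\<integral>\<^sup>+x. (\<integral>\<^sup>+y. g (c * y + x) * b y \<partial>lborel) \<partial>lborel)"
    by (rule lborel_pair.Fubini') measurable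
  also have "\<dots> = (\<integral>\<^sup>+x. (\<integral>\<^sup>+y. g (c * y) * indicator (ball (c * y) 1) x \<partial>lborel) \<partial>lborel)"
  proof (rule nn_integral_cong)
    fix x :: complex
    have "(\<integral>\<^sup>+y. g (c * y + x) * b y \<partial>lborel) =
        (\<integral>\<^sup>+y. g (c * (- (x / c) + y) + x) * b (- (x / c) + y) \<partial>lborel)"
      by (rule nn_integral_lborel_translate[symmetric]) measurable
    also have "\<dots> = (\<integral>\<^sup>+y. g (c * y) * indicator (ball (c * y) 1) x \<partial>lborel)"
    proof (rule nn_integral_cong)
      fix y
      have c0: "c \<noteq> 0" using c by auto
      have "norm (x / c - y) = norm (c * y - x)"
      proof -
        have "c * y - x = - c * (x / c - y)" using c0 by (simp add: right_diff_distrib)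
        then show ?thesis using c by (simp add: norm_mult)
      qed
      then have "b (- (x / c) + y) = indicator (ball (c * y) 1) x"
        by (simp add: indicator_def dist_norm b_def)
      then show "g (c * (- (x / c) + y) + x) * b (- (x / c) + y) = g (c * y) * indicator (ball (c * y) 1) x"
        using c0 by (simp add: right_diff_distrib)
    qed
    finally show "(\<integral>\<^sup>+y. g (c * y + x) * b y \<partial>lborel) =
      (\<integral>\<^sup>+y. g (c * y) * indicator (ball (c * y) 1) x \<partial>lborel)" .
  qed
  also have "\<dots> = (\<integral>\<^sup>+y. (\<integral>\<^sup>+x. g (c * y) * indicator (ball (c * y) 1) x \<partial>lborel) \<partial>lborel)"
  proof (rule lborel_pair.Fubini')
    have "(\<lambda>p. indicator (ball (c * fst p) 1) (snd p) :: ennreal) = (\<lambda>p. b (c * fst p - snd p))"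
      by (auto simp: indicator_def dist_norm b_def norm_minus_commute)
    moreover have "(\<lambda>p. b (c * fst p - snd p)) \<in> borel_measurable (lborel \<Otimes>\<^sub>M lborel)" by measurable
    ultimately have [measurable]: "(\<lambda>p. indicator (ball (c * fst p) 1) (snd p) :: ennreal) \<in> borel_measurable (lborel \<Otimes>\<^sub>M lborel)"
      by simp
    show "(\<lambda>(y, x). g (c * y) * indicator (ball (c * y) 1) x) \<in> borel_measurable (lborel \<Otimes>\<^sub>M lborel)"
      unfolding case_prod_unfold by measurable
  qed
  also have "\<dots> = (\<integral>\<^sup>+y. g (c * y) * B \<partial>lborel)"
    by (intro nn_integral_cong) (subst nn_integral_cmult_indicator, auto simp: B_def emeasure_ball)
  also have "\<dots> = (\<integral>\<^sup>+y. g (c * y) \<partial>lborel) * B"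
    by (simp add: nn_integral_multc)
  finally show ?thesis using B by (auto simp: ennreal_mult_cancel_left mult.commute[of _ B])
qed

text \<open>Weights are Lebesgue measurable but not necessarily Borel measurable, so the invariance is needed
  for the completed measure.\<close>

lemma lebesgue_rotate:
  fixes c :: complex
  assumes c: "norm c = 1"
  shows measurable_lebesgue_rotate: "(*) c \<in> lebesgue \<rightarrow>\<^sub>M lebesgue"
    and distr_lebesgue_rotate: "distr lebesgue lebesgue ((*) c) = lebesgue"
proof -
  have D: "distr lborel borel ((*) c) = lborel"
  proof (rule measure_eqI)
    fix A assume "A \<in> sets (distr lborel borel ((*) c))"
    then have A: "A \<in> sets borel" by simp
    have "emeasure (distr lborel borel ((*) c)) A = (\<integral>\<^sup>+z. indicator A z \<partial>distr lborel borel ((*) c))"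
      using A by simp
    also have "\<dots> = (\<integral>\<^sup>+z. indicator A (c * z) \<partial>lborel)" using A by (subst nn_integral_distr) auto
    also have "\<dots> = emeasure lborel A" using A c by (subst nn_integral_lborel_rotate) auto
    finally show "emeasure (distr lborel borel ((*) c)) A = emeasure lborel A" .
  qed simp
  have eq: "null_sets (distr lebesgue lborel ((*) c)) = null_sets lborel"
  proof -
    have "distr lebesgue lborel ((*) c) = distr lborel borel ((*) c)"
      by (subst distr_completion) (auto cong: distr_cong)
    then show ?thesis using D by simp
  qed
  show "(*) c \<in> lebesgue \<rightarrow>\<^sub>M lebesgue"
    by (rule completion.measurable_completion2) (auto simp: eq measurable_completion)
  have "distr lebesgue lebesgue ((*) c) = completion (distr lebesgue lborel ((*) c))"
    by (subst completion.completion_distr_eq) (auto simp: eq measurable_completion)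
  also have "distr lebesgue lborel ((*) c) = distr lborel borel ((*) c)"
      by (subst distr_completion) (auto cong: distr_cong)
  finally show "distr lebesgue lebesgue ((*) c) = lebesgue" by (simp only: D)
qed

lemma sets_dA [simp, measurable_cong]: "sets dA = sets (lebesgue_on disc)"
  by (simp add: dA_def)

lemma space_dA [simp]: "space dA = disc"
  by (simp add: dA_def)

lemma sets_weighted [simp, measurable_cong]: "sets (weighted \<omega>) = sets (lebesgue_on disc)"
  by (simp add: weighted_def)

lemma space_weighted [simp]: "space (weighted \<omega>) = disc"
  by (simp add: weighted_def)

lemma borel_subset_sets_lebesgue_on_disc:
  assumes "A \<in> sets borel" "A \<subseteq> disc" shows "A \<in> sets (lebesgue_on disc)"
  using assms by (subst sets_restrict_space_iff) auto

lemma measurable_id_lebesgue_on_disc [measurable]: "(\<lambda>z. z) \<in> lebesgue_on disc \<rightarrow>\<^sub>M borel"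
  by (intro measurable_restrict_space1 measurable_completion) simp

lemma weight_measurable: "weight \<omega> \<Longrightarrow> \<omega> \<in> borel_measurable (lebesgue_on disc)"
  unfolding weight_def using borel_measurable_integrable[of dA \<omega>] by (simp cong: measurable_cong_sets)

lemma nn_integral_dA:
  assumes [measurable]: "g \<in> borel_measurable (lebesgue_on disc)"
  shows "(\<integral>\<^sup>+z. g z \<partial>dA) = (\<integral>\<^sup>+z. ennreal (1/pi) * g z * indicator disc z \<partial>lebesgue)"
proof -
  have "(\<integral>\<^sup>+z. g z \<partial>dA) = (\<integral>\<^sup>+z. ennreal (1/pi) * g z \<partial>lebesgue_on disc)"
    unfolding dA_def by (rule nn_integral_density) auto
  also have "\<dots> = (\<integral>\<^sup>+z. ennreal (1/pi) * g z * indicator disc z \<partial>lebesgue)"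
    by (rule nn_integral_restrict_space) simp
  finally show ?thesis .
qed

lemma nn_integral_weighted:
  assumes "weight \<omega>" and [measurable]: "g \<in> borel_measurable (lebesgue_on disc)"
  shows "(\<integral>\<^sup>+z. g z \<partial>weighted \<omega>) = (\<integral>\<^sup>+z. ennreal (\<omega> z) * g z \<partial>dA)"
proof -
  have [measurable]: "\<omega> \<in> borel_measurable (lebesgue_on disc)" using assms(1) by (rule weight_measurable)
  show ?thesis unfolding weighted_def by (rule nn_integral_density) auto
qed

lemma finite_measure_weighted:
  assumes "weight \<omega>" shows "finite_measure (weighted \<omega>)"
proof
  have [measurable]: "\<omega> \<in> borel_measurable (lebesgue_on disc)" using assms(1) by (rule weight_measurable)
  have "emeasure (weighted \<omega>) (space (weighted \<omega>)) = (\<integral>\<^sup>+z. 1 \<partial>weighted \<omega>)" by simp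
  also have "\<dots> = (\<integral>\<^sup>+z. ennreal (\<omega> z) \<partial>dA)" by (subst nn_integral_weighted[OF assms]) auto
  also have "\<dots> = (\<integral>\<^sup>+z. ennreal (norm (\<omega> z)) \<partial>dA)"
    using assms by (intro nn_integral_cong) (auto simp: weight_def)
  also have "\<dots> < \<infinity>" using assms unfolding weight_def integrable_iff_bounded by blast
  finally show "emeasure (weighted \<omega>) (space (weighted \<omega>)) \<noteq> \<infinity>" by simp
qed

lemma nn_integral_weighted_rotate:
  assumes \<nu>: "radial_weight \<nu>" and g[measurable]: "g \<in> borel_measurable (lebesgue_on disc)" and c: "norm c = 1"
  shows "(\<integral>\<^sup>+z. g (c * z) \<partial>weighted \<nu>) = (\<integral>\<^sup>+z. g z \<partial>weighted \<nu>)"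
proof -
  have w: "weight \<nu>" and rad: "\<And>z. z \<in> disc \<Longrightarrow> \<nu> z = \<nu> (of_real (norm z))"
    using \<nu> unfolding radial_weight_def by blast+
  have [measurable]: "\<nu> \<in> borel_measurable (lebesgue_on disc)" using w by (rule weight_measurable)
  have rot: "(*) c \<in> lebesgue_on disc \<rightarrow>\<^sub>M lebesgue_on disc"
    using measurable_lebesgue_rotate[OF c] c
    by (intro measurable_restrict_space3) (auto simp: norm_mult)
  have [measurable]: "(\<lambda>z. g (c * z)) \<in> borel_measurable (lebesgue_on disc)"
    using measurable_compose[OF rot g] by simp
  let ?h = "\<lambda>z. ennreal (1/pi) * (ennreal (\<nu> z) * g z) * indicator disc z"
  have h: "?h \<in> borel_measurable lebesgue"
    by (subst borel_measurable_restrict_space_iff_ennreal[symmetric]) auto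
  have rad': "\<nu> (c * z) = \<nu> z" if "z \<in> disc" for z
  proof -
    have "norm (c * z) = norm z" using c by (simp add: norm_mult)
    then show ?thesis using rad[of z] rad[of "c * z"] that by (metis mem_ball_0)
  qed
  have "(\<integral>\<^sup>+z. g (c * z) \<partial>weighted \<nu>) = (\<integral>\<^sup>+z. ennreal (1/pi) * (ennreal (\<nu> z) * g (c * z)) * indicator disc z \<partial>lebesgue)"
    by (simp add: nn_integral_weighted[OF w] nn_integral_dA)
  also have "\<dots> = (\<integral>\<^sup>+z. ?h (c * z) \<partial>lebesgue)"
    using c rad' by (intro nn_integral_cong) (auto simp: norm_mult split: split_indicator)
  also have "\<dots> = (\<integral>\<^sup>+z. ?h z \<partial>distr lebesgue lebesgue ((*) c))"
    using h measurable_lebesgue_rotate[OF c] by (subst nn_integral_distr) auto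
  also have "\<dots> = (\<integral>\<^sup>+z. g z \<partial>weighted \<nu>)"
    by (simp add: nn_integral_weighted[OF w] nn_integral_dA distr_lebesgue_rotate[OF c])
  finally show ?thesis .
qed

text \<open>Averaging over all rotations does not change an integral against a radial weight. This replaces
  polar coordinates: statements about single circles become statements about the weighted area.\<close>

lemma nn_integral_weighted_average:
  assumes \<nu>: "radial_weight \<nu>" and g[measurable]: "g \<in> borel_measurable borel"
  shows "(\<integral>\<^sup>+z. g z \<partial>weighted \<nu>) = (\<integral>\<^sup>+z. (\<integral>\<^sup>+t\<in>{0..1}. g (z * cis (2*pi*t)) \<partial>lborel) \<partial>weighted \<nu>)"
proof -
  have w: "weight \<nu>" using \<nu> by (simp add: radial_weight_def)
  interpret V: finite_measure "weighted \<nu>" by (rule finite_measure_weighted[OF w])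
  interpret pair_sigma_finite "weighted \<nu>" "lborel :: real measure" ..
  have g': "(\<lambda>z. g z) \<in> borel_measurable (lebesgue_on disc)" by measurable
  have cis[measurable]: "cis \<in> borel_measurable borel"
    by (intro borel_measurable_continuous_onI continuous_intros)
  have "(\<integral>\<^sup>+z. g z \<partial>weighted \<nu>) = (\<integral>\<^sup>+t. (\<integral>\<^sup>+z. g z \<partial>weighted \<nu>) * indicator {0..1::real} t \<partial>lborel)"
    by (subst nn_integral_cmult_indicator) auto
  also have "\<dots> = (\<integral>\<^sup>+t. (\<integral>\<^sup>+z. g (z * cis (2*pi*t)) * indicator {0..1} t \<partial>weighted \<nu>) \<partial>lborel)"
  proof (rule nn_integral_cong)
    fix t :: real
    show "(\<integral>\<^sup>+z. g z \<partial>weighted \<nu>) * indicator {0..1} t = (\<integral>\<^sup>+z. g (z * cis (2*pi*t)) * indicator {0..1} t \<partial>weighted \<nu>)"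
      using nn_integral_weighted_rotate[OF \<nu> g', of "cis (2*pi*t)"]
      by (subst nn_integral_multc) (auto simp: mult.commute)
  qed
  also have "\<dots> = (\<integral>\<^sup>+z. (\<integral>\<^sup>+t. g (z * cis (2*pi*t)) * indicator {0..1} t \<partial>lborel) \<partial>weighted \<nu>)"
    by (rule Fubini') measurable
  finally show ?thesis .
qed

section \<open>Radial weights in the class D-hat\<close>

abbreviation mass :: "(complex \<Rightarrow> real) \<Rightarrow> complex set \<Rightarrow> real" where
  "mass \<omega> E \<equiv> measure (weighted \<omega>) E"

abbreviation square_integral :: "(complex \<Rightarrow> real) \<Rightarrow> (complex \<Rightarrow> real) \<Rightarrow> complex \<Rightarrow> ennreal" where
  "square_integral \<omega> u a \<equiv> (\<integral>\<^sup>+z\<in>carleson_square a. ennreal (u z) \<partial>weighted \<omega>)"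

lemma Arg_mult_cis:
  assumes "w \<noteq> 0"
  shows "\<bar>Arg (w * cis x)\<bar> \<le> \<bar>Arg w + x\<bar>" "\<exists>k::int. Arg (w * cis x) = Arg w + x + 2 * pi * k"
proof -
  have "w * cis x = rcis (norm w) (Arg w + x)"
    by (subst (1) rcis_cmod_Arg[symmetric]) (simp add: rcis_def cis_mult[symmetric])
  then have A: "Arg (w * cis x) = Arg (cis (Arg w + x))" "Arg (w * cis x) = normalize_angle (Arg w + x)"
    using assms Arg_rcis'[of "norm w" "Arg w + x"] Arg_rcis'[of 1 "Arg w + x"]
    by (auto simp: rcis_def)
  show "\<bar>Arg (w * cis x)\<bar> \<le> \<bar>Arg w + x\<bar>" unfolding A(1) by (rule abs_Arg_cis_le)
  show "\<exists>k::int. Arg (w * cis x) = Arg w + x + 2 * pi * k"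
    unfolding A(2) normalize_angle_def
    by (rule exI[of _ "- \<lceil>(Arg w + x) / (2 * pi) - 1 / 2\<rceil>"]) simp
qed

text \<open>The circle through \<open>\<zeta>\<close> meets \<open>S(a)\<close> in an arc of angle \<open>1 - |a|\<close>. Only the order of magnitude of its
  normalized length matters, and the generous constants make it harmless that the arc may straddle
  the endpoints of the parameter interval.\<close>

lemma carleson_square_angular_fraction:
  assumes a: "a \<in> disc" "a \<noteq> 0" and \<zeta>: "norm a \<le> norm \<zeta>" "norm \<zeta> < 1"
  shows "ennreal ((1 - norm a) / (4*pi)) \<le> (\<integral>\<^sup>+t\<in>{0..1}. indicator (carleson_square a) (\<zeta> * cis (2*pi*t)) \<partial>lborel)" (is ?lo)
    and "(\<integral>\<^sup>+t\<in>{0..1}. indicator (carleson_square a) (\<zeta> * cis (2*pi*t)) \<partial>lborel) \<le> ennreal (1 - norm a)" (is ?hi)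
proof -
  define \<delta> where "\<delta> = (1 - norm a) / (4*pi)"
  define w where "w = a * cnj \<zeta>"
  \<comment> \<open>In units of full turns: the point with parameter \<open>t\<close> lies in the square if and only if \<open>s - t\<close> is
    within \<open>\<delta>\<close> of an integer.\<close>
  define s where "s = Arg w / (2*pi)"
  have h: "0 < 1 - norm a" "1 - norm a \<le> 1" using a by auto
  have \<delta>: "0 < \<delta>" "\<delta> < 1/4" "4 * \<delta> \<le> 1 - norm a" "(1 - norm a) / 2 = 2*pi*\<delta>"
  proof -
    show "0 < \<delta>" unfolding \<delta>_def using h by simp
    have "\<delta> \<le> (1 - norm a) / (4 * 3)" unfolding \<delta>_def using h pi_gt3 by (intro divide_left_mono) auto
    then show "\<delta> < 1/4" "4 * \<delta> \<le> 1 - norm a" using h by argo+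
    show "(1 - norm a) / 2 = 2*pi*\<delta>" unfolding \<delta>_def by simp
  qed
  have w0: "w \<noteq> 0" using a \<zeta> by (auto simp: w_def)
  have s: "-1/2 < s" "s \<le> 1/2" "Arg w = 2 * pi * s"
    using Arg_bounded[of w] by (auto simp: s_def field_simps)
  have mem: "\<zeta> * cis (2*pi*t) \<in> carleson_square a \<longleftrightarrow> \<bar>Arg (w * cis (-2*pi*t))\<bar> \<le> 2*pi*\<delta>" for t
  proof -
    have "a * cnj (\<zeta> * cis (2*pi*t)) = w * cis (-2*pi*t)" by (simp add: w_def cis_cnj)
    then show ?thesis unfolding mem_carleson_square_iff[OF a(2)] \<delta>(4) using \<zeta> by (simp add: norm_mult)
  qed
  define T where "T = {t\<in>{0..1}. \<bar>Arg (w * cis (-2*pi*t))\<bar> \<le> 2*pi*\<delta>}"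
  have T: "(\<integral>\<^sup>+t\<in>{0..1}. indicator (carleson_square a) (\<zeta> * cis (2*pi*t)) \<partial>lborel) = (\<integral>\<^sup>+t. indicator T t \<partial>lborel)"
    by (intro nn_integral_cong) (auto simp: T_def mem split: split_indicator)
  have close: "\<bar>Arg (w * cis (-2*pi*t))\<bar> \<le> 2*pi*\<delta>" if "\<bar>s - t + of_int k\<bar> \<le> \<delta>" for t and k :: int
  proof -
    have "cis (2*pi*k) = 1" by (rule cis_multiple_2pi) simp
    then have "cis (-2*pi*t) = cis (2*pi*k + -2*pi*t)" by (simp only: cis_mult[symmetric]) simp
    also have "2*pi*k + -2*pi*t = 2*pi*(k - t)" by (simp add: algebra_simps)
    finally have "\<bar>Arg (w * cis (-2*pi*t))\<bar> \<le> \<bar>Arg w + 2*pi*(k - t)\<bar>"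
      using Arg_mult_cis(1)[OF w0] by simp
    also have "Arg w + 2*pi*(k - t) = 2*pi*(s - t + k)" by (simp add: s(3) algebra_simps)
    also have "\<bar>\<dots>\<bar> = 2*pi*\<bar>s - t + k\<bar>" by (simp add: abs_mult)
    also have "\<dots> \<le> 2*pi*\<delta>" using that by (intro mult_left_mono) auto
    finally show ?thesis .
  qed
  have "ennreal \<delta> \<le> (\<integral>\<^sup>+t. indicator T t \<partial>lborel)"
  proof (cases "s \<ge> 0")
    case True
    have "{s..s+\<delta>} \<subseteq> T"
    proof
      fix t assume t: "t \<in> {s..s+\<delta>}"
      then have "\<bar>s - t + of_int 0\<bar> \<le> \<delta>" by auto
      from close[OF this] show "t \<in> T" using t True s \<delta> by (auto simp: T_def)
    qed
    then have "(\<integral>\<^sup>+t. indicator {s..s+\<delta>} t \<partial>lborel) \<le> (\<integral>\<^sup>+t. indicator T t \<partial>lborel)"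
      by (intro nn_integral_mono) (auto split: split_indicator)
    then show ?thesis using \<delta> by simp
  next
    case False
    have "{s+1-\<delta>..s+1} \<subseteq> T"
    proof
      fix t assume t: "t \<in> {s+1-\<delta>..s+1}"
      then have "\<bar>s - t + of_int 1\<bar> \<le> \<delta>" by auto
      from close[OF this] show "t \<in> T" using t False s \<delta> by (auto simp: T_def)
    qed
    then have "(\<integral>\<^sup>+t. indicator {s+1-\<delta>..s+1} t \<partial>lborel) \<le> (\<integral>\<^sup>+t. indicator T t \<partial>lborel)"
      by (intro nn_integral_mono) (auto split: split_indicator)
    then show ?thesis using \<delta> by simp
  qed
  then show ?lo unfolding T \<delta>_def .
  have "T \<subseteq> {s-\<delta>..s+\<delta>} \<union> {s+1-\<delta>..s+1+\<delta>}"
  proof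
    fix t assume t: "t \<in> T"
    obtain k :: int where k: "Arg (w * cis (-2*pi*t)) = Arg w + -2*pi*t + 2*pi*k"
      using Arg_mult_cis(2)[OF w0] by blast
    also have "\<dots> = 2*pi*(s - t + k)" by (simp add: s(3) algebra_simps)
    finally have "2*pi*\<bar>s - t + k\<bar> \<le> 2*pi*\<delta>" using t by (simp add: T_def abs_mult)
    then have d: "\<bar>s - t + k\<bar> \<le> \<delta>" by simp
    then have "-1 < real_of_int k" "real_of_int k < 2" using t s \<delta> by (auto simp: T_def)
    then have "k = 0 \<or> k = 1" by linarith
    then show "t \<in> {s-\<delta>..s+\<delta>} \<union> {s+1-\<delta>..s+1+\<delta>}" using d by auto
  qed
  then have "(\<integral>\<^sup>+t. indicator T t \<partial>lborel) \<le> (\<integral>\<^sup>+t. indicator ({s-\<delta>..s+\<delta>} \<union> {s+1-\<delta>..s+1+\<delta>}) t \<partial>lborel)"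
    by (intro nn_integral_mono) (auto split: split_indicator)
  also have "\<dots> \<le> emeasure lborel {s-\<delta>..s+\<delta>} + emeasure lborel {s+1-\<delta>..s+1+\<delta>}"
    by (simp add: emeasure_subadditive)
  also have "\<dots> = ennreal (2 * \<delta> + 2 * \<delta>)" using \<delta> by (subst ennreal_plus) auto
  also have "\<dots> \<le> ennreal (1 - norm a)" using \<delta> by (intro ennreal_leI) auto
  finally show ?hi unfolding T .
qed

text \<open>The mass of an outer annulus, which is twice the integral of \<open>\<nu> s * s\<close> over \<open>s\<close> from \<open>r\<close> to 1. It
  takes the role of the one-dimensional tail because it can be rotated.\<close>

definition tail_mass :: "(complex \<Rightarrow> real) \<Rightarrow> real \<Rightarrow> real" where
  "tail_mass \<nu> r = mass \<nu> {z \<in> disc. r \<le> norm z}"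

lemma annulus_measurable: "{z \<in> disc. r \<le> norm z} \<in> sets (lebesgue_on disc)"
proof (rule borel_subset_sets_lebesgue_on_disc)
  have "{z \<in> disc. r \<le> norm z} = ball 0 1 \<inter> {z. r \<le> norm z}" by auto
  moreover have "closed {z::complex. r \<le> norm z}" by (intro closed_Collect_le continuous_intros)
  ultimately show "{z \<in> disc. r \<le> norm z} \<in> sets borel" by auto
qed auto

lemma carleson_square_measurable:
  "a \<in> disc \<Longrightarrow> carleson_square a \<in> sets (lebesgue_on disc)"
  by (rule borel_subset_sets_lebesgue_on_disc[OF borel_carleson_square carleson_square_subset_disc])

text \<open>By rotation averaging the mass of \<open>S(a)\<close> is the mass of the annulus \<open>|a| \<le> |z| < 1\<close> times the angular
  fraction of the square.\<close>

lemma
  assumes \<nu>: "radial_weight \<nu>" and a: "a \<in> disc"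
  shows carleson_square_mass_ge: "(1 - norm a) / (4*pi) * tail_mass \<nu> (norm a) \<le> mass \<nu> (carleson_square a)"
    and carleson_square_mass_le: "mass \<nu> (carleson_square a) \<le> (1 - norm a) * tail_mass \<nu> (norm a)"
proof -
  have w: "weight \<nu>" using \<nu> by (simp add: radial_weight_def)
  interpret V: finite_measure "weighted \<nu>" by (rule finite_measure_weighted[OF w])
  let ?V = "weighted \<nu>" and ?S = "carleson_square a" and ?N = "{z \<in> disc. norm a \<le> norm z}"
  have meas[measurable]: "?S \<in> sets (lebesgue_on disc)" "?N \<in> sets (lebesgue_on disc)"
    using a carleson_square_measurable annulus_measurable by auto
  have "(1 - norm a) / (4*pi) * tail_mass \<nu> (norm a) \<le> mass \<nu> ?S \<and>
    mass \<nu> ?S \<le> (1 - norm a) * tail_mass \<nu> (norm a)"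
  proof (cases "a = 0")
    case True
    have "disc = {z \<in> disc. 0 \<le> norm z}" by auto
    then have "tail_mass \<nu> 0 = measure ?V disc" by (simp add: tail_mass_def)
    moreover have "1 / (4*pi) * measure ?V disc \<le> 1 * measure ?V disc"
      using pi_gt3 by (intro mult_right_mono) auto
    ultimately show ?thesis using True by simp
  next
    case False
    let ?I = "\<lambda>z. \<integral>\<^sup>+t\<in>{0..1}. indicator ?S (z * cis (2*pi*t)) \<partial>lborel"
    have eq: "emeasure ?V ?S = (\<integral>\<^sup>+z. ?I z \<partial>?V)"
    proof -
      have "emeasure ?V ?S = (\<integral>\<^sup>+z. indicator ?S z \<partial>?V)" by simp
      also have "\<dots> = (\<integral>\<^sup>+z. ?I z \<partial>?V)"
        by (rule nn_integral_weighted_average[OF \<nu>]) (use borel_carleson_square[OF a] in simp)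
      finally show ?thesis .
    qed
    have lo: "ennreal ((1 - norm a) / (4*pi)) * indicator ?N z \<le> ?I z" if "z \<in> disc" for z
      using carleson_square_angular_fraction(1)[OF a False, of z] that by (auto split: split_indicator)
    have hi: "?I z \<le> ennreal (1 - norm a) * indicator ?N z" if "z \<in> disc" for z
    proof (cases "z \<in> ?N")
      case True
      then show ?thesis using carleson_square_angular_fraction(2)[OF a False, of z] by simp
    next
      case f: False
      then have "z * cis (2*pi*t) \<notin> ?S" for t
        using that norm_le_of_mem_carleson_square[of "z * cis (2*pi*t)" a] by (auto simp: norm_mult)
      then show ?thesis by simp
    qed
    have "(\<integral>\<^sup>+z. ennreal ((1 - norm a) / (4*pi)) * indicator ?N z \<partial>?V) \<le> emeasure ?V ?S"
      unfolding eq by (intro nn_integral_mono) (use lo in auto)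
    moreover have "emeasure ?V ?S \<le> (\<integral>\<^sup>+z. ennreal (1 - norm a) * indicator ?N z \<partial>?V)"
      unfolding eq by (intro nn_integral_mono) (use hi in auto)
    moreover have "?N \<in> sets ?V" using meas by simp
    ultimately have "ennreal ((1 - norm a) / (4*pi)) * emeasure ?V ?N \<le> emeasure ?V ?S"
       "emeasure ?V ?S \<le> ennreal (1 - norm a) * emeasure ?V ?N"
      by (simp_all only: nn_integral_cmult_indicator)
    then show ?thesis using a unfolding tail_mass_def V.emeasure_eq_measure
      by (simp add: ennreal_mult[symmetric])
  qed
  then show "(1 - norm a) / (4*pi) * tail_mass \<nu> (norm a) \<le> mass \<nu> ?S"
    "mass \<nu> ?S \<le> (1 - norm a) * tail_mass \<nu> (norm a)" by auto
qed

text \<open>The image of the area measure on the disc under the modulus is identified through its tails, that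
  is, through the areas of annuli.\<close>

lemma nn_integral_radial:
  fixes k :: "real \<Rightarrow> ennreal"
  assumes [measurable]: "k \<in> borel_measurable borel"
  shows "(\<integral>\<^sup>+z. k (norm z) * indicator (ball (0::complex) 1) z \<partial>lborel) = (\<integral>\<^sup>+s. k s * (ennreal (2*pi* s) * indicator {0..<1} s) \<partial>lborel)"
proof -
  define b where "b = (indicator (ball 0 1) :: complex \<Rightarrow> ennreal)"
  have [measurable]: "b \<in> borel_measurable borel"
    unfolding b_def by (intro borel_measurable_indicator borel_open open_ball)
  define M where "M = distr (density lborel b) borel norm"
  define N where "N = density lborel (\<lambda>s. ennreal (2*pi* s) * indicator {0..<1::real} s)"
  have M: "emeasure M {x<..} = ennreal (pi * (1 - (max 0 (min x 1))\<^sup>2))" for x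
  proof -
    define y where "y = max 0 (min x 1)"
    have y: "0 \<le> y" "y \<le> 1" by (auto simp: y_def)
    have "emeasure M {x<..} = (\<integral>\<^sup>+z. indicator {x<..} z \<partial>M)"
      by (subst nn_integral_indicator) (auto simp: M_def)
    also have "\<dots> = (\<integral>\<^sup>+z. b z * indicator {x<..} (norm z) \<partial>lborel)"
      unfolding M_def by (subst nn_integral_distr) (auto simp: nn_integral_density)
    also have "\<dots> = (\<integral>\<^sup>+z. indicator (ball 0 1 - cball (0::complex) y) z \<partial>lborel)"
    proof (rule nn_integral_cong_AE)
      have "AE z in lborel. z \<noteq> (0::complex)" by (rule AE_lborel_singleton)
      then show "AE z in lborel. b z * indicator {x<..} (norm z) = indicator (ball 0 1 - cball (0::complex) y) z"
        by eventually_elim (auto simp: b_def y_def max_def min_def split: split_indicator if_splits, smt (verit) norm_ge_zero)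
    qed
    also have "\<dots> = emeasure lborel (ball 0 1 - cball (0::complex) y)" by simp
    also have "\<dots> = ennreal (pi * (1 - y\<^sup>2))"
    proof (cases "y = 1")
      case True
      then have e: "ball 0 1 - cball (0::complex) y = {}" by auto
      show ?thesis unfolding e using True by simp
    next
      case False
      then have "emeasure lborel (ball 0 1 - cball (0::complex) y) = emeasure lborel (ball (0::complex) 1) - emeasure lborel (cball (0::complex) y)"
        using y by (intro emeasure_Diff) (auto simp: emeasure_cball)
      also have "\<dots> = ennreal (pi * (1 - y\<^sup>2))"
        using y by (simp add: emeasure_cball emeasure_ball unit_ball_vol_2 ennreal_minus algebra_simps)
      finally show ?thesis .
    qed
    finally show ?thesis by (simp add: y_def)
  qed
  have N: "emeasure N {x<..} = ennreal (pi * (1 - (max 0 (min x 1))\<^sup>2))" for x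
  proof -
    define y where "y = max 0 (min x 1)"
    have y: "0 \<le> y" "y \<le> 1" by (auto simp: y_def)
    have "emeasure N {x<..} = (\<integral>\<^sup>+s. ennreal (2*pi* s) * indicator {0..<1} s * indicator {x<..} s \<partial>lborel)"
      unfolding N_def by (subst emeasure_density) auto
    also have "\<dots> = (\<integral>\<^sup>+s. ennreal (2*pi* s) * indicator {y..1} s \<partial>lborel)"
    proof (rule nn_integral_cong_AE)
      have "AE s in lborel. s \<noteq> x" "AE s in lborel. s \<noteq> y" "AE s in lborel. s \<noteq> (1::real)" by (rule AE_lborel_singleton)+
      then show "AE s in lborel. ennreal (2*pi* s) * indicator {0..<1} s * indicator {x<..} s = ennreal (2*pi* s) * indicator {y..1} s"
        by eventually_elim (auto simp: y_def split: split_indicator)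
    qed
    also have "\<dots> = ennreal (pi * 1\<^sup>2 - pi * y\<^sup>2)"
      using y by (intro nn_integral_FTC_Icc[where F="\<lambda>s. pi * s\<^sup>2"]) (auto intro!: derivative_eq_intros)
    finally show ?thesis by (simp add: y_def algebra_simps)
  qed
  have "M = N"
    by (rule measure_eqI_lessThan) (auto simp: M N, auto simp: M_def N_def)
  have "(\<integral>\<^sup>+z. k (norm z) * indicator (ball (0::complex) 1) z \<partial>lborel) = (\<integral>\<^sup>+z. b z * k (norm z) \<partial>lborel)"
    by (simp only: b_def mult.commute)
  also have "\<dots> = (\<integral>\<^sup>+s. k s \<partial>M)"
    unfolding M_def by (subst nn_integral_distr) (auto simp: nn_integral_density)
  also have "\<dots> = (\<integral>\<^sup>+s. k s * (ennreal (2*pi* s) * indicator {0..<1} s) \<partial>lborel)"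
    unfolding \<open>M = N\<close> N_def by (subst nn_integral_density) (auto simp: mult.commute)
  finally show ?thesis .
qed

text \<open>The two tails differ by a factor \<open>2 s\<close> in the integrand, which lies between 1 and 2 if \<open>s \<ge> 1/2\<close>.
  Because \<open>\<nu>\<close> need not be Borel measurable, it is replaced by a Borel function of the radius; the null
  set of exceptional radii corresponds to a null set of points by \<open>nn_integral_radial\<close>.\<close>

lemma
  assumes \<nu>: "radial_weight \<nu>" and r: "0 \<le> r" "r < 1"
  shows tail_mass_le: "tail_mass \<nu> r \<le> 2 * weight_tail \<nu> r"
    and weight_tail_le: "1/2 \<le> r \<Longrightarrow> weight_tail \<nu> r \<le> tail_mass \<nu> r"
proof -
  have w: "weight \<nu>" and rad: "\<And>z. z \<in> disc \<Longrightarrow> \<nu> z = \<nu> (of_real (norm z))"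
    and int: "set_integrable lebesgue {0..<1} (\<lambda>s. \<nu> (of_real s))"
    using \<nu> unfolding radial_weight_def by blast+
  have pos: "0 \<le> \<nu> z" if "z \<in> disc" for z using w that by (auto simp: weight_def)
  interpret V: finite_measure "weighted \<nu>" by (rule finite_measure_weighted[OF w])
  have [measurable]: "\<nu> \<in> borel_measurable (lebesgue_on disc)" using w by (rule weight_measurable)
  define \<eta> where "\<eta> s = ennreal (indicator {0..<1} s *\<^sub>R \<nu> (of_real s))" for s :: real
  have "\<eta> \<in> borel_measurable lebesgue"
    unfolding \<eta>_def using borel_measurable_integrable[OF int[unfolded set_integrable_def]] by measurable
  from completion_ex_borel_measurable[OF this] obtain \<eta>' where
    [measurable]: "\<eta>' \<in> borel_measurable borel" and ae: "AE s in lborel. \<eta> s = \<eta>' s" by auto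
  from AE_E[OF ae] obtain E where E: "{s. \<eta> s \<noteq> \<eta>' s} \<subseteq> E" "emeasure lborel E = 0" "E \<in> sets borel" by auto
  have "(\<integral>\<^sup>+z. indicator E (norm z) * indicator (ball (0::complex) 1) z \<partial>lborel) =
      (\<integral>\<^sup>+s. indicator E s * (ennreal (2*pi* s) * indicator {0..<1} s) \<partial>lborel)"
    using E by (intro nn_integral_radial) auto
  also have "\<dots> = 0"
  proof -
    have "AE s in lborel. s \<notin> E" using E by (intro AE_not_in) (auto simp: null_sets_def)
    then show ?thesis using E by (subst nn_integral_0_iff_AE) auto
  qed
  finally have ae2: "AE z in lborel. indicator E (norm z) * indicator (ball (0::complex) 1) z = (0::ennreal)"
  proof (subst (asm) nn_integral_0_iff_AE)
    have "(indicator (ball 0 1) :: complex \<Rightarrow> ennreal) \<in> borel_measurable borel"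
      by (intro borel_measurable_indicator borel_open open_ball)
    moreover have "(\<lambda>z::complex. indicator E (norm z) :: ennreal) \<in> borel_measurable borel"
      using E by measurable
    ultimately show "(\<lambda>z. indicator E (norm z) * indicator (ball (0::complex) 1) z :: ennreal) \<in> borel_measurable lborel"
      by simp
  qed
  let ?K = "\<lambda>s. ennreal (1/pi) * (\<eta>' s * indicator {r..} s)"
  have [measurable]: "{z \<in> disc. r \<le> norm z} \<in> sets (lebesgue_on disc)" by (rule annulus_measurable)
  have "ennreal (tail_mass \<nu> r) = (\<integral>\<^sup>+z. indicator {z \<in> disc. r \<le> norm z} z \<partial>weighted \<nu>)"
    unfolding tail_mass_def V.emeasure_eq_measure[symmetric]
    by (rule nn_integral_indicator[symmetric]) (simp only: sets_weighted annulus_measurable)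
  also have "\<dots> = (\<integral>\<^sup>+z. ennreal (1/pi) * (ennreal (\<nu> z) * indicator {z \<in> disc. r \<le> norm z} z) * indicator disc z \<partial>lebesgue)"
    by (subst nn_integral_weighted[OF w], measurable, subst nn_integral_dA, measurable)
  also have "\<dots> = (\<integral>\<^sup>+z. ?K (norm z) * indicator (ball (0::complex) 1) z \<partial>lebesgue)"
  proof (rule nn_integral_cong_AE)
    show "AE z in lebesgue. ennreal (1/pi) * (ennreal (\<nu> z) * indicator {z \<in> disc. r \<le> norm z} z) * indicator disc z =
        ?K (norm z) * indicator (ball 0 1) z"
      using AE_completion[OF ae2]
    proof eventually_elim
      fix z :: complex assume z: "indicator E (norm z) * indicator (ball (0::complex) 1) z = (0::ennreal)"
      show "ennreal (1/pi) * (ennreal (\<nu> z) * indicator {z \<in> disc. r \<le> norm z} z) * indicator disc z =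
        ?K (norm z) * indicator (ball 0 1) z"
      proof (cases "z \<in> ball 0 1")
        case True
        then have "norm z \<notin> E" using z by auto
        then have "\<eta>' (norm z) = \<eta> (norm z)" using E by force
        also have "\<dots> = ennreal (\<nu> z)" using rad[of z] True by (simp add: \<eta>_def)
        finally show ?thesis using True by (simp split: split_indicator)
      qed simp
    qed
  qed
  also have "\<dots> = (\<integral>\<^sup>+z. ?K (norm z) * indicator (ball (0::complex) 1) z \<partial>lborel)"
    by (rule nn_integral_completion)
  also have "\<dots> = (\<integral>\<^sup>+s. ?K s * (ennreal (2*pi* s) * indicator {0..<1} s) \<partial>lborel)"
    by (rule nn_integral_radial) measurable
  also have "\<dots> = (\<integral>\<^sup>+s. ennreal (2 * s * (indicator {r..<1} s *\<^sub>R \<nu> (of_real s))) \<partial>lborel)"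
  proof (rule nn_integral_cong_AE)
    show "AE s in lborel. ?K s * (ennreal (2*pi* s) * indicator {0..<1} s) = ennreal (2 * s * (indicator {r..<1} s *\<^sub>R \<nu> (of_real s)))"
      using ae
    proof eventually_elim
      fix s assume s: "\<eta> s = \<eta>' s"
      show "?K s * (ennreal (2*pi* s) * indicator {0..<1} s) = ennreal (2 * s * (indicator {r..<1} s *\<^sub>R \<nu> (of_real s)))"
      proof (cases "s \<in> {r..<1}")
        case True
        then have "\<eta>' s = ennreal (\<nu> (of_real s))" using s r by (simp add: \<eta>_def)
        then show ?thesis using True r pos[of "of_real s"]
          by (simp add: ennreal_mult[symmetric] field_simps)
      qed (auto split: split_indicator)
    qed
  qed
  also have "\<dots> = (\<integral>\<^sup>+s. ennreal (2 * s * (indicator {r..<1} s *\<^sub>R \<nu> (of_real s))) \<partial>lebesgue)"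
    by (rule nn_integral_completion[symmetric])
  finally have eq: "ennreal (tail_mass \<nu> r) = (\<integral>\<^sup>+s. ennreal (2 * s * (indicator {r..<1} s *\<^sub>R \<nu> (of_real s))) \<partial>lebesgue)" .
  have int': "set_integrable lebesgue {r..<1} (\<lambda>s. \<nu> (of_real s))"
    using r by (intro set_integrable_subset[OF int]) auto
  have nn: "0 \<le> indicator {r..<1} s *\<^sub>R \<nu> (of_real s)" for s :: real
    using pos[of "of_real s"] r by (auto split: split_indicator)
  have wt: "ennreal (weight_tail \<nu> r) = (\<integral>\<^sup>+s. ennreal (indicator {r..<1} s *\<^sub>R \<nu> (of_real s)) \<partial>lebesgue)"
    unfolding weight_tail_def set_lebesgue_integral_def
    using int' nn unfolding set_integrable_def by (intro nn_integral_eq_integral[symmetric]) auto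
  have wt0: "0 \<le> weight_tail \<nu> r"
    unfolding weight_tail_def set_lebesgue_integral_def using nn by (intro integral_nonneg_AE) auto
  have [measurable]: "(\<lambda>s. indicator {r..<1} s *\<^sub>R \<nu> (of_real s)) \<in> borel_measurable lebesgue"
    using int' unfolding set_integrable_def by (rule borel_measurable_integrable)
  have "ennreal (tail_mass \<nu> r) \<le> (\<integral>\<^sup>+s. ennreal 2 * ennreal (indicator {r..<1} s *\<^sub>R \<nu> (of_real s)) \<partial>lebesgue)"
    unfolding eq
  proof (intro nn_integral_mono)
    fix s :: real
    show "ennreal (2 * s * (indicator {r..<1} s *\<^sub>R \<nu> (of_real s))) \<le> ennreal 2 * ennreal (indicator {r..<1} s *\<^sub>R \<nu> (of_real s))"
    proof (cases "s \<in> {r..<1}")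
      case True
      then have "0 \<le> \<nu> (of_real s)" using nn[of s] by simp
      moreover from this have "s * \<nu> (of_real s) \<le> 1 * \<nu> (of_real s)"
        using True by (intro mult_right_mono) auto
      ultimately have "2 * s * (indicator {r..<1} s *\<^sub>R \<nu> (of_real s)) \<le> 2 * (indicator {r..<1} s *\<^sub>R \<nu> (of_real s))"
        using True by simp
      then show ?thesis using nn[of s] by (subst ennreal_mult[symmetric]) (auto intro: ennreal_leI)
    qed simp
  qed
  also have "\<dots> = ennreal 2 * ennreal (weight_tail \<nu> r)" unfolding wt by (rule nn_integral_cmult) measurable
  finally have "ennreal (tail_mass \<nu> r) \<le> ennreal (2 * weight_tail \<nu> r)"
    using wt0 by (simp add: ennreal_mult)
  then show "tail_mass \<nu> r \<le> 2 * weight_tail \<nu> r"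
    using wt0 by (subst (asm) ennreal_le_iff) auto
  assume r2: "1/2 \<le> r"
  have "ennreal (weight_tail \<nu> r) \<le> ennreal (tail_mass \<nu> r)"
    unfolding eq wt
  proof (intro nn_integral_mono ennreal_leI)
    fix s :: real
    show "indicator {r..<1} s *\<^sub>R \<nu> (of_real s) \<le> 2 * s * (indicator {r..<1} s *\<^sub>R \<nu> (of_real s))"
      using nn[of s] r2 mult_right_mono[of 1 "2 * s" "\<nu> (of_real s)"] by (auto split: split_indicator)
  qed
  then show "weight_tail \<nu> r \<le> tail_mass \<nu> r"
    by (subst (asm) ennreal_le_iff) (auto simp: tail_mass_def)
qed

lemma tail_mass_antimono:
  assumes "weight \<nu>" "r \<le> s" shows "tail_mass \<nu> s \<le> tail_mass \<nu> r"
proof -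
  interpret V: finite_measure "weighted \<nu>" by (rule finite_measure_weighted[OF assms(1)])
  show ?thesis unfolding tail_mass_def
    by (rule V.finite_measure_mono) (use assms annulus_measurable in auto)
qed

text \<open>The lower bound of the annular tail is only available for radii above 1/2, but \<open>(1 + r) / 2\<close> always
  is such a radius.\<close>

lemma tail_mass_halving:
  assumes "\<nu> \<in> D_hat"
  obtains c where "1 \<le> c" "\<And>r k. 0 \<le> r \<Longrightarrow> r < 1 \<Longrightarrow> tail_mass \<nu> r \<le> c^k * tail_mass \<nu> (1 - (1 - r) / 2^k)"
proof -
  have \<nu>: "radial_weight \<nu>" using assms by (simp add: D_hat_def)
  obtain C where C: "1 < C" "\<And>r. 0 \<le> r \<Longrightarrow> r < 1 \<Longrightarrow> weight_tail \<nu> r \<le> C * weight_tail \<nu> ((1 + r) / 2)"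
    using assms by (auto simp: D_hat_def)
  have step: "tail_mass \<nu> r \<le> (2 * C) * tail_mass \<nu> ((1 + r) / 2)" if "0 \<le> r" "r < 1" for r
  proof -
    have "tail_mass \<nu> r \<le> 2 * weight_tail \<nu> r" using tail_mass_le[OF \<nu>] that by simp
    also have "\<dots> \<le> 2 * (C * weight_tail \<nu> ((1 + r) / 2))" using C(2)[OF that] by simp
    also have "\<dots> \<le> 2 * (C * tail_mass \<nu> ((1 + r) / 2))"
      using C(1) weight_tail_le[OF \<nu>, of "(1 + r) / 2"] that by (intro mult_left_mono) auto
    finally show ?thesis by simp
  qed
  show ?thesis
  proof (rule that[of "2 * C"])
    show "1 \<le> 2 * C" using C by simp
    fix r :: real and k assume r: "0 \<le> r" "r < 1"
    show "tail_mass \<nu> r \<le> (2*C)^k * tail_mass \<nu> (1 - (1 - r) / 2^k)"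
    proof (induction k)
      case (Suc k)
      have "1 \<le> (2::real)^k" by simp
      then have "(1 - r) / 2^k \<le> (1 - r) / 1" using r by (intro divide_left_mono) auto
      also have "\<dots> \<le> 1" using r by simp
      finally have "(1 - r) / 2^k \<le> 1" .
      moreover have "0 < (1 - r) / 2^k" using r by simp
      ultimately have "0 \<le> 1 - (1 - r) / 2^k" "1 - (1 - r) / 2^k < 1" by (simp_all only: diff_ge_0_iff_ge diff_less_eq)
      then have "tail_mass \<nu> (1 - (1 - r) / 2^k) \<le> (2 * C) * tail_mass \<nu> ((1 + (1 - (1 - r) / 2^k)) / 2)"
        by (rule step)
      also have "(1 + (1 - (1 - r) / 2^k)) / 2 = 1 - (1 - r) / 2^Suc k" by (simp add: field_simps)
      finally have "(2*C)^k * tail_mass \<nu> (1 - (1 - r) / 2^k) \<le> (2*C)^k * ((2*C) * tail_mass \<nu> (1 - (1 - r) / 2^Suc k))"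
        using C(1) by (intro mult_left_mono) auto
      with Suc show ?case by (simp add: mult_ac)
    qed simp
  qed
qed

section \<open>Transfer from the radial weight to the general weight\<close>

text \<open>The positive numbers \<open>X\<close> and \<open>Y\<close> bound the two integrals from above. Normalizing by them instead of
  the integrals avoids the case of a vanishing integral.\<close>

lemma nn_integral_Hoelder:
  fixes f g :: "'a \<Rightarrow> real"
  assumes [measurable]: "f \<in> borel_measurable M" "g \<in> borel_measurable M"
    and nn: "\<And>x. x \<in> space M \<Longrightarrow> 0 \<le> f x" "\<And>x. x \<in> space M \<Longrightarrow> 0 \<le> g x"
    and pq: "1 < p" "1 < q" "1/p + 1/q = 1"
    and X: "0 < X" "(\<integral>\<^sup>+x. ennreal (f x powr p) \<partial>M) \<le> ennreal X"
    and Y: "0 < Y" "(\<integral>\<^sup>+x. ennreal (g x powr q) \<partial>M) \<le> ennreal Y"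
  shows "(\<integral>\<^sup>+x. ennreal (f x * g x) \<partial>M) \<le> ennreal (X powr (1/p) * Y powr (1/q))"
proof -
  define A where "A = X powr (1/p)"
  define B where "B = Y powr (1/q)"
  have AB: "0 < A" "0 < B" "A powr p = X" "B powr q = Y"
    using X Y pq by (auto simp: A_def B_def powr_powr)
  have pw: "f x * g x \<le> (A * B / (p * X)) * f x powr p + (A * B / (q * Y)) * g x powr q" if "x \<in> space M" for x
  proof -
    have "(f x / A) * (g x / B) \<le> (f x / A) powr p / p + (g x / B) powr q / q"
      using nn[OF that] AB pq by (intro Youngs_inequality) auto
    also have "\<dots> = f x powr p / (p * X) + g x powr q / (q * Y)"
      using nn[OF that] AB by (simp add: powr_divide mult.commute)
    finally have "A * B * ((f x / A) * (g x / B)) \<le> A * B * (f x powr p / (p * X) + g x powr q / (q * Y))"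
      using AB by (intro mult_left_mono) auto
    then show ?thesis using AB by (simp add: distrib_left)
  qed
  have c: "0 \<le> A * B / (p * X)" "0 \<le> A * B / (q * Y)" using AB X Y pq by auto
  have lin: "ennreal (\<alpha> * F + \<beta> * G) = ennreal \<alpha> * ennreal F + ennreal \<beta> * ennreal G"
    if "0 \<le> \<alpha>" "0 \<le> \<beta>" "0 \<le> F" "0 \<le> G" for \<alpha> \<beta> F G :: real
    using that by (simp add: ennreal_plus ennreal_mult)
  have "(\<integral>\<^sup>+x. ennreal (f x * g x) \<partial>M) \<le>
      (\<integral>\<^sup>+x. ennreal (A * B / (p * X)) * ennreal (f x powr p) + ennreal (A * B / (q * Y)) * ennreal (g x powr q) \<partial>M)"
  proof (intro nn_integral_mono)
    fix x assume x: "x \<in> space M"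
    from ennreal_leI[OF pw[OF x]] lin[OF c] show "ennreal (f x * g x) \<le>
        ennreal (A * B / (p * X)) * ennreal (f x powr p) + ennreal (A * B / (q * Y)) * ennreal (g x powr q)"
      by simp
  qed
  also have "\<dots> = ennreal (A * B / (p * X)) * (\<integral>\<^sup>+x. ennreal (f x powr p) \<partial>M)
      + ennreal (A * B / (q * Y)) * (\<integral>\<^sup>+x. ennreal (g x powr q) \<partial>M)"
    by (simp add: nn_integral_add nn_integral_cmult)
  also have "\<dots> \<le> ennreal (A * B / (p * X)) * ennreal X + ennreal (A * B / (q * Y)) * ennreal Y"
    by (intro add_mono mult_left_mono X Y) auto
  also have "\<dots> = ennreal (A * B / (p * X) * X + A * B / (q * Y) * Y)"
    using X Y by (intro lin[OF c, symmetric]) auto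
  also have "A * B / (p * X) * X + A * B / (q * Y) * Y = A * B * (1/p + 1/q)"
    using X Y by (simp add: distrib_left)
  also have "\<dots> = A * B" using pq by simp
  finally show ?thesis by (simp add: A_def B_def)
qed

lemma weight_square_pos:
  assumes "weight \<omega>" "a \<in> disc"
  shows "0 < mass \<omega> (carleson_square a)"
proof -
  interpret V: finite_measure "weighted \<omega>" by (rule finite_measure_weighted[OF assms(1)])
  have pos: "0 < emeasure (weighted \<omega>) (carleson_square b)" if "b \<in> disc" "b \<noteq> 0" for b
    using assms(1) that by (auto simp: weight_def)
  have "0 < emeasure (weighted \<omega>) (carleson_square a)"
  proof (cases "a = 0")
    case True
    have h: "(1/2::complex) \<in> disc" by (simp add: norm_divide)
    have "0 < emeasure (weighted \<omega>) (carleson_square (1/2))" using pos h by simp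
    also have "\<dots> \<le> emeasure (weighted \<omega>) (carleson_square a)"
      using True carleson_square_subset_disc[of "1/2"] by (intro emeasure_mono) auto
    finally show ?thesis .
  qed (use pos assms in auto)
  then show ?thesis by (simp add: V.emeasure_eq_measure)
qed

lemma tail_mass_pos:
  assumes "radial_weight \<nu>" "0 \<le> r" "r < 1"
  shows "0 < tail_mass \<nu> r"
proof -
  have w: "weight \<nu>" using assms by (simp add: radial_weight_def)
  have r: "norm (of_real r :: complex) = r" "(of_real r :: complex) \<in> disc" using assms by auto
  have "0 < (1 - r) * tail_mass \<nu> r"
    using carleson_square_mass_le[OF assms(1) r(2)] weight_square_pos[OF w r(2)] unfolding r(1) by linarith
  then show ?thesis using assms by (simp add: zero_less_mult_iff)
qed

lemma set_nn_integral_weighted: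
  assumes "weight \<omega>" "a \<in> disc" and [measurable]: "g \<in> borel_measurable (lebesgue_on disc)"
  shows "(\<integral>\<^sup>+z\<in>carleson_square a. g z \<partial>weighted \<omega>) = (\<integral>\<^sup>+z. ennreal (\<omega> z) * (g z * indicator (carleson_square a) z) \<partial>dA)"
proof -
  have [measurable]: "carleson_square a \<in> sets (lebesgue_on disc)" using assms(2) by (rule carleson_square_measurable)
  show ?thesis by (rule nn_integral_weighted[OF assms(1)]) measurable
qed

text \<open>The inequality of Hoelder for \<open>u \<nu> = (u \<omega>^(1/s)) (\<nu> \<omega>^(-1/s))\<close>. The factorization fails where
  \<open>\<omega> = 0 < \<nu>\<close>; there the dual integrand is infinite. But its integral over the square is finite, since
  \<open>\<omega>\<close> has positive mass on the square, so this set is a null set.\<close>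

lemma quotient_in_B_transfer:
  assumes w: "weight \<omega>" and \<nu>: "weight \<nu>" and s: "1 < s" and B: "quotient_in_B s \<nu> \<omega>"
  obtains C where "0 < C"
    "\<And>a u X. a \<in> disc \<Longrightarrow> u \<in> borel_measurable (lebesgue_on disc) \<Longrightarrow> (\<And>z. 0 \<le> u z) \<Longrightarrow> 0 < X \<Longrightarrow>
      square_integral \<omega> (\<lambda>z. u z powr s) a \<le> ennreal X \<Longrightarrow>
      square_integral \<nu> u a \<le>
        ennreal (C * mass \<nu> (carleson_square a) * (X / mass \<omega> (carleson_square a)) powr (1/s))"
proof -
  define s' where "s' = s / (s - 1)"
  have s': "1 < s'" "1/s + 1/s' = 1" using s by (auto simp: s'_def field_simps)
  interpret W: finite_measure "weighted \<omega>" by (rule finite_measure_weighted[OF w])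
  interpret V: finite_measure "weighted \<nu>" by (rule finite_measure_weighted[OF \<nu>])
  obtain C0 where C0: "\<And>S. S \<in> carleson_squares \<Longrightarrow>
        epowr (emeasure (weighted \<omega>) S) (1 / s) * epowr (\<integral>\<^sup>+z\<in>S. dual_integrand s \<nu> \<omega> z \<partial>dA) (1 / s')
        \<le> ennreal C0 * emeasure (weighted \<nu>) S"
    using B unfolding quotient_in_B_def s'_def by blast
  define C where "C = max C0 1"
  have wm[measurable]: "\<omega> \<in> borel_measurable (lebesgue_on disc)" "\<nu> \<in> borel_measurable (lebesgue_on disc)"
    using w \<nu> weight_measurable by auto
  have nn: "0 \<le> \<omega> z" "0 \<le> \<nu> z" if "z \<in> disc" for z using w \<nu> that by (auto simp: weight_def)
  show ?thesis
  proof (rule that[of C])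
    show "0 < C" by (simp add: C_def)
    fix a u X assume a: "a \<in> disc" and u[measurable]: "u \<in> borel_measurable (lebesgue_on disc)" and u0: "\<And>z. 0 \<le> u z"
      and X: "0 < X" "square_integral \<omega> (\<lambda>z. u z powr s) a \<le> ennreal X"
    define S where "S = carleson_square a"
    have S[measurable]: "S \<in> sets (lebesgue_on disc)" unfolding S_def using a by (rule carleson_square_measurable)
    have Sd: "S \<subseteq> disc" unfolding S_def by (rule carleson_square_subset_disc)
    define vS where "vS = mass \<nu> S"
    define wS where "wS = mass \<omega> S"
    have pos: "0 < vS" "0 < wS" using weight_square_pos w \<nu> a by (auto simp: vS_def wS_def S_def)
    define J where "J = (\<integral>\<^sup>+z\<in>S. dual_integrand s \<nu> \<omega> z \<partial>dA)"
    have "epowr (ennreal wS) (1/s) * epowr J (1/s') \<le> ennreal C0 * ennreal vS"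
      using C0[of S] a by (simp add: carleson_squares_def S_def J_def vS_def wS_def W.emeasure_eq_measure V.emeasure_eq_measure)
    also have "\<dots> \<le> ennreal C * ennreal vS" by (intro mult_right_mono ennreal_leI) (auto simp: C_def)
    also have "\<dots> = ennreal (C * vS)" using pos by (simp add: ennreal_mult C_def)
    finally have J1: "ennreal (wS powr (1/s)) * epowr J (1/s') \<le> ennreal (C * vS)"
      using pos by (simp add: epowr_def)
    have Jfin: "J \<noteq> \<infinity>"
    proof
      assume "J = \<infinity>"
      then have "ennreal (wS powr (1/s)) * \<infinity> \<le> ennreal (C * vS)" using J1 by (simp add: epowr_def)
      moreover have "ennreal (wS powr (1/s)) * \<infinity> = \<infinity>" using pos by (simp add: ennreal_mult_top)
      ultimately show False by (simp add: top_unique)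
    qed
    then obtain j where j: "J = ennreal j" "0 \<le> j" by (cases J) auto
    \<comment> \<open>The \<open>B_s\<close> condition read as a bound for the dual integral.\<close>
    define Y where "Y = (C * vS / wS powr (1/s)) powr s'"
    have Ypos: "0 < Y" using pos by (simp add: Y_def C_def)
    have Y': "Y powr (1/s') = C * vS / wS powr (1/s)" using pos s' by (simp add: Y_def powr_powr C_def)
    have "wS powr (1/s) * j powr (1/s') \<le> C * vS"
      using J1 j pos by (simp add: epowr_def ennreal_mult[symmetric] C_def)
    then have "j powr (1/s') \<le> C * vS / wS powr (1/s)" using pos by (simp add: field_simps)
    then have "(j powr (1/s')) powr s' \<le> Y" unfolding Y_def using s' by (intro powr_mono2) auto
    then have jY: "j \<le> Y" using s' j by (simp add: powr_powr)
    define f where "f z = u z * \<omega> z powr (1/s) * indicator S z" for z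
    define g where "g z = \<nu> z * \<omega> z powr (-1/s) * indicator S z" for z
    have [measurable]: "f \<in> borel_measurable dA" "g \<in> borel_measurable dA" unfolding f_def g_def by measurable
    have dual_meas[measurable]: "dual_integrand s \<nu> \<omega> \<in> borel_measurable (lebesgue_on disc)"
      unfolding dual_integrand_def by measurable
    have fin: "AE z in dA. dual_integrand s \<nu> \<omega> z * indicator S z \<noteq> \<infinity>"
      using Jfin unfolding J_def by (intro nn_integral_noteq_infinite) auto
    have "(\<integral>\<^sup>+z. ennreal (f z powr s) \<partial>dA) = (\<integral>\<^sup>+z. ennreal (\<omega> z) * (ennreal (u z powr s) * indicator S z) \<partial>dA)"
    proof (rule nn_integral_cong)
      fix z assume "z \<in> space dA"
      then have "0 \<le> \<omega> z" using nn by simp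
      then show "ennreal (f z powr s) = ennreal (\<omega> z) * (ennreal (u z powr s) * indicator S z)"
        using s u0[of z] by (auto simp: f_def powr_mult powr_powr ennreal_mult[symmetric] mult.commute split: split_indicator)
    qed
    also have "\<dots> \<le> ennreal X" using X(2) set_nn_integral_weighted[OF w a, of "\<lambda>z. ennreal (u z powr s)"]
      unfolding S_def by simp
    finally have fX: "(\<integral>\<^sup>+z. ennreal (f z powr s) \<partial>dA) \<le> ennreal X" .
    have "(\<integral>\<^sup>+z. ennreal (g z powr s') \<partial>dA) \<le> J" unfolding J_def
    proof (rule nn_integral_mono)
      fix z assume "z \<in> space dA"
      then show "ennreal (g z powr s') \<le> dual_integrand s \<nu> \<omega> z * indicator S z"
        using s' by (auto simp: g_def dual_integrand_def s'_def split: split_indicator)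
    qed
    also have "\<dots> \<le> ennreal Y" using j jY by (simp add: ennreal_leI)
    finally have gY: "(\<integral>\<^sup>+z. ennreal (g z powr s') \<partial>dA) \<le> ennreal Y" .
    have "(\<integral>\<^sup>+z\<in>S. ennreal (u z) \<partial>weighted \<nu>) = (\<integral>\<^sup>+z. ennreal (\<nu> z) * (ennreal (u z) * indicator S z) \<partial>dA)"
      unfolding S_def by (rule set_nn_integral_weighted[OF \<nu> a]) measurable
    also have "\<dots> = (\<integral>\<^sup>+z. ennreal (f z * g z) \<partial>dA)"
    proof (rule nn_integral_cong_AE)
      show "AE z in dA. ennreal (\<nu> z) * (ennreal (u z) * indicator S z) = ennreal (f z * g z)"
        using fin AE_space
      proof eventually_elim
        fix z assume z: "dual_integrand s \<nu> \<omega> z * indicator S z \<noteq> \<infinity>" "z \<in> space dA"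
        show "ennreal (\<nu> z) * (ennreal (u z) * indicator S z) = ennreal (f z * g z)"
        proof (cases "z \<in> S \<and> \<nu> z \<noteq> 0")
          case True
          then have "\<omega> z \<noteq> 0" using z by (auto simp: dual_integrand_def)
          then have "\<omega> z > 0" using nn[of z] z by simp
          then have "\<omega> z powr (1/s) * \<omega> z powr (-1/s) = 1" by (simp add: powr_add[symmetric])
          then have "f z * g z = u z * \<nu> z"
            using True by (simp add: f_def g_def mult.assoc mult.left_commute[of _ "\<nu> z"])
          then show ?thesis using True nn[of z] z u0[of z] by (simp add: ennreal_mult[symmetric] mult.commute)
        next
          case False
          then show ?thesis by (auto simp: f_def g_def split: split_indicator)
        qed
      qed
    qed
    also have "\<dots> \<le> ennreal (X powr (1/s) * Y powr (1/s'))"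
      using s s' X(1) Ypos fX gY nn u0 by (intro nn_integral_Hoelder) (auto simp: f_def g_def)
    also have "X powr (1/s) * Y powr (1/s') = C * vS * (X / wS) powr (1/s)"
      using X(1) pos by (simp add: Y' powr_divide)
    finally show "square_integral \<nu> u a \<le>
        ennreal (C * mass \<nu> (carleson_square a) * (X / mass \<omega> (carleson_square a)) powr (1/s))"
      by (simp add: S_def vS_def wS_def)
  qed
qed

lemma tent_measurable:
  assumes "0 < d" shows "tent a d \<in> sets (lebesgue_on disc)"
  by (metis assms tent_eq_carleson_square carleson_square_measurable)

text \<open>Enlarging a square by \<open>2^n\<close> costs a factor \<open>2^n\<close> for the angle and, by halving the distance to the
  boundary repeatedly, a factor \<open>c^n\<close> for the tail; the additional 2 in the exponents comes from the
  factor 4 in the definition of tents.\<close>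

lemma radial_tent_mass:
  assumes \<nu>: "radial_weight \<nu>"
    and c: "1 \<le> c" "\<And>r k. 0 \<le> r \<Longrightarrow> r < 1 \<Longrightarrow> tail_mass \<nu> r \<le> c^k * tail_mass \<nu> (1 - (1 - r) / 2^k)"
    and a: "a \<in> disc"
  shows "mass \<nu> (tent a (2^n * (1 - norm a))) \<le> 2^(n+2) * c^(n+2) * (1 - norm a) * tail_mass \<nu> (norm a)"
proof -
  have w: "weight \<nu>" using \<nu> by (simp add: radial_weight_def)
  define h where "h = 1 - norm a"
  have h: "0 < h" using a by (simp add: h_def)
  then have "0 < 2^n * h" by simp
  from tent_eq_carleson_square[OF this] obtain b where
    b: "b \<in> disc" "tent a (2^n * h) = carleson_square b" "norm b = max 0 (1 - 4 * (2^n * h))" by blast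
  have nb: "0 < 1 - norm b" "1 - norm b \<le> 2^(n+2) * h" using b by auto
  have "mass \<nu> (tent a (2^n * h)) \<le> (1 - norm b) * tail_mass \<nu> (norm b)"
    unfolding b(2) by (rule carleson_square_mass_le[OF \<nu> b(1)])
  also have "\<dots> \<le> (2^(n+2) * h) * (c^(n+2) * tail_mass \<nu> (1 - (1 - norm b) / 2^(n+2)))"
    using nb h c(2)[of "norm b" "n+2"] by (intro mult_mono) (auto simp: tail_mass_def)
  also have "\<dots> \<le> (2^(n+2) * h) * (c^(n+2) * tail_mass \<nu> (norm a))"
  proof -
    have "(1 - norm b) / 2^(n+2) \<le> h" using nb by (simp add: divide_le_eq mult.commute)
    then have "tail_mass \<nu> (1 - (1 - norm b) / 2^(n+2)) \<le> tail_mass \<nu> (norm a)"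
      by (intro tail_mass_antimono[OF w]) (auto simp: h_def)
    then show ?thesis using c(1) h by (intro mult_left_mono) auto
  qed
  finally show ?thesis by (simp add: h_def mult_ac)
qed

lemma power_powr_commute: "0 < x \<Longrightarrow> (x^n) powr s = (x powr s)^n" for x :: real
  by (simp add: powr_power powr_realpow[symmetric] powr_powr mult.commute)

text \<open>Transfer applied to the indicator function of the small square \<open>S\<close> inside the tent \<open>T\<close> yields
  \<open>\<nu>(S) / \<nu>(T) \<le> C (\<omega>(S) / \<omega>(T))^(1/s)\<close>, and the left-hand side is at least a constant times
  \<open>(2 c)^(-n)\<close>. The bound \<open>n \<ge> 1\<close> ensures that the tent contains the square.\<close>

lemma B_infty_tent_doubling:
  assumes \<nu>: "\<nu> \<in> D_hat" and \<omega>: "\<omega> \<in> B_infty \<nu>"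
  obtains K where "1 \<le> K" "\<And>a n. a \<in> disc \<Longrightarrow> 1 \<le> n \<Longrightarrow>
    mass \<omega> (tent a (2^n * (1 - norm a))) \<le> K^(n+1) * mass \<omega> (carleson_square a)"
proof -
  have rv: "radial_weight \<nu>" and wv: "weight \<nu>" using \<nu> unfolding D_hat_def radial_weight_def by blast+
  obtain s where s: "1 < s" and w: "weight \<omega>" and B: "quotient_in_B s \<nu> \<omega>" using \<omega> by (auto simp: B_infty_def)
  interpret W: finite_measure "weighted \<omega>" by (rule finite_measure_weighted[OF w])
  interpret V: finite_measure "weighted \<nu>" by (rule finite_measure_weighted[OF wv])
  obtain C where C: "0 < C"
    "\<And>a u X. a \<in> disc \<Longrightarrow> u \<in> borel_measurable (lebesgue_on disc) \<Longrightarrow> (\<And>z. 0 \<le> u z) \<Longrightarrow> 0 < X \<Longrightarrow>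
      square_integral \<omega> (\<lambda>z. u z powr s) a \<le> ennreal X \<Longrightarrow>
      square_integral \<nu> u a \<le>
        ennreal (C * mass \<nu> (carleson_square a) * (X / mass \<omega> (carleson_square a)) powr (1/s))"
    using quotient_in_B_transfer[OF w wv s B] by blast
  obtain c where c: "1 \<le> c" "\<And>r k. 0 \<le> r \<Longrightarrow> r < 1 \<Longrightarrow> tail_mass \<nu> r \<le> c^k * tail_mass \<nu> (1 - (1 - r) / 2^k)"
    using tail_mass_halving[OF \<nu>] by blast
  define A where "A = (C * (16 * pi * c^2)) powr s"
  define D where "D = (2 * c) powr s"
  define K where "K = max 1 (max A D)"
  show ?thesis
  proof (rule that[of K])
    show "1 \<le> K" by (simp add: K_def)
    fix a :: complex and n :: nat assume a: "a \<in> disc" and n: "1 \<le> n"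
    define T where "T = tent a (2^n * (1 - norm a))"
    define S where "S = carleson_square a"
    have h: "0 < 1 - norm a" using a by simp
    then have "0 < 2^n * (1 - norm a)" by simp
    note d = this
    obtain b where b: "b \<in> disc" "T = carleson_square b"
      using tent_eq_carleson_square[OF d] unfolding T_def by metis
    have ST: "S \<subseteq> T"
    proof -
      have "2 * (1 - norm a) \<le> 2^n * (1 - norm a)"
        using h power_increasing[OF n, of "2::real"] by (intro mult_right_mono) auto
      then have "S \<subseteq> disc \<inter> cball (cis (Arg a)) (2^n * (1 - norm a))"
        using carleson_square_subset_cball[OF a] carleson_square_subset_disc[of a] unfolding S_def by fastforce
      also have "\<dots> \<subseteq> T" unfolding T_def by (rule disc_Int_cball_subset_tent[OF d])
      finally show ?thesis .
    qed
    have meas[measurable]: "S \<in> sets (lebesgue_on disc)" "T \<in> sets (lebesgue_on disc)"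
      using carleson_square_measurable a b by (auto simp: S_def)
    define wS where "wS = mass \<omega> S"
    define wT where "wT = mass \<omega> T"
    define vS where "vS = mass \<nu> S"
    define vT where "vT = mass \<nu> T"
    have pos: "0 < wS" "0 < wT" "0 < vS" "0 < vT"
      using weight_square_pos w wv a b by (auto simp: wS_def wT_def vS_def vT_def S_def)
    have int: "(\<integral>\<^sup>+z\<in>T. ennreal (indicator S z) \<partial>weighted \<rho>) = emeasure (weighted \<rho>) S" for \<rho>
    proof -
      have "(\<integral>\<^sup>+z\<in>T. ennreal (indicator S z) \<partial>weighted \<rho>) = (\<integral>\<^sup>+z. indicator S z \<partial>weighted \<rho>)"
        using ST by (intro nn_integral_cong) (auto split: split_indicator)
      then show ?thesis by simp
    qed
    have "(indicator S z :: real) powr s = indicator S z" for z by (simp split: split_indicator)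
    then have "(\<integral>\<^sup>+z\<in>T. ennreal (indicator S z powr s) \<partial>weighted \<omega>) \<le> ennreal wS"
      by (simp add: int wS_def W.emeasure_eq_measure)
    then have "(\<integral>\<^sup>+z\<in>T. ennreal (indicator S z) \<partial>weighted \<nu>) \<le> ennreal (C * vT * (wS / wT) powr (1/s))"
      using C(2)[OF b(1), of "indicator S" wS] pos meas unfolding b(2)[symmetric] wT_def vT_def by simp
    then have "ennreal vS \<le> ennreal (C * vT * (wS / wT) powr (1/s))"
      unfolding int vS_def V.emeasure_eq_measure .
    then have "vS \<le> C * vT * (wS / wT) powr (1/s)"
      using C(1) pos by (subst (asm) ennreal_le_iff) auto
    then have 1: "(wT / wS) powr (1/s) \<le> C * (vT / vS)"
      using pos by (simp add: powr_divide field_simps)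
    have "vT \<le> 2^(n+2) * c^(n+2) * ((1 - norm a) * tail_mass \<nu> (norm a))"
      unfolding vT_def T_def using radial_tent_mass[OF rv c a, of n] by (simp add: mult.assoc)
    also have "\<dots> \<le> 2^(n+2) * c^(n+2) * (4 * pi * vS)"
      using carleson_square_mass_ge[OF rv a] c(1) unfolding vS_def S_def
      by (intro mult_left_mono) (auto simp: field_simps)
    also have "\<dots> = (16 * pi * c^2) * (2 * c)^n * vS" by (simp add: power_mult_distrib power_add power2_eq_square)
    finally have "vT / vS \<le> (16 * pi * c^2) * (2 * c)^n" using pos by (simp add: divide_le_eq)
    then have "C * (vT / vS) \<le> C * ((16 * pi * c^2) * (2 * c)^n)"
      using C(1) by (intro mult_left_mono) auto
    with 1 have 2: "(wT / wS) powr (1/s) \<le> (C * (16 * pi * c^2)) * (2 * c)^n" by simp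
    have "((wT / wS) powr (1/s)) powr s \<le> ((C * (16 * pi * c^2)) * (2 * c)^n) powr s"
      using s 2 by (intro powr_mono2) auto
    also have "\<dots> = A * D^n"
    proof -
      have "((2 * c)^n) powr s = D^n"
        unfolding D_def using c(1) by (intro power_powr_commute) auto
      then show ?thesis using C(1) c(1) unfolding A_def by (subst powr_mult) auto
    qed
    also have "\<dots> \<le> K * K^n"
      by (intro mult_mono power_mono) (auto simp: K_def A_def D_def)
    finally have "wT / wS \<le> K^(n+1)" using s pos by (simp add: powr_powr)
    then show "mass \<omega> (tent a (2^n * (1 - norm a))) \<le> K^(n+1) * mass \<omega> (carleson_square a)"
      using pos unfolding wT_def wS_def T_def S_def by (simp add: divide_le_eq)
  qed
qed

section \<open>Extended nonnegative powers and quotients\<close>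

lemma ennreal_divide_le_iff:
  fixes x y :: ennreal
  assumes "0 < w" shows "x / ennreal w \<le> y \<longleftrightarrow> x \<le> y * ennreal w"
proof
  assume "x / ennreal w \<le> y"
  then have "x / ennreal w * ennreal w \<le> y * ennreal w" by (rule mult_right_mono) simp
  moreover have "x / ennreal w * ennreal w = x"
    using assms by (simp add: ennreal_divide_times mult_divide_eq_ennreal)
  ultimately show "x \<le> y * ennreal w" by simp
next
  assume "x \<le> y * ennreal w"
  then have "x / ennreal w \<le> y * ennreal w / ennreal w" by (rule divide_right_mono_ennreal)
  then show "x / ennreal w \<le> y" using assms by (simp add: mult_divide_eq_ennreal)
qed

lemma epowr_ennreal [simp]: "0 \<le> x \<Longrightarrow> epowr (ennreal x) a = ennreal (x powr a)"
  by (simp add: epowr_def)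

lemma epowr_top [simp]: "epowr \<infinity> a = \<infinity>" "epowr top a = top"
  by (simp_all add: epowr_def)

lemma epowr_zero [simp]: "epowr 0 a = 0"
  by (simp add: epowr_def)

lemma borel_measurable_epowr [measurable]:
  assumes [measurable]: "f \<in> borel_measurable M"
  shows "(\<lambda>x. epowr (f x) a) \<in> borel_measurable M"
  unfolding epowr_def by measurable

lemma epowr_mono: "0 \<le> a \<Longrightarrow> x \<le> y \<Longrightarrow> epowr x a \<le> epowr y a"
  by (cases x; cases y) (auto intro!: ennreal_leI powr_mono2 simp: top_unique)

lemma epowr_epowr: "0 < a \<Longrightarrow> 0 < b \<Longrightarrow> epowr (epowr x a) b = epowr x (a * b)"
  by (cases x) (auto simp: powr_powr)

lemma epowr_mult: "0 \<le> c \<Longrightarrow> 0 < a \<Longrightarrow> epowr (ennreal c * x) a = ennreal (c powr a) * epowr x a"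
  by (cases x; cases "c = 0") (auto simp: ennreal_mult[symmetric] powr_mult ennreal_mult_top)

lemma epowr_inverse: "0 < a \<Longrightarrow> epowr (epowr x a) (1/a) = x" "0 < a \<Longrightarrow> epowr (epowr x (1/a)) a = x"
  by (cases x; simp add: powr_powr)+

text \<open>Operator norms are infima of admissible constants. Since powers are order isomorphisms, an
  estimate that holds for each admissible constant holds for the norm.\<close>

lemma le_epowr_Inf:
  fixes Z :: ennreal
  assumes k: "0 < k" and q: "0 < q" and le: "\<And>C. C \<in> A \<Longrightarrow> Z \<le> ennreal k * epowr C q"
  shows "Z \<le> ennreal k * epowr (Inf A) q"
proof -
  have div: "x / ennreal k \<le> y \<longleftrightarrow> x \<le> ennreal k * y" for x y :: ennreal
    using ennreal_divide_le_iff[OF k, of x y] by (simp add: mult.commute)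
  have "epowr (Z / ennreal k) (1/q) \<le> C" if "C \<in> A" for C
  proof -
    have "epowr (Z / ennreal k) (1/q) \<le> epowr (epowr C q) (1/q)"
      using le[OF that] q unfolding div[symmetric] by (intro epowr_mono) auto
    then show ?thesis using q by (simp add: epowr_inverse)
  qed
  then have "epowr (Z / ennreal k) (1/q) \<le> Inf A" by (rule Inf_greatest)
  then have "epowr (epowr (Z / ennreal k) (1/q)) q \<le> epowr (Inf A) q" using q by (intro epowr_mono) auto
  then show ?thesis using q by (simp add: epowr_inverse div)
qed

section \<open>Domination of holomorphic functions by the maximal function\<close>

lemma norm_diff_cis_Arg: "norm z \<le> 1 \<Longrightarrow> norm (z - cis (Arg z)) = 1 - norm z"
proof (cases "z = 0")
  case True
  then show ?thesis by simp
next
  case False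
  assume z: "norm z \<le> 1"
  have "z - cis (Arg z) = of_real (norm z - 1) * sgn z"
    using False by (simp add: cis_Arg sgn_eq left_diff_distrib divide_simps)
  then show ?thesis using z False by (simp only: norm_mult norm_sgn norm_of_real) simp
qed

text \<open>Only one term of the series is used: the one for the least \<open>n\<close> with \<open>|w - z| \<le> 2^n (1 - |z|)\<close>. By
  minimality \<open>|w - z| > 2^(n-1) (1 - |z|)\<close> unless \<open>n = 0\<close>, and then the lower bound on \<open>|w|\<close> gives the
  same with \<open>\<ge>\<close>.\<close>

lemma kernel_le_dyadic_sum:
  assumes z: "z \<in> disc" and w: "w \<in> disc" "1 - (1 - norm z) / 2 \<le> norm w"
  shows "ennreal ((2 * (1 - norm z))^N / norm (w - z)^(N+1)) \<le>
    (\<Sum>n. ennreal (2^(2*N+1) / (1 - norm z) * (1/2)^(n*(N+1))) * indicator (tent z (2^(n+1) * (1 - norm z))) w)"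
proof -
  define h where "h = 1 - norm z"
  have h: "0 < h" using z by (simp add: h_def)
  let ?c = "\<lambda>n. 2^(2*N+1) / h * (1/2)^(n*(N+1)) :: real"
  have lower: "h / 2 \<le> norm (w - z)"
    using norm_triangle_ineq2[of w z] w by (simp add: h_def field_simps)
  have ex: "\<exists>n. norm (w - z) \<le> 2^n * h"
  proof -
    obtain n where "norm (w - z) / h < 2^n" using real_arch_pow[of 2] by auto
    then show ?thesis using h by (intro exI[of _ n]) (simp add: field_simps)
  qed
  define n where "n = (LEAST n. norm (w - z) \<le> 2^n * h)"
  have n: "norm (w - z) \<le> 2^n * h" unfolding n_def by (rule LeastI_ex[OF ex])
  have lower': "2^n * (h / 2) \<le> norm (w - z)"
  proof (cases n)
    case (Suc m)
    have "\<not> norm (w - z) \<le> 2^m * h" using not_less_Least[of m "\<lambda>n. norm (w - z) \<le> 2^n * h"] Suc n_def by simp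
    then show ?thesis using Suc by simp
  qed (use lower in simp)
  have "w \<in> disc \<inter> cball (cis (Arg z)) (2^(n+1) * h)"
  proof -
    have "norm (w - cis (Arg z)) \<le> 2^n * h + h"
      using n norm_diff_cis_Arg[of z] z by (intro norm_diff_triangle_le[of w z]) (auto simp: h_def)
    also have "\<dots> \<le> 2^n * h + 2^n * h" using h by simp
    also have "\<dots> = 2^(n+1) * h" by simp
    finally show ?thesis using w by (simp add: dist_norm norm_minus_commute)
  qed
  then have wT: "w \<in> tent z (2^(n+1) * h)"
    using disc_Int_cball_subset_tent[of "2^(n+1) * h" z] h by auto
  have "(2 * h)^N / norm (w - z)^(N+1) \<le> (2 * h)^N / (2^n * (h / 2))^(N+1)"
    using h lower' by (intro divide_left_mono power_mono) (auto intro!: mult_pos_pos zero_less_power less_le_trans[OF _ lower'])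
  also have "\<dots> = ?c n"
  proof -
    define q where "q = ((2::real)^n)^(N+1)"
    have q: "0 < q" "(1/2)^(n*(N+1)) = 1 / q"
      unfolding q_def by (simp, simp only: power_mult power_one_over)
    have "(2 * h)^N / (2^n * (h / 2))^(N+1) = (2 * h)^N / (q * (h / 2)^(N+1))"
      by (simp only: q_def power_mult_distrib)
    also have "\<dots> = 2^(2*N+1) / h * (1 / q)"
    proof -
      have "(P * H) / (q * (H * h / (P * 2))) = (P * P * 2) / h * (1 / q)" if "0 < P" "0 < H" for P H :: real
        using that h q(1) by (simp add: field_simps)
      moreover have "(2 * h)^N = 2^N * h^N" by (rule power_mult_distrib)
      moreover have "(h / 2)^(N+1) = h^N * h / (2^N * 2)" by (simp add: power_divide mult.commute)
      moreover have "(2::real)^(2*N+1) = 2^N * 2^N * 2" by (simp only: mult_2 power_add power_one_right)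
      ultimately show ?thesis using h by (simp only: zero_less_power zero_less_numeral)
    qed
    also have "\<dots> = ?c n" by (simp only: q(2))
    finally show ?thesis .
  qed
  finally have "ennreal ((2 * h)^N / norm (w - z)^(N+1)) \<le> ennreal (?c n) * indicator (tent z (2^(n+1) * h)) w"
    using wT by (simp add: ennreal_leI)
  also have "\<dots> = (\<Sum>m\<in>{n}. ennreal (?c m) * indicator (tent z (2^(m+1) * h)) w)"
    by (subst sum.insert) (simp_all only: finite.emptyI empty_iff not_False_eq_True sum.empty add_0_right)
  also have "\<dots> \<le> (\<Sum>m. ennreal (?c m) * indicator (tent z (2^(m+1) * h)) w)"
    by (rule sum_le_suminf) auto
  finally show ?thesis by (simp only: h_def)
qed

lemma holomorphic_measurable_disc:
  assumes "f holomorphic_on disc" shows "f \<in> borel_measurable (restrict_space borel disc)"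
  using holomorphic_on_imp_continuous_on[OF assms] by (rule borel_measurable_continuous_on_restrict)

lemma holomorphic_powr_measurable:
  assumes "f holomorphic_on disc"
  shows "(\<lambda>z. norm (f z) powr b) \<in> borel_measurable (restrict_space borel disc)"
proof -
  have [measurable]: "f \<in> borel_measurable (restrict_space borel disc)"
    by (rule holomorphic_measurable_disc[OF assms])
  show ?thesis by measurable
qed

lemma measurable_lebesgue_on_disc_of_borel:
  "f \<in> borel_measurable (restrict_space borel disc) \<Longrightarrow> f \<in> borel_measurable (lebesgue_on disc)"
proof -
  assume f: "f \<in> borel_measurable (restrict_space borel disc)"
  have "(\<lambda>z. z) \<in> lebesgue_on disc \<rightarrow>\<^sub>M restrict_space borel disc"
    by (rule measurable_restrict_space2) auto
  from measurable_compose[OF this f] show ?thesis .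
qed

text \<open>The circle estimate is integrated against \<open>\<nu>\<close> over the annulus between the radius halfway from \<open>|z|\<close>
  to the boundary and the boundary. Up to constants, and with \<open>h = 1 - |z|\<close>, the \<open>n\<close>-th dyadic term is
  \<open>2^(-n(N+1)) / h\<close> times \<open>m \<nu>(T)\<close> for a tent \<open>T\<close> of mass at most \<open>h (2 c)^n\<close> times the tail at \<open>|z|\<close>.
  The sum is finite once \<open>2^N > 2 c\<close>, and the tail at \<open>|z|\<close> cancels against the mass of the annulus.\<close>

lemma radial_pointwise_estimate:
  assumes \<nu>: "\<nu> \<in> D_hat" and b: "0 < b"
  obtains C where "0 < C"
    "\<And>f z m. f holomorphic_on disc \<Longrightarrow> z \<in> disc \<Longrightarrow> 0 < m \<Longrightarrow>
      (\<And>a. a \<in> disc \<Longrightarrow> z \<in> carleson_square a \<Longrightarrow>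
        square_integral \<nu> (\<lambda>w. norm (f w) powr b) a \<le> ennreal (m * mass \<nu> (carleson_square a))) \<Longrightarrow>
      norm (f z) powr b \<le> C * m"
proof -
  have rv: "radial_weight \<nu>" and wv: "weight \<nu>" using \<nu> unfolding D_hat_def radial_weight_def by blast+
  interpret V: finite_measure "weighted \<nu>" by (rule finite_measure_weighted[OF wv])
  obtain c where c: "1 \<le> c" "\<And>r k. 0 \<le> r \<Longrightarrow> r < 1 \<Longrightarrow> tail_mass \<nu> r \<le> c^k * tail_mass \<nu> (1 - (1 - r) / 2^k)"
    using tail_mass_halving[OF \<nu>] by blast
  obtain N where N: "2 * c < 2^N" using real_arch_pow[of 2 "2 * c"] by auto
  \<comment> \<open>\<open>2^(2N+1)\<close> is the coefficient in the dyadic sum, \<open>8 c^3\<close> that in the mass of the first tent; the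
    factor 2 in \<open>C\<close> is the sum of the geometric series, and \<open>c\<close> compares the tails at \<open>|z|\<close> and \<open>\<rho>\<close>.\<close>
  define A where "A = 2^(2*N+1) * 8 * c^3"
  define C where "C = 2 * A * c"
  show ?thesis
  proof (rule that[of C])
    show "0 < C" using c by (simp add: C_def A_def)
    fix f z m assume f: "f holomorphic_on disc" and z: "z \<in> disc" and m: "0 < m"
      and avg: "\<And>a. a \<in> disc \<Longrightarrow> z \<in> carleson_square a \<Longrightarrow>
        square_integral \<nu> (\<lambda>w. norm (f w) powr b) a \<le> ennreal (m * mass \<nu> (carleson_square a))"
    define h where "h = 1 - norm z"
    have h: "0 < h" "h \<le> 1" using z by (auto simp: h_def)
    define \<rho> where "\<rho> = 1 - h / 2"
    have \<rho>: "norm z < \<rho>" "0 \<le> \<rho>" "\<rho> < 1" using h by (auto simp: \<rho>_def h_def field_simps)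
    define R where "R = {w \<in> disc. \<rho> \<le> norm w}"
    have R[measurable]: "R \<in> sets borel" "R \<in> sets (lebesgue_on disc)"
    proof -
      have "R = ball 0 1 \<inter> {w. \<rho> \<le> norm w}" by (auto simp: R_def)
      moreover have "closed {w::complex. \<rho> \<le> norm w}" by (intro closed_Collect_le continuous_intros)
      ultimately show "R \<in> sets borel" by auto
      show "R \<in> sets (lebesgue_on disc)" unfolding R_def by (rule annulus_measurable)
    qed
    define u where "u w = ennreal (norm (f w) powr b)" for w
    define k where "k w = ennreal ((2 * h)^N / norm (w - z)^(N+1))" for w
    have um: "u \<in> borel_measurable (restrict_space borel disc)"
      unfolding u_def using holomorphic_powr_measurable[OF f, of b] by (auto intro: measurable_compose[OF _ measurable_ennreal])
    then have [measurable]: "u \<in> borel_measurable (lebesgue_on disc)" by (rule measurable_lebesgue_on_disc_of_borel)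
    have [measurable]: "k \<in> borel_measurable borel" unfolding k_def by measurable
    define G where "G w = u w * k w * indicator R w" for w
    have Gm: "G \<in> borel_measurable borel"
    proof -
      have "(\<lambda>w. u w * indicator disc w) \<in> borel_measurable borel"
        using um by (subst borel_measurable_restrict_space_iff_ennreal[symmetric]) auto
      then have "(\<lambda>w. (u w * indicator disc w) * k w * indicator R w) \<in> borel_measurable borel" by measurable
      also have "(\<lambda>w. (u w * indicator disc w) * k w * indicator R w) = G"
        by (auto simp: G_def R_def split: split_indicator)
      finally show ?thesis .
    qed
    have circ: "u z * indicator R \<zeta> \<le> (\<integral>\<^sup>+t\<in>{0..1}. G (\<zeta> * cis (2*pi*t)) \<partial>lborel)" for \<zeta>
    proof (cases "\<zeta> \<in> R")
      case True
      then have \<zeta>: "norm z < norm \<zeta>" "norm \<zeta> < 1" using \<rho> by (auto simp: R_def)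
      have rot: "\<zeta> * cis (2*pi*t) \<in> R" for t using True by (simp add: R_def norm_mult)
      have "u z \<le> (\<integral>\<^sup>+t\<in>{0..1}. ennreal (norm (f (\<zeta> * cis (2*pi*t))) powr b *
           ((2 * (1 - norm z))^N / norm (\<zeta> * cis (2*pi*t) - z)^(N+1))) \<partial>lborel)"
        unfolding u_def by (rule powr_norm_le_circle_average[OF f \<zeta> b])
      also have "\<dots> = (\<integral>\<^sup>+t\<in>{0..1}. G (\<zeta> * cis (2*pi*t)) \<partial>lborel)"
      proof (rule nn_integral_cong)
        fix t :: real
        have "ennreal (x * y) = ennreal x * ennreal y" if "0 \<le> x" "0 \<le> y" for x y :: real
          using that by (rule ennreal_mult)
        moreover have "0 \<le> (2 * h)^N / norm (\<zeta> * cis (2*pi*t) - z)^(N+1)" using h by simp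
        ultimately show "ennreal (norm (f (\<zeta> * cis (2*pi*t))) powr b *
           ((2 * (1 - norm z))^N / norm (\<zeta> * cis (2*pi*t) - z)^(N+1))) * indicator {0..1} t
           = G (\<zeta> * cis (2*pi*t)) * indicator {0..1} t"
          unfolding G_def u_def k_def using rot[of t] by (simp only: h_def powr_ge_zero indicator_simps mult_1_right)
      qed
      finally show ?thesis using True by simp
    qed simp
    let ?c = "\<lambda>n. 2^(2*N+1) / h * (1/2)^(n*(N+1)) :: real"
    let ?T = "\<lambda>n. tent z (2^(n+1) * h)"
    have d: "0 < 2^(n+1) * h" for n using h by simp
    have [measurable]: "?T n \<in> sets (lebesgue_on disc)" for n by (rule tent_measurable[OF d])
    have Tint: "(\<integral>\<^sup>+w\<in>?T n. u w \<partial>weighted \<nu>) \<le> ennreal (m * mass \<nu> (?T n))" for n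
    proof -
      obtain a where a: "a \<in> disc" "?T n = carleson_square a" using tent_eq_carleson_square[OF d] by metis
      have "z \<in> disc \<inter> cball (cis (Arg z)) (2^(n+1) * h)"
      proof -
        have "(1::real) \<le> 2^(n+1)" by (rule one_le_power) simp
        then have "1 * h \<le> 2^(n+1) * h" using h by (intro mult_right_mono) auto
        then show ?thesis using norm_diff_cis_Arg[of z] z by (simp add: dist_norm norm_minus_commute h_def)
      qed
      then have "z \<in> carleson_square a" using disc_Int_cball_subset_tent[OF d] a(2) by blast
      then show ?thesis unfolding a(2) u_def by (rule avg[OF a(1)])
    qed
    have Tmass: "mass \<nu> (?T n) \<le> 8 * c^3 * h * tail_mass \<nu> (norm z) * (2 * c)^n" for n
    proof -
      have "2^(n+1+2) * c^(n+1+2) * h * x = 8 * c^3 * h * x * (2 * c)^n" for x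
        by (simp add: power_add power_mult_distrib eval_nat_numeral)
      then show ?thesis using radial_tent_mass[OF rv c z, of "n+1", folded h_def] by (simp only:)
    qed
    define \<tau> where "\<tau> = tail_mass \<nu> (norm z)"
    have \<tau>0: "0 \<le> \<tau>" by (simp add: \<tau>_def tail_mass_def)
    have dyad: "ennreal (?c n) * (\<integral>\<^sup>+w\<in>?T n. u w \<partial>weighted \<nu>) \<le> ennreal (A * m * \<tau> * (1/2)^n)" for n
    proof -
      have "ennreal (?c n) * (\<integral>\<^sup>+w\<in>?T n. u w \<partial>weighted \<nu>) \<le> ennreal (?c n) * ennreal (m * (8 * c^3 * h * \<tau> * (2 * c)^n))"
        using Tint[of n] Tmass[of n] m unfolding \<tau>_def
        by (intro mult_left_mono order_trans[OF Tint[of n]] ennreal_leI) auto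
      also have "\<dots> = ennreal (?c n * (m * (8 * c^3 * h * \<tau> * (2 * c)^n)))"
        using h m c(1) \<tau>0 by (intro ennreal_mult[symmetric]) auto
      also have "\<dots> \<le> ennreal (A * m * \<tau> * (1/2)^n)"
      proof (rule ennreal_leI)
        have "(1/2)^(n*(N+1)) * (2 * c)^n = ((1/2)^N * c)^n"
        proof -
          have "((1/2::real)^(N+1))^n * (2 * c)^n = ((1/2)^(N+1) * (2 * c))^n" by (rule power_mult_distrib[symmetric])
          moreover have "(1/2::real)^(n*(N+1)) = ((1/2)^(N+1))^n" by (metis power_mult mult.commute)
          moreover have "(1/2)^(N+1) * (2 * c) = (1/2)^N * c" by simp
          ultimately show ?thesis by (simp only:)
        qed
        also have "\<dots> \<le> (1/2)^n"
          using N c(1) by (intro power_mono) (auto simp: power_divide field_simps)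
        finally have le: "(1/2)^(n*(N+1)) * (2 * c)^n \<le> (1/2)^n" .
        have "?c n * (m * (8 * c^3 * h * \<tau> * (2 * c)^n)) = A * m * \<tau> * ((1/2)^(n*(N+1)) * (2 * c)^n)"
          using h by (simp add: A_def)
        also have "\<dots> \<le> A * m * \<tau> * (1/2)^n" using le m c(1) \<tau>0 by (intro mult_left_mono) (auto simp: A_def)
        finally show "?c n * (m * (8 * c^3 * h * \<tau> * (2 * c)^n)) \<le> A * m * \<tau> * (1/2)^n" .
      qed
      finally show ?thesis .
    qed
    have "u z * ennreal (tail_mass \<nu> \<rho>) = (\<integral>\<^sup>+\<zeta>. u z * indicator R \<zeta> \<partial>weighted \<nu>)"
    proof (subst nn_integral_cmult_indicator)
      show "R \<in> sets (weighted \<nu>)" using R(2) by simp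
      show "u z * ennreal (tail_mass \<nu> \<rho>) = u z * emeasure (weighted \<nu>) R"
        by (simp only: tail_mass_def R_def V.emeasure_eq_measure)
    qed
    also have "\<dots> \<le> (\<integral>\<^sup>+\<zeta>. (\<integral>\<^sup>+t\<in>{0..1}. G (\<zeta> * cis (2*pi*t)) \<partial>lborel) \<partial>weighted \<nu>)"
      by (intro nn_integral_mono circ)
    also have "\<dots> = (\<integral>\<^sup>+w. G w \<partial>weighted \<nu>)"
      by (rule nn_integral_weighted_average[OF rv Gm, symmetric])
    also have "\<dots> \<le> (\<integral>\<^sup>+w. (\<Sum>n. ennreal (?c n) * (u w * indicator (?T n) w)) \<partial>weighted \<nu>)"
    proof (rule nn_integral_mono)
      fix w assume w: "w \<in> space (weighted \<nu>)"
      show "G w \<le> (\<Sum>n. ennreal (?c n) * (u w * indicator (?T n) w))"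
      proof (cases "w \<in> R")
        case True
        then have "k w \<le> (\<Sum>n. ennreal (?c n) * indicator (?T n) w)"
          using kernel_le_dyadic_sum[OF z, of w N] unfolding k_def h_def R_def \<rho>_def by auto
        then have "u w * k w \<le> u w * (\<Sum>n. ennreal (?c n) * indicator (?T n) w)"
          by (rule mult_left_mono) simp
        also have "\<dots> = (\<Sum>n. u w * (ennreal (?c n) * indicator (?T n) w))"
          by (rule ennreal_suminf_cmult[symmetric])
        also have "\<dots> = (\<Sum>n. ennreal (?c n) * (u w * indicator (?T n) w))"
          by (intro suminf_cong mult.left_commute)
        finally have "u w * k w \<le> (\<Sum>n. ennreal (?c n) * (u w * indicator (?T n) w))" .
        moreover have "G w = u w * k w" using True by (simp only: G_def indicator_simps mult_1_right)
        ultimately show ?thesis by (simp only:)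
      qed (simp add: G_def)
    qed
    also have "\<dots> = (\<Sum>n. (\<integral>\<^sup>+w. ennreal (?c n) * (u w * indicator (?T n) w) \<partial>weighted \<nu>))"
      by (rule nn_integral_suminf) measurable
    also have "\<dots> = (\<Sum>n. ennreal (?c n) * (\<integral>\<^sup>+w\<in>?T n. u w \<partial>weighted \<nu>))"
      by (intro suminf_cong nn_integral_cmult) measurable
    also have "\<dots> \<le> (\<Sum>n. ennreal (A * m * \<tau> * (1/2)^n))"
      by (intro suminf_le dyad) auto
    also have "\<dots> = ennreal (\<Sum>n. A * m * \<tau> * (1/2)^n)"
      using m c(1) \<tau>0 by (intro suminf_ennreal2 summable_mult summable_geometric) (auto simp: A_def)
    also have "(\<Sum>n. A * m * \<tau> * (1/2)^n) = 2 * A * m * \<tau>"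
      by (subst suminf_mult) (auto simp: suminf_geometric summable_geometric)
    finally have "u z * ennreal (tail_mass \<nu> \<rho>) \<le> ennreal (2 * A * m * \<tau>)" .
    also have "\<dots> \<le> ennreal (2 * A * m * (c * tail_mass \<nu> \<rho>))"
    proof (intro ennreal_leI mult_left_mono)
      show "\<tau> \<le> c * tail_mass \<nu> \<rho>" using c(2)[of "norm z" 1] z by (simp add: \<tau>_def \<rho>_def h_def)
      show "0 \<le> 2 * A * m" using m c(1) by (simp add: A_def)
    qed
    finally have "norm (f z) powr b * tail_mass \<nu> \<rho> \<le> C * m * tail_mass \<nu> \<rho>"
      unfolding u_def C_def using m c(1)
      by (subst (asm) ennreal_mult[symmetric], simp, simp add: tail_mass_def, subst (asm) ennreal_le_iff)
         (auto simp: tail_mass_def A_def mult_ac)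
    then show "norm (f z) powr b \<le> C * m"
      using tail_mass_pos[OF rv \<rho>(2,3)] by simp
  qed
qed

text \<open>The radial estimate is applied to the exponent \<open>\<gamma> / s\<close>, because transfer bounds the \<open>\<nu>\<close>-mean of
  \<open>|f|^(\<gamma>/s)\<close> by the \<open>s\<close>-th root of the \<open>\<omega>\<close>-mean of \<open>|f|^\<gamma>\<close>.\<close>

lemma B_infty_pointwise_estimate:
  assumes \<nu>: "\<nu> \<in> D_hat" and \<omega>: "\<omega> \<in> B_infty \<nu>" and g: "0 < \<gamma>"
  obtains C where "0 < C"
    "\<And>f z. f holomorphic_on disc \<Longrightarrow> z \<in> disc \<Longrightarrow>
      ennreal (norm (f z) powr \<gamma>) \<le> ennreal C * hormander_maximal \<omega> (\<lambda>w. norm (f w) powr \<gamma>) z"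
proof -
  have rv: "radial_weight \<nu>" and wv: "weight \<nu>" using \<nu> unfolding D_hat_def radial_weight_def by blast+
  obtain s where s: "1 < s" and w: "weight \<omega>" and B: "quotient_in_B s \<nu> \<omega>" using \<omega> by (auto simp: B_infty_def)
  interpret W: finite_measure "weighted \<omega>" by (rule finite_measure_weighted[OF w])
  interpret V: finite_measure "weighted \<nu>" by (rule finite_measure_weighted[OF wv])
  obtain C where C: "0 < C"
    "\<And>a u X. a \<in> disc \<Longrightarrow> u \<in> borel_measurable (lebesgue_on disc) \<Longrightarrow> (\<And>z. 0 \<le> u z) \<Longrightarrow> 0 < X \<Longrightarrow>
      square_integral \<omega> (\<lambda>z. u z powr s) a \<le> ennreal X \<Longrightarrow>
      square_integral \<nu> u a \<le>
        ennreal (C * mass \<nu> (carleson_square a) * (X / mass \<omega> (carleson_square a)) powr (1/s))"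
    using quotient_in_B_transfer[OF w wv s B] by blast
  have b: "0 < \<gamma> / s" using g s by simp
  obtain D where D: "0 < D"
    "\<And>f z m. f holomorphic_on disc \<Longrightarrow> z \<in> disc \<Longrightarrow> 0 < m \<Longrightarrow>
      (\<And>a. a \<in> disc \<Longrightarrow> z \<in> carleson_square a \<Longrightarrow>
        square_integral \<nu> (\<lambda>w. norm (f w) powr (\<gamma>/s)) a \<le> ennreal (m * mass \<nu> (carleson_square a))) \<Longrightarrow>
      norm (f z) powr (\<gamma>/s) \<le> D * m"
    using radial_pointwise_estimate[OF \<nu> b] by blast
  define K where "K = (D * C) powr s"
  show ?thesis
  proof (rule that[of K])
    show "0 < K" using C D by (simp add: K_def)
    fix f z assume f: "f holomorphic_on disc" and z: "z \<in> disc"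
    define M where "M = hormander_maximal \<omega> (\<lambda>w. norm (f w) powr \<gamma>) z"
    have key: "norm (f z) powr \<gamma> \<le> K * m" if m: "0 < m" "M \<le> ennreal m" for m
    proof -
      have "norm (f z) powr (\<gamma>/s) \<le> D * (C * m powr (1/s))"
      proof (rule D(2)[OF f z])
        show "0 < C * m powr (1/s)" using C m by simp
        fix a assume a: "a \<in> disc" "z \<in> carleson_square a"
        define S where "S = carleson_square a"
        define wS where "wS = mass \<omega> S"
        have wS: "0 < wS" unfolding wS_def S_def by (rule weight_square_pos[OF w a(1)])
        have "(\<integral>\<^sup>+\<zeta>\<in>S. ennreal (norm (norm (f \<zeta>) powr \<gamma>)) \<partial>weighted \<omega>) / emeasure (weighted \<omega>) S \<le> M"
          unfolding M_def hormander_maximal_def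
          by (rule SUP_upper2[of S]) (use a in \<open>auto simp: carleson_squares_def S_def\<close>)
        also note m(2)
        finally have "(\<integral>\<^sup>+\<zeta>\<in>S. ennreal (norm (f \<zeta>) powr \<gamma>) \<partial>weighted \<omega>) / ennreal wS \<le> ennreal m"
          by (simp add: wS_def W.emeasure_eq_measure)
        then have "(\<integral>\<^sup>+\<zeta>\<in>S. ennreal (norm (f \<zeta>) powr \<gamma>) \<partial>weighted \<omega>) \<le> ennreal m * ennreal wS"
          using wS by (simp only: ennreal_divide_le_iff)
        then have X: "square_integral \<omega> (\<lambda>\<zeta>. (norm (f \<zeta>) powr (\<gamma>/s)) powr s) a \<le> ennreal (m * wS)"
          using s m wS by (simp add: powr_powr ennreal_mult S_def)
        have "square_integral \<nu> (\<lambda>\<zeta>. norm (f \<zeta>) powr (\<gamma>/s)) a \<le>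
          ennreal (C * mass \<nu> (carleson_square a) * (m * wS / mass \<omega> (carleson_square a)) powr (1/s))"
          by (rule C(2)[OF a(1) _ _ _ X])
             (use m wS b in \<open>auto intro!: measurable_lebesgue_on_disc_of_borel holomorphic_powr_measurable[OF f]\<close>)
        also have "C * mass \<nu> (carleson_square a) * (m * wS / mass \<omega> (carleson_square a)) powr (1/s)
           = C * m powr (1/s) * mass \<nu> (carleson_square a)"
          using wS by (simp add: wS_def S_def)
        finally show "square_integral \<nu> (\<lambda>\<zeta>. norm (f \<zeta>) powr (\<gamma>/s)) a
           \<le> ennreal (C * m powr (1/s) * mass \<nu> (carleson_square a))" .
      qed
      then have "(norm (f z) powr (\<gamma>/s)) powr s \<le> ((D * C) * m powr (1/s)) powr s"
        using s by (intro powr_mono2) (auto simp: mult.assoc)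
      also have "\<dots> = K * m"
        using s m C D by (subst powr_mult) (auto simp: K_def powr_powr)
      finally show ?thesis using s by (simp add: powr_powr)
    qed
    show "ennreal (norm (f z) powr \<gamma>) \<le> ennreal K * hormander_maximal \<omega> (\<lambda>w. norm (f w) powr \<gamma>) z"
      unfolding M_def[symmetric]
    proof (cases M)
      case (real x)
      have "norm (f z) powr \<gamma> \<le> K * x"
      proof (rule field_le_epsilon)
        fix e :: real assume e: "0 < e"
        have "norm (f z) powr \<gamma> \<le> K * (x + e / K)"
          using real e \<open>0 < K\<close> by (intro key) (auto intro!: ennreal_leI add_nonneg_pos)
        then show "norm (f z) powr \<gamma> \<le> K * x + e" using \<open>0 < K\<close> by (simp add: distrib_left)
      qed
      then show "ennreal (norm (f z) powr \<gamma>) \<le> ennreal K * M"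
        using real \<open>0 < K\<close> by (simp add: ennreal_mult[symmetric] ennreal_leI)
    next
      case top
      then show "ennreal (norm (f z) powr \<gamma>) \<le> ennreal K * M"
        using \<open>0 < K\<close> by (simp add: ennreal_mult_top)
    qed
  qed
qed

section \<open>Semicontinuity of the maximal function\<close>

lemma disc_borel_measure_sets:
  assumes "\<mu> \<in> disc_borel_measures"
  shows "sets \<mu> = sets (restrict_space borel disc)" "space \<mu> = disc"
proof -
  show 1: "sets \<mu> = sets (restrict_space borel disc)" using assms by (simp add: disc_borel_measures_def)
  show "space \<mu> = disc" using sets_eq_imp_space_eq[OF 1] by (simp add: space_restrict_space)
qed

lemma carleson_square_sets_disc:
  assumes "a \<in> disc" shows "carleson_square a \<in> sets (restrict_space borel disc)"
  using borel_carleson_square[OF assms] carleson_square_subset_disc[of a]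
  by (subst sets_restrict_space_iff) auto

abbreviation square_mean :: "(complex \<Rightarrow> real) \<Rightarrow> (complex \<Rightarrow> real) \<Rightarrow> complex \<Rightarrow> ennreal" where
  "square_mean \<omega> F a \<equiv> square_integral \<omega> (\<lambda>\<zeta>. norm (F \<zeta>)) a / emeasure (weighted \<omega>) (carleson_square a)"

lemma carleson_square_subset_scale:
  assumes "a \<in> disc" "a \<noteq> 0" "0 < t" "t < 1"
  shows "carleson_square a \<subseteq> carleson_square (of_real t * a)"
  using carleson_square_scale_interior[OF assms] by (metis order_trans)

lemma less_hormander_maximal_iff:
  "t < hormander_maximal \<omega> F z \<longleftrightarrow> (\<exists>a\<in>disc. z \<in> carleson_square a \<and> t < square_mean \<omega> F a)"
  unfolding hormander_maximal_def carleson_squares_def by (auto simp: less_SUP_iff)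

text \<open>A union of uncountably many relatively closed squares need not be Borel. But if the mean over
  \<open>S(a)\<close> exceeds \<open>t\<close>, so does the mean over some slightly larger square with \<open>S(a)\<close> in its interior:
  the numerator can only grow, and the denominator converges by continuity from above.\<close>

lemma open_hormander_maximal_greater:
  fixes F :: "complex \<Rightarrow> real"
  assumes w: "weight \<omega>"
  shows "open {z \<in> disc. t < hormander_maximal \<omega> F z}"
proof (rule openI)
  interpret W: finite_measure "weighted \<omega>" by (rule finite_measure_weighted[OF w])
  fix z assume "z \<in> {z \<in> disc. t < hormander_maximal \<omega> F z}"
  then obtain a where z: "z \<in> disc" and a: "a \<in> disc" "z \<in> carleson_square a" and t: "t < square_mean \<omega> F a"
    by (auto simp: less_hormander_maximal_iff)
  have "\<exists>U b. b \<in> disc \<and> open U \<and> z \<in> U \<and> U \<subseteq> carleson_square b \<and> t < square_mean \<omega> F b"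
  proof (cases "a = 0")
    case True
    then show ?thesis using t z by (intro exI[of _ disc] exI[of _ 0]) simp
  next
    case False
    define r where "r n = 1 - 1 / (real n + 2)" for n
    have r: "0 < r n" "r n < 1" for n by (auto simp: r_def field_simps)
    define b where "b n = of_real (r n) * a" for n
    have nb: "norm (b n) = r n * norm a" for n unfolding b_def norm_mult norm_of_real using r(1)[of n] by simp
    have b: "b n \<in> disc" for n
    proof -
      have "r n * norm a \<le> 1 * norm a" using r(2)[of n] by (intro mult_right_mono) auto
      then show ?thesis using a(1) nb[of n] by simp
    qed
    have sub: "carleson_square a \<subseteq> carleson_square (b n)" for n
      unfolding b_def by (rule carleson_square_subset_scale[OF a(1) False r])
    have anti: "carleson_square (b m) \<subseteq> carleson_square (b n)" if "n \<le> m" for n m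
    proof (cases "n = m")
      case f: False
      then have nm: "r n < r m" using that by (auto simp: r_def field_simps)
      have b0: "b m \<noteq> 0" using False r(1)[of m] by (simp add: b_def)
      have "b n = of_real (r n / r m) * b m" using r(1)[of m] by (simp add: b_def)
      moreover have "0 < r n / r m" "r n / r m < 1" using nm r(1)[of n] r(1)[of m] by auto
      ultimately show ?thesis using carleson_square_subset_scale[OF b[of m] b0, of "r n / r m"] by (simp only:)
    qed simp
    let ?m = "\<lambda>a. mass \<omega> (carleson_square a)"
    have lim: "(\<lambda>n. ?m (b n)) \<longlonglongrightarrow> ?m a"
    proof -
      have "(\<lambda>n. ?m (b n)) \<longlonglongrightarrow> mass \<omega> (\<Inter>n. carleson_square (b n))"
        by (rule W.finite_Lim_measure_decseq)
           (use carleson_square_measurable[OF b] anti in \<open>auto simp: decseq_def\<close>)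
      also have "(\<Inter>n. carleson_square (b n)) = carleson_square a"
        unfolding b_def r_def by (rule INT_carleson_square_scale[OF a(1) False])
      finally show ?thesis .
    qed
    define J where "J = square_integral \<omega> (\<lambda>\<zeta>. norm (F \<zeta>)) a"
    obtain x where x: "t = ennreal x" "0 \<le> x" using t by (cases t) auto
    have "\<not> J / ennreal (?m a) \<le> ennreal x" using t x unfolding J_def by (simp add: W.emeasure_eq_measure)
    then have "ennreal x * ennreal (?m a) < J"
      using weight_square_pos[OF w a(1)] by (simp only: ennreal_divide_le_iff not_le)
    then have "ennreal (x * ?m a) < J" using x by (simp add: ennreal_mult)
    moreover have "(\<lambda>n. ennreal (x * ?m (b n))) \<longlonglongrightarrow> ennreal (x * ?m a)"
      by (intro tendsto_ennrealI tendsto_mult_left lim)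
    ultimately have "\<forall>\<^sub>F n in sequentially. ennreal (x * ?m (b n)) < J" by (rule order_tendstoD(2)[rotated])
    then obtain n where n: "ennreal (x * ?m (b n)) < J" by (auto simp: eventually_sequentially)
    also have "J \<le> square_integral \<omega> (\<lambda>\<zeta>. norm (F \<zeta>)) (b n)"
      unfolding J_def using sub[of n] by (intro nn_integral_mono) (auto split: split_indicator)
    finally have "\<not> square_integral \<omega> (\<lambda>\<zeta>. norm (F \<zeta>)) (b n) \<le> ennreal x * ennreal (?m (b n))"
      using x by (simp add: ennreal_mult)
    then have "\<not> square_mean \<omega> F (b n) \<le> t"
      using weight_square_pos[OF w b[of n]] unfolding W.emeasure_eq_measure by (simp only: ennreal_divide_le_iff x(1) not_False_eq_True)
    moreover obtain U where "open U" "carleson_square a \<subseteq> U" "U \<subseteq> carleson_square (b n)"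
      unfolding b_def using carleson_square_scale_interior[OF a(1) False r] by blast
    ultimately show ?thesis using a b[of n] by (intro exI[of _ U] exI[of _ "b n"]) auto
  qed
  then obtain U b where U: "b \<in> disc" "open U" "z \<in> U" "U \<subseteq> carleson_square b" "t < square_mean \<omega> F b" by blast
  then have sub: "U \<subseteq> {z \<in> disc. t < hormander_maximal \<omega> F z}"
    using carleson_square_subset_disc[of b] by (auto simp: less_hormander_maximal_iff)
  obtain e where "0 < e" "ball z e \<subseteq> U" using U openE by blast
  then show "\<exists>e>0. ball z e \<subseteq> {z \<in> disc. t < hormander_maximal \<omega> F z}" using sub by blast
qed

lemma hormander_maximal_measurable:
  fixes F :: "complex \<Rightarrow> real"
  assumes w: "weight \<omega>"
  shows "hormander_maximal \<omega> F \<in> borel_measurable (restrict_space borel disc)"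
proof (rule borel_measurableI_greater)
  fix t
  have "{z \<in> space (restrict_space borel disc). t < hormander_maximal \<omega> F z} = {z \<in> disc. t < hormander_maximal \<omega> F z}"
    by (auto simp: space_restrict_space)
  then show "{z \<in> space (restrict_space borel disc). t < hormander_maximal \<omega> F z} \<in> sets (restrict_space borel disc)"
    using open_hormander_maximal_greater[OF w, of t F] by (subst sets_restrict_space_iff) auto
qed

section \<open>Weak and strong type bounds for the maximal function\<close>

text \<open>The squares with mean above \<open>t\<close> are contained in balls, from which the covering lemma of Vitali
  selects countably many disjoint ones whose fivefold enlargements cover the level set; within the
  disc these lie in tents of comparable \<open>\<omega>\<close>-mass. The exponent \<open>e \<ge> 1\<close> is absorbed by bounding \<open>e - 1\<close> of
  the factors \<open>\<omega>(S)\<close> by \<open>I / t\<close>, which also bounds their sum.\<close>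

lemma hormander_maximal_weak_type:
  fixes F :: "complex \<Rightarrow> real"
  assumes w: "weight \<omega>"
    and K: "1 \<le> K" "\<And>a. a \<in> disc \<Longrightarrow> mass \<omega> (tent a (16 * (1 - norm a))) \<le> K * mass \<omega> (carleson_square a)"
    and \<mu>: "\<mu> \<in> disc_borel_measures"
    and \<kappa>: "0 \<le> \<kappa>" "\<And>a. a \<in> disc \<Longrightarrow> emeasure \<mu> (carleson_square a) \<le> ennreal (\<kappa> * mass \<omega> (carleson_square a) powr e)"
    and e: "1 \<le> e" and t: "0 < t" and F[measurable]: "F \<in> borel_measurable (lebesgue_on disc)"
    and I: "(\<integral>\<^sup>+z. ennreal (norm (F z)) \<partial>weighted \<omega>) \<le> ennreal I" "0 \<le> I"
  shows "emeasure \<mu> {z \<in> disc. ennreal t < hormander_maximal \<omega> F z} \<le> ennreal (\<kappa> * K powr e * (I / t) powr e)"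
proof -
  interpret W: finite_measure "weighted \<omega>" by (rule finite_measure_weighted[OF w])
  note \<mu>s[measurable_cong] = disc_borel_measure_sets(1)[OF \<mu>]
  define E where "E = {z \<in> disc. ennreal t < hormander_maximal \<omega> F z}"
  define A where "A = {a \<in> disc. ennreal t < square_mean \<omega> F a}"
  have cov: "E \<subseteq> (\<Union>a\<in>A. cball (cis (Arg a)) (2 * (1 - norm a)))"
  proof
    fix z assume "z \<in> E"
    then obtain a where "a \<in> A" "z \<in> carleson_square a" by (auto simp: E_def A_def less_hormander_maximal_iff)
    moreover from this have "z \<in> cball (cis (Arg a)) (2 * (1 - norm a))"
      using carleson_square_subset_cball[of a] unfolding A_def by blast
    ultimately show "z \<in> (\<Union>a\<in>A. cball (cis (Arg a)) (2 * (1 - norm a)))" by blast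
  qed
  have "0 < 2 * (1 - norm a) \<and> 2 * (1 - norm a) \<le> 2" if "a \<in> A" for a using that by (auto simp: A_def)
  from Vitali_covering_lemma_cballs[OF cov this] obtain C where
    C: "countable C" "C \<subseteq> A"
     "pairwise (\<lambda>i j. disjnt (cball (cis (Arg i)) (2 * (1 - norm i))) (cball (cis (Arg j)) (2 * (1 - norm j)))) C"
     "E \<subseteq> (\<Union>a\<in>C. cball (cis (Arg a)) (5 * (2 * (1 - norm a))))" by blast
  have Cd: "a \<in> disc" if "a \<in> C" for a using C(2) that by (auto simp: A_def)
  \<comment> \<open>16 is the least power of 2 above 10, the fivefold of the radius factor 2.\<close>
  let ?S = carleson_square and ?T = "\<lambda>a. tent a (16 * (1 - norm a))"
  have d: "0 < 16 * (1 - norm a)" if "a \<in> C" for a using Cd[OF that] by simp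
  have ET: "E \<subseteq> (\<Union>a\<in>C. ?T a)"
  proof
    fix z assume z: "z \<in> E"
    then obtain a where a: "a \<in> C" "z \<in> cball (cis (Arg a)) (5 * (2 * (1 - norm a)))" using C(4) by blast
    moreover have "5 * (2 * (1 - norm a)) \<le> 16 * (1 - norm a)" using Cd[OF a(1)] by simp
    ultimately have "z \<in> disc \<inter> cball (cis (Arg a)) (16 * (1 - norm a))" using z by (auto simp: E_def)
    then show "z \<in> (\<Union>a\<in>C. ?T a)" using disc_Int_cball_subset_tent[OF d[OF a(1)]] a(1) by blast
  qed
  have Tm: "\<exists>b\<in>disc. ?T a = ?S b" if "a \<in> C" for a
    using tent_eq_carleson_square[OF d[OF that]] by metis
  have Tsets: "?T a \<in> sets \<mu>" if "a \<in> C" for a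
    using Tm[OF that] carleson_square_sets_disc unfolding \<mu>s by auto
  have disj: "disjoint_family_on ?S C"
    unfolding disjoint_family_on_def
  proof (intro ballI impI)
    fix a b assume ab: "a \<in> C" "b \<in> C" "a \<noteq> b"
    then have "disjnt (cball (cis (Arg a)) (2 * (1 - norm a))) (cball (cis (Arg b)) (2 * (1 - norm b)))"
      using C(3) by (auto simp: pairwise_def)
    then show "?S a \<inter> ?S b = {}"
      using carleson_square_subset_cball[OF Cd[OF ab(1)]] carleson_square_subset_cball[OF Cd[OF ab(2)]]
      unfolding disjnt_def by blast
  qed
  define D where "D = density (weighted \<omega>) (\<lambda>z. ennreal (norm (F z)))"
  have Dm: "emeasure D (?S a) = square_integral \<omega> (\<lambda>\<zeta>. norm (F \<zeta>)) a" if "a \<in> C" for a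
    unfolding D_def using carleson_square_measurable[OF Cd[OF that]] by (intro emeasure_density) auto
  define x where "x a = mass \<omega> (?S a)" for a
  have x: "0 < x a" if "a \<in> C" for a unfolding x_def by (rule weight_square_pos[OF w Cd[OF that]])
  have xD: "ennreal (x a) \<le> ennreal (1/t) * emeasure D (?S a)" if "a \<in> C" for a
  proof -
    have "\<not> emeasure D (?S a) / ennreal (x a) \<le> ennreal t"
      using C(2) that unfolding Dm[OF that] x_def A_def by (auto simp: W.emeasure_eq_measure not_le)
    then have "ennreal t * ennreal (x a) \<le> emeasure D (?S a)"
      using x[OF that] by (simp only: ennreal_divide_le_iff not_le less_imp_le)
    then have "ennreal (1/t) * (ennreal t * ennreal (x a)) \<le> ennreal (1/t) * emeasure D (?S a)"
      by (rule mult_left_mono) simp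
    moreover have "ennreal (1/t) * (ennreal t * ennreal (x a)) = ennreal (x a)"
      using t x[OF that] by (simp add: ennreal_mult[symmetric])
    ultimately show ?thesis by simp
  qed
  have Dtot: "(\<integral>\<^sup>+a. emeasure D (?S a) \<partial>count_space C) \<le> ennreal I"
  proof -
    have "(\<integral>\<^sup>+a. emeasure D (?S a) \<partial>count_space C) = emeasure D (\<Union>a\<in>C. ?S a)"
      using carleson_square_measurable[OF Cd] C(1) disj
      by (intro emeasure_UN_countable[symmetric]) (auto simp: D_def)
    also have "\<dots> \<le> emeasure D (space D)" by (rule emeasure_space)
    also have "\<dots> = (\<integral>\<^sup>+z. ennreal (norm (F z)) * indicator (space D) z \<partial>weighted \<omega>)"
      unfolding D_def by (subst emeasure_density) auto
    also have "\<dots> = (\<integral>\<^sup>+z. ennreal (norm (F z)) \<partial>weighted \<omega>)"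
      by (intro nn_integral_cong) (auto simp: D_def)
    finally show ?thesis using I by simp
  qed
  define T where "T = I / t"
  have T0: "0 \<le> T" using t I by (simp add: T_def)
  have xT: "x a \<le> T" if "a \<in> C" for a
  proof -
    have "emeasure D (?S a) \<le> ennreal I"
      using nn_integral_ge_point[OF that, of "\<lambda>a. emeasure D (?S a)"] Dtot by (rule order_trans)
    then have "ennreal (x a) \<le> ennreal (1/t) * ennreal I"
      using xD[OF that] by (meson mult_left_mono order_trans zero_le)
    also have "\<dots> = ennreal T" using t I by (simp add: T_def ennreal_mult[symmetric])
    finally show ?thesis using T0 by simp
  qed
  have each: "emeasure \<mu> (?T a) \<le> ennreal (\<kappa> * K powr e * T powr (e - 1) * (1/t)) * emeasure D (?S a)" if a: "a \<in> C" for a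
  proof -
    obtain b where b: "b \<in> disc" "?T a = ?S b" using Tm[OF a] by blast
    have "emeasure \<mu> (?T a) \<le> ennreal (\<kappa> * mass \<omega> (?T a) powr e)"
      unfolding b(2) by (rule \<kappa>(2)[OF b(1)])
    also have "\<dots> \<le> ennreal (\<kappa> * (K powr e * T powr (e - 1) * x a))"
    proof (intro ennreal_leI mult_left_mono)
      have "mass \<omega> (?T a) powr e \<le> (K * x a) powr e"
        using K(2)[OF Cd[OF a]] e unfolding x_def by (intro powr_mono2) auto
      also have "\<dots> = K powr e * (x a powr (e - 1) * x a)"
        using K(1) x[OF a] by (simp add: powr_mult powr_mult_base[symmetric] mult.commute powr_diff)
      also have "\<dots> \<le> K powr e * (T powr (e - 1) * x a)"
        using x[OF a] xT[OF a] e by (intro mult_left_mono mult_right_mono powr_mono2) auto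
      finally show "mass \<omega> (?T a) powr e \<le> K powr e * T powr (e - 1) * x a" by simp
    qed (rule \<kappa>(1))
    also have "\<dots> = ennreal (\<kappa> * K powr e * T powr (e - 1)) * ennreal (x a)"
      using x[OF a] \<kappa>(1) by (subst ennreal_mult[symmetric]) (auto simp: mult.assoc)
    also have "\<dots> \<le> ennreal (\<kappa> * K powr e * T powr (e - 1)) * (ennreal (1/t) * emeasure D (?S a))"
      by (intro mult_left_mono xD[OF a]) simp
    also have "\<dots> = ennreal (\<kappa> * K powr e * T powr (e - 1) * (1/t)) * emeasure D (?S a)"
      using \<kappa>(1) t by (subst ennreal_mult) (auto simp: mult.assoc)
    finally show ?thesis .
  qed
  have "emeasure \<mu> E \<le> emeasure \<mu> (\<Union>a\<in>C. ?T a)"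
    using Tsets C(1) by (intro emeasure_mono ET sets.countable_UN') auto
  also have "\<dots> = (\<integral>\<^sup>+z. indicator (\<Union>a\<in>C. ?T a) z \<partial>\<mu>)"
    using Tsets C(1) by (intro nn_integral_indicator[symmetric] sets.countable_UN') auto
  also have "\<dots> \<le> (\<integral>\<^sup>+z. (\<integral>\<^sup>+a. indicator (?T a) z \<partial>count_space C) \<partial>\<mu>)"
  proof (rule nn_integral_mono)
    fix z
    show "(indicator (\<Union>a\<in>C. ?T a) z :: ennreal) \<le> (\<integral>\<^sup>+a. indicator (?T a) z \<partial>count_space C)"
    proof (cases "z \<in> (\<Union>a\<in>C. ?T a)")
      case True
      then obtain a where a: "a \<in> C" "z \<in> ?T a" by blast
      then show ?thesis using True nn_integral_ge_point[OF a(1), of "\<lambda>a. indicator (?T a) z"] by simp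
    qed simp
  qed
  also have "\<dots> = (\<integral>\<^sup>+a. (\<integral>\<^sup>+z. indicator (?T a) z \<partial>\<mu>) \<partial>count_space C)"
    using C(1) Tsets by (intro nn_integral_count_space_nn_integral) auto
  also have "\<dots> = (\<integral>\<^sup>+a. emeasure \<mu> (?T a) \<partial>count_space C)"
    using Tsets by (intro nn_integral_cong nn_integral_indicator) auto
  also have "\<dots> \<le> (\<integral>\<^sup>+a. ennreal (\<kappa> * K powr e * T powr (e - 1) * (1/t)) * emeasure D (?S a) \<partial>count_space C)"
    using each by (intro nn_integral_mono) auto
  also have "\<dots> = ennreal (\<kappa> * K powr e * T powr (e - 1) * (1/t)) * (\<integral>\<^sup>+a. emeasure D (?S a) \<partial>count_space C)"
    by (rule nn_integral_cmult) simp
  also have "\<dots> \<le> ennreal (\<kappa> * K powr e * T powr (e - 1) * (1/t)) * ennreal I"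
    by (intro mult_left_mono Dtot) simp
  also have "\<dots> = ennreal (\<kappa> * K powr e * (T powr (e - 1) * T))"
    using \<kappa>(1) t I by (subst ennreal_mult[symmetric]) (auto simp: T_def)
  also have "T powr (e - 1) * T = T powr e"
    using T0 by (cases "T = 0") (auto simp: powr_diff)
  finally show ?thesis by (simp only: E_def T_def)
qed

lemma nn_integral_powr_from_0:
  fixes c a :: real
  assumes "0 < a" "0 \<le> c"
  shows "(\<integral>\<^sup>+t. ennreal (t powr (a - 1)) * indicator {t. 0 < t \<and> t < c} t \<partial>lborel) = ennreal (c powr a / a)"
proof -
  have "((\<lambda>t. t powr (a - 1)) has_integral (c powr (a - 1 + 1) / (a - 1 + 1))) {0..c}"
    using assms by (intro has_integral_powr_from_0) auto
  from nn_integral_has_integral_lebesgue[OF _ this]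
  have "(\<integral>\<^sup>+t. ennreal (indicator {0..c} t * t powr (a - 1)) \<partial>lborel) = ennreal (c powr a / a)" by simp
  moreover have "(\<integral>\<^sup>+t. ennreal (t powr (a - 1)) * indicator {t. 0 < t \<and> t < c} t \<partial>lborel) =
      (\<integral>\<^sup>+t. ennreal (indicator {0..c} t * t powr (a - 1)) \<partial>lborel)"
  proof (rule nn_integral_cong_AE)
    have "AE t in lborel. t \<noteq> (0::real)" "AE t in lborel. t \<noteq> c" by (rule AE_lborel_singleton)+
    then show "AE t in lborel. ennreal (t powr (a - 1)) * indicator {t. 0 < t \<and> t < c} t = ennreal (indicator {0..c} t * t powr (a - 1))"
      by eventually_elim (auto split: split_indicator)
  qed
  ultimately show ?thesis by simp
qed

lemma epowr_eq_layer_cake: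
  assumes a: "0 < a"
  shows "epowr x a = ennreal a * (\<integral>\<^sup>+t. ennreal (t powr (a - 1)) * indicator {t. 0 < t \<and> ennreal t < x} t \<partial>lborel)"
proof (cases x)
  case (real c)
  have "{t. 0 < t \<and> ennreal t < x} = {t. 0 < t \<and> t < c}"
    using real by (auto simp: ennreal_less_iff)
  then show ?thesis using real a nn_integral_powr_from_0[OF a, of c]
    by (simp add: ennreal_mult[symmetric])
next
  case top
  define I where "I = (\<integral>\<^sup>+t. ennreal (t powr (a - 1)) * indicator {t. 0 < t \<and> ennreal t < x} t \<partial>lborel)"
  have "ennreal y \<le> I" if y: "0 < y" for y
  proof -
    define c where "c = (a * y) powr (1/a)"
    have "c powr a / a = y" using a y by (simp add: c_def powr_powr)
    then have "ennreal y = (\<integral>\<^sup>+t. ennreal (t powr (a - 1)) * indicator {t. 0 < t \<and> t < c} t \<partial>lborel)"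
      using nn_integral_powr_from_0[OF a, of c] by (simp add: c_def)
    also have "\<dots> \<le> I" unfolding I_def
      using top by (intro nn_integral_mono) (auto split: split_indicator)
    finally show ?thesis .
  qed
  then have "I = top"
  proof (cases I)
    case (real r)
    then have "ennreal (r + 1) \<le> ennreal r" using \<open>\<And>y. 0 < y \<Longrightarrow> ennreal y \<le> I\<close>[of "r + 1"] by simp
    then show ?thesis using real by simp
  qed
  then show ?thesis using top a by (simp add: I_def ennreal_mult_top)
qed

text \<open>The part of \<open>F\<close> below \<open>t / 2\<close> contributes at most \<open>t / 2\<close> to any mean.\<close>

lemma hormander_maximal_truncate:
  fixes F :: "complex \<Rightarrow> real"
  assumes w: "weight \<omega>" and F[measurable]: "F \<in> borel_measurable (lebesgue_on disc)" and t: "0 < t"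
    and less: "ennreal t < hormander_maximal \<omega> F z"
  shows "ennreal (t / 2) < hormander_maximal \<omega> (\<lambda>\<zeta>. if norm (F \<zeta>) > t / 2 then F \<zeta> else 0) z"
proof -
  interpret W: finite_measure "weighted \<omega>" by (rule finite_measure_weighted[OF w])
  let ?G = "\<lambda>\<zeta>. if norm (F \<zeta>) > t / 2 then F \<zeta> else 0"
  obtain a where a: "a \<in> disc" "z \<in> carleson_square a" "ennreal t < square_mean \<omega> F a"
    using less by (auto simp: less_hormander_maximal_iff)
  define m where "m = mass \<omega> (carleson_square a)"
  have m: "0 < m" unfolding m_def by (rule weight_square_pos[OF w a(1)])
  have em: "emeasure (weighted \<omega>) (carleson_square a) = ennreal m" by (simp add: m_def W.emeasure_eq_measure)
  have S[measurable]: "carleson_square a \<in> sets (lebesgue_on disc)" by (rule carleson_square_measurable[OF a(1)])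
  have "square_integral \<omega> (\<lambda>\<zeta>. norm (F \<zeta>)) a \<le>
    (\<integral>\<^sup>+\<zeta>. ennreal (norm (?G \<zeta>)) * indicator (carleson_square a) \<zeta> + ennreal (t / 2) * indicator (carleson_square a) \<zeta> \<partial>weighted \<omega>)"
    using t by (intro nn_integral_mono) (auto split: split_indicator intro: ennreal_leI)
  also have "\<dots> = square_integral \<omega> (\<lambda>\<zeta>. norm (?G \<zeta>)) a + (\<integral>\<^sup>+\<zeta>. ennreal (t / 2) * indicator (carleson_square a) \<zeta> \<partial>weighted \<omega>)"
    by (rule nn_integral_add) measurable
  also have "(\<integral>\<^sup>+\<zeta>. ennreal (t / 2) * indicator (carleson_square a) \<zeta> \<partial>weighted \<omega>) = ennreal (t / 2) * ennreal m"
    unfolding em[symmetric] by (rule nn_integral_cmult_indicator) simp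
  finally have le: "square_integral \<omega> (\<lambda>\<zeta>. norm (F \<zeta>)) a \<le>
    square_integral \<omega> (\<lambda>\<zeta>. norm (?G \<zeta>)) a + ennreal (t / 2) * ennreal m" .
  have "\<not> square_mean \<omega> ?G a \<le> ennreal (t / 2)"
  proof
    assume "square_mean \<omega> ?G a \<le> ennreal (t / 2)"
    then have "square_integral \<omega> (\<lambda>\<zeta>. norm (?G \<zeta>)) a \<le> ennreal (t / 2) * ennreal m"
      unfolding em using m by (simp only: ennreal_divide_le_iff)
    then have "square_integral \<omega> (\<lambda>\<zeta>. norm (F \<zeta>)) a \<le> ennreal (t / 2) * ennreal m + ennreal (t / 2) * ennreal m"
      using le by (meson add_right_mono order_trans)
    also have "\<dots> = (ennreal (t / 2) + ennreal (t / 2)) * ennreal m" by (rule distrib_right[symmetric])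
    also have "ennreal (t / 2) + ennreal (t / 2) = ennreal t" using t by (subst ennreal_plus[symmetric]) auto
    finally have "square_mean \<omega> F a \<le> ennreal t"
      unfolding em using m by (simp only: ennreal_divide_le_iff)
    then show False using a(3) leD by blast
  qed
  then show ?thesis unfolding less_hormander_maximal_iff using a(1,2) by (intro bexI[of _ a]) (simp_all only: not_le simp_thms)
qed

lemma powr_le_mult_powr: "0 \<le> x \<Longrightarrow> x \<le> B \<Longrightarrow> 1 \<le> e \<Longrightarrow> x powr e \<le> B powr (e - 1) * x" for x B e :: real
proof -
  assume x: "0 \<le> x" "x \<le> B" "1 \<le> e"
  have "x powr e = x powr (e - 1) * x" using x by (cases "x = 0") (auto simp: powr_diff)
  also have "\<dots> \<le> B powr (e - 1) * x" using x by (intro mult_right_mono powr_mono2) auto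
  finally show ?thesis .
qed

text \<open>Marcinkiewicz interpolation between the weak type bound and the trivial bound for bounded
  functions. Level sets at \<open>t\<close> are controlled by the \<open>e\<close>-th power of the integral \<open>I t\<close> of the part of
  \<open>|F|\<close> above \<open>t / 2\<close>. Of these \<open>e\<close> factors, \<open>e - 1\<close> are estimated by \<open>(2/t)^(P-1) N\<close>, and the remaining
  one leaves the same integral over \<open>t\<close> as in the classical case \<open>e = 1\<close>.\<close>

lemma hormander_maximal_strong_type:
  fixes F :: "complex \<Rightarrow> real"
  assumes w: "weight \<omega>"
    and K: "1 \<le> K" "\<And>a. a \<in> disc \<Longrightarrow> mass \<omega> (tent a (16 * (1 - norm a))) \<le> K * mass \<omega> (carleson_square a)"
    and \<mu>: "\<mu> \<in> disc_borel_measures"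
    and \<kappa>: "0 \<le> \<kappa>" "\<And>a. a \<in> disc \<Longrightarrow> emeasure \<mu> (carleson_square a) \<le> ennreal (\<kappa> * mass \<omega> (carleson_square a) powr e)"
    and e: "1 \<le> e" and P: "1 < P" and F[measurable]: "F \<in> borel_measurable (lebesgue_on disc)"
    and N: "(\<integral>\<^sup>+z. ennreal (norm (F z) powr P) \<partial>weighted \<omega>) = ennreal N" "0 \<le> N"
  shows "(\<integral>\<^sup>+z. epowr (hormander_maximal \<omega> F z) (e * P) \<partial>\<mu>) \<le> ennreal (e * P * K powr e * 2 powr (e * P) / (P - 1) * \<kappa> * N powr e)"
proof -
  interpret W: finite_measure "weighted \<omega>" by (rule finite_measure_weighted[OF w])
  note \<mu>s[measurable_cong] = disc_borel_measure_sets(1)[OF \<mu>]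
  note \<mu>sp = disc_borel_measure_sets(2)[OF \<mu>]
  interpret M: finite_measure \<mu>
  proof
    have "emeasure \<mu> (space \<mu>) \<le> ennreal (\<kappa> * mass \<omega> disc powr e)"
      using \<kappa>(2)[of 0] \<mu>sp by simp
    also have "\<dots> < \<infinity>" by simp
    finally show "emeasure \<mu> (space \<mu>) \<noteq> \<infinity>" by simp
  qed
  interpret MP: pair_sigma_finite \<mu> "lborel :: real measure" ..
  interpret WP: pair_sigma_finite "weighted \<omega>" "lborel :: real measure" ..
  define H where "H = hormander_maximal \<omega> F"
  have H[measurable]: "H \<in> borel_measurable \<mu>"
    using hormander_maximal_measurable[OF w, of F] unfolding H_def by (simp cong: measurable_cong_sets add: \<mu>s)
  define Q where "Q = e * P"
  have Q: "0 < Q" using e P by (simp add: Q_def)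
  define G where "G t \<zeta> = (if norm (F \<zeta>) > t / 2 then F \<zeta> else 0)" for t \<zeta>
  define I where "I t = (\<integral>\<^sup>+\<zeta>. ennreal (norm (G t \<zeta>)) \<partial>weighted \<omega>)" for t
  \<comment> \<open>The factor \<open>Q t^(Q-1)\<close> of the layer cake formula and the bound \<open>B t^(P-1-Q) I t\<close> for the level
    sets combine to \<open>t^(P-2)\<close>, which is integrable at 0 because \<open>P > 1\<close>.\<close>
  define B where "B = \<kappa> * K powr e * 2 powr (Q - P + 1) * N powr (e - 1)"
  have B0: "0 \<le> B" using \<kappa>(1) by (simp add: B_def)
  have level: "emeasure \<mu> {z \<in> disc. ennreal t < H z} \<le> ennreal (B * t powr (P - 1 - Q)) * I t" if t: "0 < t" for t
  proof -
    have Gm: "G t \<in> borel_measurable (lebesgue_on disc)" unfolding G_def by measurable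
    have "I t \<le> (\<integral>\<^sup>+\<zeta>. ennreal ((2 / t) powr (P - 1)) * ennreal (norm (F \<zeta>) powr P) \<partial>weighted \<omega>)"
      unfolding I_def
    proof (rule nn_integral_mono)
      fix \<zeta>
      have "norm (G t \<zeta>) \<le> (2 / t) powr (P - 1) * norm (F \<zeta>) powr P"
      proof (cases "norm (F \<zeta>) > t / 2")
        case True
        then have p: "0 < norm (F \<zeta>)" using t by (meson half_gt_zero less_trans)
        have "1 \<le> ((2 / t) * norm (F \<zeta>)) powr (P - 1)"
          using True t P by (intro ge_one_powr_ge_zero) (auto simp: field_simps)
        then have "norm (F \<zeta>) * 1 \<le> norm (F \<zeta>) * ((2 / t) * norm (F \<zeta>)) powr (P - 1)"
          by (intro mult_left_mono) auto
        also have "\<dots> = (2 / t) powr (P - 1) * norm (F \<zeta>) powr P"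
        proof -
          have "norm (F \<zeta>) powr P = norm (F \<zeta>) * norm (F \<zeta>) powr (P - 1)" using p by (simp add: powr_diff)
          moreover have "((2 / t) * norm (F \<zeta>)) powr (P - 1) = (2 / t) powr (P - 1) * norm (F \<zeta>) powr (P - 1)"
            by (rule powr_mult)
          ultimately show ?thesis by (simp only: mult_ac)
        qed
        finally show ?thesis using True by (simp add: G_def)
      qed (simp add: G_def)
      then have "ennreal (norm (G t \<zeta>)) \<le> ennreal ((2 / t) powr (P - 1) * norm (F \<zeta>) powr P)" by (rule ennreal_leI)
      also have "\<dots> = ennreal ((2 / t) powr (P - 1)) * ennreal (norm (F \<zeta>) powr P)" by (rule ennreal_mult) auto
      finally show "ennreal (norm (G t \<zeta>)) \<le> ennreal ((2 / t) powr (P - 1)) * ennreal (norm (F \<zeta>) powr P)" .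
    qed
    also have "\<dots> = ennreal ((2 / t) powr (P - 1)) * (\<integral>\<^sup>+\<zeta>. ennreal (norm (F \<zeta>) powr P) \<partial>weighted \<omega>)"
      by (rule nn_integral_cmult) measurable
    also have "\<dots> = ennreal ((2 / t) powr (P - 1) * N)" unfolding N(1) using N(2) by (subst ennreal_mult) auto
    finally have It: "I t \<le> ennreal ((2 / t) powr (P - 1) * N)" .
    then obtain i where i: "I t = ennreal i" "0 \<le> i" by (cases "I t") (auto simp: top_unique)
    have i_le: "i \<le> (2 / t) powr (P - 1) * N" using It i N(2) by (simp add: ennreal_le_iff)
    have "emeasure \<mu> {z \<in> disc. ennreal t < H z} \<le> emeasure \<mu> {z \<in> disc. ennreal (t / 2) < hormander_maximal \<omega> (G t) z}"
    proof (rule emeasure_mono)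
      show "{z \<in> disc. ennreal t < H z} \<subseteq> {z \<in> disc. ennreal (t / 2) < hormander_maximal \<omega> (G t) z}"
        using hormander_maximal_truncate[OF w F t] unfolding H_def G_def by blast
      show "{z \<in> disc. ennreal (t / 2) < hormander_maximal \<omega> (G t) z} \<in> sets \<mu>"
        unfolding \<mu>s using open_hormander_maximal_greater[OF w, of "ennreal (t / 2)" "G t"]
        by (subst sets_restrict_space_iff) auto
    qed
    also have "\<dots> \<le> ennreal (\<kappa> * K powr e * (i / (t / 2)) powr e)"
      using t i unfolding I_def
      by (intro hormander_maximal_weak_type[OF w K \<mu> \<kappa> e _ Gm]) auto
    also have "\<dots> \<le> ennreal (B * t powr (P - 1 - Q) * i)"
    proof (rule ennreal_leI)
      have "(i / (t / 2)) powr e = (2 / t) powr e * i powr e"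
        using i t by (subst powr_mult[symmetric]) (auto simp: field_simps)
      also have "\<dots> \<le> (2 / t) powr e * (((2 / t) powr (P - 1) * N) powr (e - 1) * i)"
        using i i_le e by (intro mult_left_mono powr_le_mult_powr) auto
      also have "((2 / t) powr (P - 1) * N) powr (e - 1) = (2 / t) powr ((P - 1) * (e - 1)) * N powr (e - 1)"
        using N t by (subst powr_mult) (auto simp: powr_powr)
      also have "(2 / t) powr e * ((2 / t) powr ((P - 1) * (e - 1)) * N powr (e - 1) * i) =
          (2 / t) powr (e + (P - 1) * (e - 1)) * N powr (e - 1) * i"
        by (simp add: powr_add)
      also have "e + (P - 1) * (e - 1) = Q - P + 1" by (simp add: Q_def algebra_simps)
      also have "(2 / t) powr (Q - P + 1) = 2 powr (Q - P + 1) * t powr (P - 1 - Q)"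
      proof -
        have "(2 / t) powr (Q - P + 1) = 2 powr (Q - P + 1) / t powr (Q - P + 1)"
          using t by (simp add: powr_divide)
        moreover have "t powr (P - 1 - Q) = inverse (t powr (Q - P + 1))"
          using powr_minus[of t "Q - P + 1"] by (simp add: algebra_simps)
        ultimately show ?thesis by (simp only: divide_inverse)
      qed
      finally have "\<kappa> * K powr e * (i / (t / 2)) powr e \<le> \<kappa> * K powr e * (2 powr (Q - P + 1) * t powr (P - 1 - Q) * N powr (e - 1) * i)"
        using \<kappa>(1) by (intro mult_left_mono) auto
      then show "\<kappa> * K powr e * (i / (t / 2)) powr e \<le> B * t powr (P - 1 - Q) * i"
        by (simp only: B_def mult_ac)
    qed
    also have "\<dots> = ennreal (B * t powr (P - 1 - Q)) * I t" unfolding i(1) using B0 i by (intro ennreal_mult) auto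
    finally show ?thesis .
  qed
  define L where "L z t = ennreal (t powr (Q - 1)) * indicator {t. 0 < t \<and> ennreal t < H z} t" for z t
  define R where "R \<zeta> t = ennreal (norm (F \<zeta>)) * (ennreal (t powr (P - 1 - 1)) * indicator {t. 0 < t \<and> t < 2 * norm (F \<zeta>)} t)" for \<zeta> t
  have Lm[measurable]: "(\<lambda>(z, t). L z t) \<in> borel_measurable (\<mu> \<Otimes>\<^sub>M lborel)"
  proof -
    have "(\<lambda>(z, t). L z t) = (\<lambda>p. if 0 < snd p \<and> ennreal (snd p) < H (fst p) then ennreal (snd p powr (Q - 1)) else 0)"
      by (auto simp: L_def)
    also have "\<dots> \<in> borel_measurable (\<mu> \<Otimes>\<^sub>M lborel)" by measurable
    finally show ?thesis .
  qed
  have Rm[measurable]: "(\<lambda>(\<zeta>, t). R \<zeta> t) \<in> borel_measurable (weighted \<omega> \<Otimes>\<^sub>M lborel)"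
  proof -
    have "(\<lambda>(\<zeta>, t). R \<zeta> t) = (\<lambda>p. ennreal (norm (F (fst p))) *
        (if 0 < snd p \<and> snd p < 2 * norm (F (fst p)) then ennreal (snd p powr (P - 1 - 1)) else 0))"
      by (auto simp: R_def)
    also have "\<dots> \<in> borel_measurable (weighted \<omega> \<Otimes>\<^sub>M lborel)" by measurable
    finally show ?thesis .
  qed
  have slice: "(\<integral>\<^sup>+z. L z t \<partial>\<mu>) \<le> ennreal B * (\<integral>\<^sup>+\<zeta>. R \<zeta> t \<partial>weighted \<omega>)" for t
  proof (cases "0 < t")
    case True
    have sm: "{z \<in> disc. ennreal t < H z} \<in> sets \<mu>"
      unfolding \<mu>s H_def using open_hormander_maximal_greater[OF w, of "ennreal t" F]
      by (subst sets_restrict_space_iff) auto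
    have "(\<integral>\<^sup>+z. L z t \<partial>\<mu>) = (\<integral>\<^sup>+z. ennreal (t powr (Q - 1)) * indicator {z \<in> disc. ennreal t < H z} z \<partial>\<mu>)"
      using True by (intro nn_integral_cong) (auto simp: L_def \<mu>sp split: split_indicator)
    also have "\<dots> = ennreal (t powr (Q - 1)) * emeasure \<mu> {z \<in> disc. ennreal t < H z}"
      by (rule nn_integral_cmult_indicator[OF sm])
    also have "\<dots> \<le> ennreal (t powr (Q - 1)) * (ennreal (B * t powr (P - 1 - Q)) * I t)"
      by (intro mult_left_mono level[OF True]) simp
    also have "\<dots> = ennreal B * (ennreal (t powr (P - 1 - 1)) * I t)"
    proof -
      have m3: "ennreal x * (ennreal y * i) = ennreal (x * y) * i" if "0 \<le> x" "0 \<le> y" for x y i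
        using that by (simp add: ennreal_mult mult.assoc)
      have "ennreal (t powr (Q - 1)) * (ennreal (B * t powr (P - 1 - Q)) * I t) =
          ennreal (t powr (Q - 1) * (B * t powr (P - 1 - Q))) * I t"
        using B0 by (intro m3) auto
      also have "t powr (Q - 1) * (B * t powr (P - 1 - Q)) = B * t powr (P - 1 - 1)"
        by (simp add: powr_add[symmetric])
      also have "ennreal (B * t powr (P - 1 - 1)) * I t = ennreal B * (ennreal (t powr (P - 1 - 1)) * I t)"
        using B0 by (intro m3[symmetric]) auto
      finally show ?thesis .
    qed
    also have "ennreal (t powr (P - 1 - 1)) * I t = (\<integral>\<^sup>+\<zeta>. ennreal (t powr (P - 1 - 1)) * ennreal (norm (G t \<zeta>)) \<partial>weighted \<omega>)"
      unfolding I_def G_def by (rule nn_integral_cmult[symmetric]) measurable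
    also have "\<dots> = (\<integral>\<^sup>+\<zeta>. R \<zeta> t \<partial>weighted \<omega>)"
      using True by (intro nn_integral_cong) (auto simp: R_def G_def mult.commute split: split_indicator)
    finally show ?thesis .
  qed (simp add: L_def)
  have inner: "(\<integral>\<^sup>+t. R \<zeta> t \<partial>lborel) = ennreal (2 powr (P - 1) / (P - 1)) * ennreal (norm (F \<zeta>) powr P)" for \<zeta>
  proof -
    have "(\<integral>\<^sup>+t. R \<zeta> t \<partial>lborel) = ennreal (norm (F \<zeta>)) * (\<integral>\<^sup>+t. ennreal (t powr (P - 1 - 1)) * indicator {t. 0 < t \<and> t < 2 * norm (F \<zeta>)} t \<partial>lborel)"
      unfolding R_def by (rule nn_integral_cmult) measurable
    also have "\<dots> = ennreal (norm (F \<zeta>)) * ennreal ((2 * norm (F \<zeta>)) powr (P - 1) / (P - 1))"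
      using P by (subst nn_integral_powr_from_0) auto
    also have "\<dots> = ennreal (norm (F \<zeta>) * ((2 * norm (F \<zeta>)) powr (P - 1) / (P - 1)))"
      using P by (intro ennreal_mult[symmetric]) auto
    also have "norm (F \<zeta>) * ((2 * norm (F \<zeta>)) powr (P - 1) / (P - 1)) = 2 powr (P - 1) / (P - 1) * norm (F \<zeta>) powr P"
    proof -
      have "norm (F \<zeta>) powr P = norm (F \<zeta>) * norm (F \<zeta>) powr (P - 1)"
        by (cases "norm (F \<zeta>) = 0") (auto simp: powr_diff)
      then show ?thesis by (simp add: powr_mult)
    qed
    also have "ennreal \<dots> = ennreal (2 powr (P - 1) / (P - 1)) * ennreal (norm (F \<zeta>) powr P)"
      using P by (intro ennreal_mult) auto
    finally show ?thesis .
  qed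
  have "(\<integral>\<^sup>+z. epowr (H z) Q \<partial>\<mu>) = (\<integral>\<^sup>+z. ennreal Q * (\<integral>\<^sup>+t. L z t \<partial>lborel) \<partial>\<mu>)"
    unfolding L_def by (intro nn_integral_cong epowr_eq_layer_cake[OF Q])
  also have "\<dots> = ennreal Q * (\<integral>\<^sup>+z. (\<integral>\<^sup>+t. L z t \<partial>lborel) \<partial>\<mu>)"
    by (rule nn_integral_cmult) measurable
  finally have 1: "(\<integral>\<^sup>+z. epowr (H z) Q \<partial>\<mu>) = ennreal Q * (\<integral>\<^sup>+z. (\<integral>\<^sup>+t. L z t \<partial>lborel) \<partial>\<mu>)" .
  have "(\<integral>\<^sup>+z. (\<integral>\<^sup>+t. L z t \<partial>lborel) \<partial>\<mu>) = (\<integral>\<^sup>+t. (\<integral>\<^sup>+z. L z t \<partial>\<mu>) \<partial>lborel)"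
    by (rule MP.Fubini'[symmetric]) measurable
  also have "\<dots> \<le> (\<integral>\<^sup>+t. ennreal B * (\<integral>\<^sup>+\<zeta>. R \<zeta> t \<partial>weighted \<omega>) \<partial>lborel)"
    by (intro nn_integral_mono slice)
  also have "\<dots> = ennreal B * (\<integral>\<^sup>+t. (\<integral>\<^sup>+\<zeta>. R \<zeta> t \<partial>weighted \<omega>) \<partial>lborel)"
  proof (rule nn_integral_cmult)
    have "(\<lambda>(t, \<zeta>). R \<zeta> t) \<in> borel_measurable (lborel \<Otimes>\<^sub>M weighted \<omega>)"
      using measurable_pair_swap[OF Rm] by simp
    then show "(\<lambda>t. \<integral>\<^sup>+\<zeta>. R \<zeta> t \<partial>weighted \<omega>) \<in> borel_measurable lborel"
      by (rule W.borel_measurable_nn_integral)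
  qed
  also have "(\<integral>\<^sup>+t. (\<integral>\<^sup>+\<zeta>. R \<zeta> t \<partial>weighted \<omega>) \<partial>lborel) = (\<integral>\<^sup>+\<zeta>. (\<integral>\<^sup>+t. R \<zeta> t \<partial>lborel) \<partial>weighted \<omega>)"
    by (rule WP.Fubini') measurable
  also have "\<dots> = (\<integral>\<^sup>+\<zeta>. ennreal (2 powr (P - 1) / (P - 1)) * ennreal (norm (F \<zeta>) powr P) \<partial>weighted \<omega>)"
    by (intro nn_integral_cong inner)
  also have "\<dots> = ennreal (2 powr (P - 1) / (P - 1)) * ennreal N"
    unfolding N(1)[symmetric] by (rule nn_integral_cmult) measurable
  finally have "(\<integral>\<^sup>+z. epowr (H z) Q \<partial>\<mu>) \<le> ennreal Q * (ennreal B * (ennreal (2 powr (P - 1) / (P - 1)) * ennreal N))"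
    unfolding 1 by (rule mult_left_mono) simp
  also have "\<dots> = ennreal (Q * (B * (2 powr (P - 1) / (P - 1) * N)))"
    using Q B0 P N(2) by (simp add: ennreal_mult[symmetric])
  also have "Q * (B * (2 powr (P - 1) / (P - 1) * N)) = e * P * K powr e * 2 powr (e * P) / (P - 1) * \<kappa> * N powr e"
  proof -
    have "2 powr (Q - P + 1) * 2 powr (P - 1) = (2::real) powr Q" by (simp add: powr_add[symmetric])
    moreover have "N powr (e - 1) * N = N powr e" using N(2) by (cases "N = 0") (auto simp: powr_diff)
    moreover have "Q * ((\<kappa> * K powr e * x * y) * (v / (P - 1) * N)) = Q * K powr e * (x * v) / (P - 1) * \<kappa> * (y * N)" for x y v
      by (simp add: mult_ac)
    ultimately show ?thesis unfolding B_def Q_def[symmetric] by (simp only:)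
  qed
  finally show ?thesis by (simp only: H_def Q_def)
qed

section \<open>Bounded operators and their norms\<close>

lemma bounded_operator_iff_operator_norm:
  assumes fin: "\<And>f. f \<in> X \<Longrightarrow> nX f < \<infinity>" and Y: "\<And>f. f \<in> X \<Longrightarrow> nY (T f) < \<infinity> \<Longrightarrow> T f \<in> Y"
  shows "bounded_operator X nX Y nY T \<longleftrightarrow> operator_norm X nX nY T < \<infinity>"
proof
  assume "bounded_operator X nX Y nY T"
  then obtain C :: real where "\<forall>f\<in>X. nY (T f) \<le> ennreal C * nX f" unfolding bounded_operator_def by blast
  then have "operator_norm X nX nY T \<le> ennreal C" unfolding operator_norm_def by (intro Inf_lower) simp
  then show "operator_norm X nX nY T < \<infinity>" using ennreal_less_top le_less_trans infinity_ennreal_def by metis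
next
  assume "operator_norm X nX nY T < \<infinity>"
  then obtain D where D: "D < \<infinity>" "\<forall>f\<in>X. nY (T f) \<le> D * nX f"
    unfolding operator_norm_def Inf_less_iff by blast
  then obtain C where C: "D = ennreal C" by (cases D) auto
  have "T f \<in> Y" if "f \<in> X" for f
  proof -
    have "nY (T f) \<le> D * nX f" using D(2) that by blast
    also have "\<dots> < \<infinity>" using D(1) fin[OF that] by (simp add: ennreal_mult_less_top)
    finally show ?thesis by (rule Y[OF that])
  qed
  then show "bounded_operator X nX Y nY T" unfolding bounded_operator_def using D(2) C by blast
qed

lemma eLp_norm_finite_iff: "0 < p \<Longrightarrow> eLp_norm M p u < \<infinity> \<longleftrightarrow> (\<integral>\<^sup>+x. epowr (u x) p \<partial>M) < \<infinity>"
  unfolding eLp_norm_def by (cases "\<integral>\<^sup>+x. epowr (u x) p \<partial>M") auto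

lemma eLp_norm_cmult_mono:
  assumes c: "0 \<le> c" and q: "0 < q" and v: "v \<in> borel_measurable M"
    and le: "\<And>x. x \<in> space M \<Longrightarrow> u x \<le> ennreal c * v x"
  shows "eLp_norm M q u \<le> ennreal c * eLp_norm M q v"
proof -
  have "(\<integral>\<^sup>+x. epowr (u x) q \<partial>M) \<le> (\<integral>\<^sup>+x. ennreal (c powr q) * epowr (v x) q \<partial>M)"
    using epowr_mono[OF less_imp_le[OF q] le] by (intro nn_integral_mono) (simp add: epowr_mult[OF c q])
  also have "\<dots> = ennreal (c powr q) * (\<integral>\<^sup>+x. epowr (v x) q \<partial>M)"
    using v by (intro nn_integral_cmult) measurable
  finally have "eLp_norm M q u \<le> epowr (ennreal (c powr q) * (\<integral>\<^sup>+x. epowr (v x) q \<partial>M)) (1/q)"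
    unfolding eLp_norm_def using q by (intro epowr_mono) auto
  also have "\<dots> = ennreal c * eLp_norm M q v"
    unfolding eLp_norm_def using c q by (subst epowr_mult) (auto simp: powr_powr)
  finally show ?thesis .
qed

lemma bergman_subset_Lp: "bergman p \<omega> \<subseteq> Lp (weighted \<omega>) p"
proof
  fix f assume "f \<in> bergman p \<omega>"
  then have f: "f holomorphic_on disc" "Lp_norm (weighted \<omega>) p f < \<infinity>" by (auto simp: bergman_def)
  have "f \<in> borel_measurable (weighted \<omega>)"
    using measurable_lebesgue_on_disc_of_borel[OF holomorphic_measurable_disc[OF f(1)]]
    by (simp cong: measurable_cong_sets)
  then show "f \<in> Lp (weighted \<omega>) p" using f(2) by (simp add: Lp_def)
qed

lemma maximal_operator_measurable:
  assumes "weight \<omega>" "\<mu> \<in> disc_borel_measures"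
  shows "maximal_operator \<omega> \<alpha> \<phi> \<in> borel_measurable \<mu>"
proof -
  note [measurable_cong] = disc_borel_measure_sets(1)[OF assms(2)]
  have [measurable]: "hormander_maximal \<omega> (\<lambda>\<zeta>. norm (\<phi> \<zeta>) powr (1 / \<alpha>)) \<in> borel_measurable \<mu>"
    using hormander_maximal_measurable[OF assms(1), of "\<lambda>\<zeta>. norm (\<phi> \<zeta>) powr (1 / \<alpha>)"]
    by (simp cong: measurable_cong_sets add: disc_borel_measure_sets(1)[OF assms(2)])
  show ?thesis unfolding maximal_operator_def[abs_def] by measurable
qed

lemma carleson_measure_iff:
  assumes "0 < p" "0 < q" "\<mu> \<in> disc_borel_measures"
  shows "carleson_measure q p \<omega> \<mu> \<longleftrightarrow> embedding_norm q p \<omega> \<mu> < \<infinity>"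
  unfolding carleson_measure_def embedding_norm_def
proof (rule bounded_operator_iff_operator_norm)
  fix f assume f: "f \<in> bergman p \<omega>"
  then show "Lp_norm (weighted \<omega>) p f < \<infinity>" by (simp add: bergman_def)
  assume "Lp_norm \<mu> q (id f) < \<infinity>"
  moreover have "f \<in> borel_measurable \<mu>"
    using f holomorphic_measurable_disc[of f]
    by (simp add: bergman_def disc_borel_measure_sets(1)[OF assms(3)] cong: measurable_cong_sets)
  ultimately show "id f \<in> Lp \<mu> q" by (simp add: Lp_def)
qed

lemma maximal_bounded_iff:
  assumes "weight \<omega>" "\<mu> \<in> disc_borel_measures"
  shows "maximal_bounded q p \<omega> \<alpha> \<mu> \<longleftrightarrow> maximal_norm q p \<omega> \<alpha> \<mu> < \<infinity>"
  unfolding maximal_bounded_def maximal_norm_def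
proof (rule bounded_operator_iff_operator_norm)
  fix \<phi> assume \<phi>: "\<phi> \<in> Lp (weighted \<omega>) p"
  then show "Lp_norm (weighted \<omega>) p \<phi> < \<infinity>" by (simp add: Lp_def)
  assume "eLp_norm \<mu> q (maximal_operator \<omega> \<alpha> \<phi>) < \<infinity>"
  then show "maximal_operator \<omega> \<alpha> \<phi> \<in> eLp \<mu> q"
    using maximal_operator_measurable[OF assms] by (simp add: eLp_def)
qed

text \<open>By pointwise domination every admissible constant for the maximal operator is, up to the factor
  \<open>C^\<alpha>\<close>, admissible for the embedding: the maximal operator is applied to \<open>f\<close> itself.\<close>

lemma embedding_norm_le_maximal_norm:
  assumes p: "0 < p" and q: "0 < q" and \<nu>: "\<nu> \<in> D_hat" and \<omega>: "\<omega> \<in> B_infty \<nu>" and \<alpha>: "0 < \<alpha>"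
  obtains c where "0 < c"
    "\<And>\<mu>. \<mu> \<in> disc_borel_measures \<Longrightarrow> epowr (embedding_norm q p \<omega> \<mu>) q \<le> ennreal c * epowr (maximal_norm q p \<omega> \<alpha> \<mu>) q"
proof -
  have w: "weight \<omega>" using \<omega> by (auto simp: B_infty_def)
  obtain C where C: "0 < C"
    "\<And>f z. f holomorphic_on disc \<Longrightarrow> z \<in> disc \<Longrightarrow>
      ennreal (norm (f z) powr (1/\<alpha>)) \<le> ennreal C * hormander_maximal \<omega> (\<lambda>w. norm (f w) powr (1/\<alpha>)) z"
    using B_infty_pointwise_estimate[OF \<nu> \<omega>, of "1/\<alpha>"] \<alpha> by auto
  show ?thesis
  proof (rule that[of "(C powr \<alpha>) powr q"])
    show "0 < (C powr \<alpha>) powr q" using C by simp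
    fix \<mu> assume \<mu>: "\<mu> \<in> disc_borel_measures"
    show "epowr (embedding_norm q p \<omega> \<mu>) q \<le> ennreal ((C powr \<alpha>) powr q) * epowr (maximal_norm q p \<omega> \<alpha> \<mu>) q"
      unfolding maximal_norm_def operator_norm_def
    proof (rule le_epowr_Inf)
      show "0 < (C powr \<alpha>) powr q" using C by simp
      fix D assume "D \<in> {D. \<forall>f\<in>Lp (weighted \<omega>) p. eLp_norm \<mu> q (maximal_operator \<omega> \<alpha> f) \<le> D * Lp_norm (weighted \<omega>) p f}"
      then have D: "\<And>f. f \<in> Lp (weighted \<omega>) p \<Longrightarrow> eLp_norm \<mu> q (maximal_operator \<omega> \<alpha> f) \<le> D * Lp_norm (weighted \<omega>) p f" by blast
      have "Lp_norm \<mu> q (id f) \<le> (ennreal (C powr \<alpha>) * D) * Lp_norm (weighted \<omega>) p f" if f: "f \<in> bergman p \<omega>" for f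
      proof -
        have hol: "f holomorphic_on disc" using f by (simp add: bergman_def)
        have pt: "ennreal (norm (f z)) \<le> ennreal (C powr \<alpha>) * maximal_operator \<omega> \<alpha> f z" if "z \<in> space \<mu>" for z
        proof -
          have z: "z \<in> disc" using that disc_borel_measure_sets(2)[OF \<mu>] by simp
          have "epowr (ennreal (norm (f z) powr (1/\<alpha>))) \<alpha> \<le>
              epowr (ennreal C * hormander_maximal \<omega> (\<lambda>w. norm (f w) powr (1/\<alpha>)) z) \<alpha>"
            using \<alpha> by (intro epowr_mono C(2)[OF hol z]) auto
          then show ?thesis using \<alpha> C(1) by (simp add: epowr_mult maximal_operator_def powr_powr)
        qed
        have "Lp_norm \<mu> q (id f) \<le> ennreal (C powr \<alpha>) * eLp_norm \<mu> q (maximal_operator \<omega> \<alpha> f)"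
          unfolding Lp_norm_def id_apply
          using pt by (intro eLp_norm_cmult_mono q maximal_operator_measurable[OF w \<mu>]) auto
        also have "\<dots> \<le> ennreal (C powr \<alpha>) * (D * Lp_norm (weighted \<omega>) p f)"
          using f bergman_subset_Lp by (intro mult_left_mono D) auto
        finally show ?thesis by (simp add: mult.assoc)
      qed
      then have "embedding_norm q p \<omega> \<mu> \<le> ennreal (C powr \<alpha>) * D"
        unfolding embedding_norm_def operator_norm_def by (intro Inf_lower) blast
      then have "epowr (embedding_norm q p \<omega> \<mu>) q \<le> epowr (ennreal (C powr \<alpha>) * D) q"
        using q by (intro epowr_mono) auto
      then show "epowr (embedding_norm q p \<omega> \<mu>) q \<le> ennreal ((C powr \<alpha>) powr q) * epowr D q"
        using q by (simp add: epowr_mult)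
    qed (rule q)
  qed
qed

text \<open>The strong type bound for \<open>F = |\<phi>|^(1/\<alpha>)\<close> with \<open>e = q / p\<close> and \<open>P = p \<alpha>\<close>; the condition \<open>\<alpha> > 1/p\<close> says
  that \<open>P > 1\<close>.\<close>

lemma maximal_norm_le_carleson_sup:
  assumes p: "0 < p" "p \<le> q" and \<nu>: "\<nu> \<in> D_hat" and \<omega>: "\<omega> \<in> B_infty \<nu>" and \<alpha>: "1/p < \<alpha>"
  obtains c where "0 < c"
    "\<And>\<mu>. \<mu> \<in> disc_borel_measures \<Longrightarrow> epowr (maximal_norm q p \<omega> \<alpha> \<mu>) q \<le> ennreal c * carleson_sup q p \<omega> \<mu>"
proof -
  have q: "0 < q" using p by simp
  have w: "weight \<omega>" using \<omega> by (auto simp: B_infty_def)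
  interpret W: finite_measure "weighted \<omega>" by (rule finite_measure_weighted[OF w])
  obtain K0 where K0: "1 \<le> K0" "\<And>a n. a \<in> disc \<Longrightarrow> 1 \<le> n \<Longrightarrow>
    mass \<omega> (tent a (2^n * (1 - norm a))) \<le> K0^(n+1) * mass \<omega> (carleson_square a)"
    using B_infty_tent_doubling[OF \<nu> \<omega>] by blast
  define K where "K = K0^5"
  have K: "1 \<le> K" using K0(1) by (simp add: K_def)
  have K': "mass \<omega> (tent a (16 * (1 - norm a))) \<le> K * mass \<omega> (carleson_square a)"
    if "a \<in> disc" for a using K0(2)[OF that, of 4] by (simp add: K_def)
  define e where "e = q / p"
  define P where "P = p * \<alpha>"
  have e: "1 \<le> e" using p by (simp add: e_def)
  have \<alpha>0: "0 < \<alpha>" using \<alpha> p by (meson divide_pos_pos less_trans zero_less_one)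
  have P: "1 < P" using \<alpha> p by (simp add: P_def field_simps)
  have eP: "e * P = \<alpha> * q" using p by (simp add: e_def P_def)
  define c where "c = e * P * K powr e * 2 powr (e * P) / (P - 1)"
  have c: "0 < c" using e P K by (simp add: c_def)
  show ?thesis
  proof (rule that[OF c])
    fix \<mu> assume \<mu>: "\<mu> \<in> disc_borel_measures"
    show "epowr (maximal_norm q p \<omega> \<alpha> \<mu>) q \<le> ennreal c * carleson_sup q p \<omega> \<mu>"
    proof (cases "carleson_sup q p \<omega> \<mu>")
      case top
      then show ?thesis using c by (simp add: ennreal_mult_top)
    next
      case (real \<kappa>)
      have \<kappa>: "emeasure \<mu> (carleson_square a) \<le> ennreal (\<kappa> * mass \<omega> (carleson_square a) powr e)" if a: "a \<in> disc" for a
      proof -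
        have pos: "0 < mass \<omega> (carleson_square a)" by (rule weight_square_pos[OF w a])
        have "emeasure \<mu> (carleson_square a) / epowr (emeasure (weighted \<omega>) (carleson_square a)) (q / p) \<le> carleson_sup q p \<omega> \<mu>"
          unfolding carleson_sup_def by (rule SUP_upper) (use a in \<open>auto simp: carleson_squares_def\<close>)
        then have "emeasure \<mu> (carleson_square a) / ennreal (mass \<omega> (carleson_square a) powr e) \<le> ennreal \<kappa>"
          using real by (simp add: W.emeasure_eq_measure e_def)
        then show ?thesis using pos real by (simp add: ennreal_divide_le_iff ennreal_mult)
      qed
      have bd: "eLp_norm \<mu> q (maximal_operator \<omega> \<alpha> \<phi>) \<le> ennreal ((c * \<kappa>) powr (1/q)) * Lp_norm (weighted \<omega>) p \<phi>"
        if \<phi>: "\<phi> \<in> Lp (weighted \<omega>) p" for \<phi>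
      proof -
        define F where "F \<zeta> = norm (\<phi> \<zeta>) powr (1/\<alpha>)" for \<zeta>
        have [measurable]: "\<phi> \<in> borel_measurable (lebesgue_on disc)"
          using \<phi> by (simp add: Lp_def cong: measurable_cong_sets)
        have Fm: "F \<in> borel_measurable (lebesgue_on disc)" unfolding F_def by measurable
        have FP: "norm (F \<zeta>) powr P = norm (\<phi> \<zeta>) powr p" for \<zeta>
          using \<alpha>0 by (simp add: F_def P_def powr_powr)
        have norm_eq: "Lp_norm (weighted \<omega>) p \<phi> = epowr (\<integral>\<^sup>+\<zeta>. ennreal (norm (\<phi> \<zeta>) powr p) \<partial>weighted \<omega>) (1/p)"
          by (simp add: Lp_norm_def eLp_norm_def)
        have "(\<integral>\<^sup>+\<zeta>. ennreal (norm (\<phi> \<zeta>) powr p) \<partial>weighted \<omega>) < \<infinity>"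
          using \<phi> eLp_norm_finite_iff[OF p(1), of "weighted \<omega>" "\<lambda>x. ennreal (norm (\<phi> x))"] by (simp add: Lp_def Lp_norm_def)
        then obtain N where N: "(\<integral>\<^sup>+\<zeta>. ennreal (norm (\<phi> \<zeta>) powr p) \<partial>weighted \<omega>) = ennreal N" "0 \<le> N"
          by (cases "\<integral>\<^sup>+\<zeta>. ennreal (norm (\<phi> \<zeta>) powr p) \<partial>weighted \<omega>") auto
        have N': "(\<integral>\<^sup>+\<zeta>. ennreal (norm (F \<zeta>) powr P) \<partial>weighted \<omega>) = ennreal N" unfolding FP by (rule N)
        have strong: "(\<integral>\<^sup>+z. epowr (hormander_maximal \<omega> F z) (\<alpha> * q) \<partial>\<mu>) \<le> ennreal (c * \<kappa> * N powr e)"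
          using hormander_maximal_strong_type[OF w K K' \<mu> real(1) \<kappa> e P Fm N' N(2)] unfolding eP c_def by simp
        have "eLp_norm \<mu> q (maximal_operator \<omega> \<alpha> \<phi>) = epowr (\<integral>\<^sup>+z. epowr (hormander_maximal \<omega> F z) (\<alpha> * q) \<partial>\<mu>) (1/q)"
          unfolding eLp_norm_def maximal_operator_def F_def epowr_epowr[OF \<alpha>0 q] by simp
        also have "\<dots> \<le> epowr (ennreal (c * \<kappa> * N powr e)) (1/q)" using q by (intro epowr_mono strong) auto
        also have "\<dots> = ennreal ((c * \<kappa>) powr (1/q)) * ennreal (N powr (1/p))"
          using c real N q p by (simp add: powr_mult powr_powr e_def ennreal_mult[symmetric])
        also have "ennreal (N powr (1/p)) = Lp_norm (weighted \<omega>) p \<phi>" unfolding norm_eq N(1) using N(2) by simp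
        finally show ?thesis .
      qed
      have "maximal_norm q p \<omega> \<alpha> \<mu> \<le> ennreal ((c * \<kappa>) powr (1/q))"
        unfolding maximal_norm_def operator_norm_def using bd by (intro Inf_lower) blast
      then have "epowr (maximal_norm q p \<omega> \<alpha> \<mu>) q \<le> epowr (ennreal ((c * \<kappa>) powr (1/q))) q"
        using q by (intro epowr_mono) auto
      also have "\<dots> = ennreal c * carleson_sup q p \<omega> \<mu>"
        using q c real by (simp add: powr_powr ennreal_mult)
      finally show ?thesis .
    qed
  qed
qed

section \<open>Test functions\<close>

text \<open>With the boundary point \<open>e = a / |a|\<close>, the modulus of \<open>1 - cnj a z\<close> is comparable to
  \<open>(1 - |a|) + |z - e|\<close>.\<close>

lemma
  assumes a: "a \<in> disc" and z: "z \<in> disc"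
  shows one_minus_norm_le_norm_one_minus_cnj_mult: "1 - norm a \<le> norm (1 - cnj a * z)"
    and norm_diff_cis_Arg_le_twice: "norm (z - cis (Arg a)) \<le> 2 * norm (1 - cnj a * z)"
    and norm_one_minus_cnj_mult_le: "norm (1 - cnj a * z) \<le> (1 - norm a) + norm (z - cis (Arg a))"
proof -
  define e where "e = cis (Arg a)"
  define x where "x = cnj e * z"
  have a': "a = of_real (norm a) * e" using rcis_cmod_Arg[of a] by (simp add: e_def rcis_def)
  have ax: "cnj a * z = of_real (norm a) * x"
    by (subst (1) a') (simp add: x_def mult.assoc)
  have nx: "norm x < 1" using z by (simp add: x_def e_def norm_mult)
  have ze: "norm (z - e) = norm (1 - x)"
  proof -
    have "e * (1 - x) = e - z"
      using complex_norm_square[of e] by (simp add: x_def e_def algebra_simps flip: mult.assoc)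
    then have "norm (e - z) = norm (1 - x)" by (metis e_def mult_1_left norm_cis norm_mult)
    then show ?thesis by (simp add: norm_minus_commute)
  qed
  have na: "norm a < 1" "0 \<le> norm a" using a by auto
  show 1: "1 - norm a \<le> norm (1 - cnj a * z)"
  proof -
    have "norm (cnj a * z) \<le> norm a * 1" unfolding norm_mult complex_mod_cnj using z by (intro mult_left_mono) auto
    moreover have "norm (1::complex) - norm (cnj a * z) \<le> norm (1 - cnj a * z)" by (rule norm_triangle_ineq2)
    ultimately show ?thesis by simp
  qed
  have d: "norm ((1 - of_real (norm a)) * x) \<le> 1 - norm a"
  proof -
    have "norm (1 - of_real (norm a) :: complex) = 1 - norm a"
      using na by (metis norm_of_real of_real_1 of_real_diff abs_of_pos diff_gt_0_iff_gt)
    then have "norm ((1 - of_real (norm a)) * x) = (1 - norm a) * norm x" by (simp only: norm_mult)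
    also have "\<dots> \<le> (1 - norm a) * 1" using nx na by (intro mult_left_mono) auto
    finally show ?thesis by simp
  qed
  have "1 - x = (1 - cnj a * z) - (1 - of_real (norm a)) * x"
    by (simp only: ax left_diff_distrib mult_1_left) simp
  then have "norm (1 - x) \<le> norm (1 - cnj a * z) + norm ((1 - of_real (norm a)) * x)"
    using norm_triangle_ineq4 by metis
  then show "norm (z - cis (Arg a)) \<le> 2 * norm (1 - cnj a * z)"
    using 1 d ze unfolding e_def by linarith
  have "1 - cnj a * z = (1 - x) + (1 - of_real (norm a)) * x"
    by (simp only: ax left_diff_distrib mult_1_left) simp
  then have "norm (1 - cnj a * z) \<le> norm (1 - x) + norm ((1 - of_real (norm a)) * x)"
    using norm_triangle_ineq by metis
  then show "norm (1 - cnj a * z) \<le> (1 - norm a) + norm (z - cis (Arg a))"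
    using d ze unfolding e_def by linarith
qed

text \<open>From one dyadic tent to the next the test function decays by the factor \<open>2^(-N)\<close>; again only the
  term for the first tent that contains \<open>z\<close> is used.\<close>

lemma test_function_powr_le_dyadic_sum:
  assumes a: "a \<in> disc" and z: "z \<in> disc" and p: "0 < p"
  shows "ennreal (norm ((of_real (1 - norm a) / (1 - cnj a * z))^N) powr p) \<le>
    (\<Sum>m. ennreal ((2 powr p)^N * (1 / (2 powr p)^N)^m) * indicator (tent a (2^(m+1) * (1 - norm a))) z)"
proof -
  define h where "h = 1 - norm a"
  define \<delta> where "\<delta> = (2 powr p)^N"
  have h: "0 < h" using a by (simp add: h_def)
  define y where "y = norm (1 - cnj a * z)"
  have y: "h \<le> y" "norm (z - cis (Arg a)) \<le> 2 * y"
    using one_minus_norm_le_norm_one_minus_cnj_mult[OF a z] norm_diff_cis_Arg_le_twice[OF a z] by (auto simp: h_def y_def)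
  have fn: "norm ((of_real (1 - norm a) / (1 - cnj a * z))^N) = (h / y)^N"
    unfolding norm_power norm_divide norm_of_real using h by (simp add: y_def h_def)
  have ex: "\<exists>m. norm (z - cis (Arg a)) \<le> 2^(m+1) * h"
  proof -
    obtain m where "norm (z - cis (Arg a)) / h < 2^m" using real_arch_pow[of 2] by auto
    then have "norm (z - cis (Arg a)) < 2^m * h" using h by (simp add: divide_less_eq)
    also have "\<dots> \<le> 2^(m+1) * h" using h by simp
    finally show ?thesis by (intro exI[of _ m]) simp
  qed
  define m where "m = (LEAST m. norm (z - cis (Arg a)) \<le> 2^(m+1) * h)"
  have m: "norm (z - cis (Arg a)) \<le> 2^(m+1) * h" unfolding m_def by (rule LeastI_ex[OF ex])
  have hy: "h / y \<le> 2 / 2^m"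
  proof (cases m)
    case 0
    have "h / y \<le> 1" using h y by simp
    then show ?thesis using 0 by simp
  next
    case (Suc k)
    have "\<not> norm (z - cis (Arg a)) \<le> 2^(k+1) * h"
      using not_less_Least[of k "\<lambda>m. norm (z - cis (Arg a)) \<le> 2^(m+1) * h"] Suc m_def by simp
    then have "2^m * h < 2 * y" using y Suc by simp
    then show ?thesis using h y by (simp add: field_simps)
  qed
  have "((h / y)^N) powr p = ((h / y) powr p)^N"
    using h y by (intro power_powr_commute) auto
  also have "\<dots> \<le> ((2 / 2^m) powr p)^N"
    using hy h y p by (intro power_mono powr_mono2) auto
  also have "(2 / 2^m) powr p = 2 powr p * (1 / 2 powr p)^m"
  proof -
    have "(2^m) powr p = (2 powr p)^m" by (intro power_powr_commute) auto
    moreover have "(2 / 2^m) powr p = 2 powr p / (2^m) powr p" by (simp add: powr_divide)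
    ultimately show ?thesis by (simp add: power_one_over)
  qed
  also have "(2 powr p * (1 / 2 powr p)^m)^N = \<delta> * (1 / \<delta>)^m"
  proof -
    have "(2 powr p * (1 / 2 powr p)^m)^N = (2 powr p)^N * ((1 / 2 powr p)^m)^N" by (rule power_mult_distrib)
    also have "((1 / 2 powr p)^m)^N = ((1 / 2 powr p)^N)^m" by (simp only: power_mult[symmetric] mult.commute)
    finally show ?thesis by (simp only: \<delta>_def power_one_over)
  qed
  finally have le: "((h / y)^N) powr p \<le> \<delta> * (1 / \<delta>)^m" .
  have "z \<in> disc \<inter> cball (cis (Arg a)) (2^(m+1) * h)"
    using m z by (simp add: dist_norm norm_minus_commute mult.commute)
  moreover have "0 < 2^(m+1) * h" using h by simp
  ultimately have zT: "z \<in> tent a (2^(m+1) * h)" using disc_Int_cball_subset_tent by blast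
  have "ennreal (((h / y)^N) powr p) \<le> ennreal (\<delta> * (1 / \<delta>)^m) * indicator (tent a (2^(m+1) * h)) z"
    using le zT by (simp add: ennreal_leI)
  also have "\<dots> = (\<Sum>k\<in>{m}. ennreal (\<delta> * (1 / \<delta>)^k) * indicator (tent a (2^(k+1) * h)) z)"
    by (subst sum.insert) (simp_all only: finite.emptyI empty_iff not_False_eq_True sum.empty add_0_right)
  also have "\<dots> \<le> (\<Sum>k. ennreal (\<delta> * (1 / \<delta>)^k) * indicator (tent a (2^(k+1) * h)) z)"
    by (rule sum_le_suminf) auto
  finally show ?thesis unfolding fn \<delta>_def h_def .
qed

text \<open>The test function for \<open>a\<close> is bounded below on \<open>S(a)\<close>. The integral of its \<open>p\<close>-th power is at most a
  constant times \<open>\<omega>(S(a))\<close>, as soon as the decay \<open>2^(-Np)\<close> per dyadic step outweighs the growth \<open>K\<close> of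
  the masses of tents.\<close>

lemma carleson_sup_le_embedding_norm:
  assumes p: "0 < p" "p \<le> q" and \<nu>: "\<nu> \<in> D_hat" and \<omega>: "\<omega> \<in> B_infty \<nu>"
  obtains c where "0 < c"
    "\<And>\<mu>. \<mu> \<in> disc_borel_measures \<Longrightarrow> carleson_sup q p \<omega> \<mu> \<le> ennreal c * epowr (embedding_norm q p \<omega> \<mu>) q"
proof -
  have q: "0 < q" using p by simp
  have w: "weight \<omega>" using \<omega> by (auto simp: B_infty_def)
  interpret W: finite_measure "weighted \<omega>" by (rule finite_measure_weighted[OF w])
  obtain K where K: "1 \<le> K" "\<And>a n. a \<in> disc \<Longrightarrow> 1 \<le> n \<Longrightarrow>
    mass \<omega> (tent a (2^n * (1 - norm a))) \<le> K^(n+1) * mass \<omega> (carleson_square a)"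
    using B_infty_tent_doubling[OF \<nu> \<omega>] by blast
  have "1 < 2 powr p" using p by simp
  then obtain N where N: "2 * K < (2 powr p)^N" using real_arch_pow by blast
  define \<delta> where "\<delta> = (2 powr p)^N"
  have \<delta>: "2 * K < \<delta>" "0 < \<delta>" using N K by (auto simp: \<delta>_def)
  define A where "A = 2 * \<delta> * K^2"
  have A: "0 < A" using K \<delta> by (simp add: A_def)
  \<comment> \<open>On \<open>S(a)\<close> the modulus of \<open>1 - cnj a z\<close> is at most \<open>3 (1 - |a|)\<close>, hence \<open>3^N\<close>.\<close>
  define c where "c = (3^N) powr q * A powr (q / p)"
  have c: "0 < c" using A by (simp add: c_def)
  show ?thesis
  proof (rule that[OF c])
    fix \<mu> assume \<mu>: "\<mu> \<in> disc_borel_measures"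
    note \<mu>s[measurable_cong] = disc_borel_measure_sets(1)[OF \<mu>]
    show "carleson_sup q p \<omega> \<mu> \<le> ennreal c * epowr (embedding_norm q p \<omega> \<mu>) q"
      unfolding embedding_norm_def operator_norm_def
    proof (rule le_epowr_Inf[OF c q])
      fix D assume "D \<in> {C. \<forall>f\<in>bergman p \<omega>. Lp_norm \<mu> q (id f) \<le> C * Lp_norm (weighted \<omega>) p f}"
      then have D: "\<And>f. f \<in> bergman p \<omega> \<Longrightarrow> Lp_norm \<mu> q f \<le> D * Lp_norm (weighted \<omega>) p f" by simp
      show "carleson_sup q p \<omega> \<mu> \<le> ennreal c * epowr D q"
      proof (cases D)
        case top
        then show ?thesis using c by (simp add: ennreal_mult_top)
      next
        case (real r)
        show ?thesis unfolding carleson_sup_def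
        proof (rule SUP_least)
          fix S assume "S \<in> carleson_squares"
          then obtain a where a: "a \<in> disc" and S: "S = carleson_square a" by (auto simp: carleson_squares_def)
          define m where "m = mass \<omega> S"
          have m: "0 < m" unfolding m_def S by (rule weight_square_pos[OF w a])
          define h where "h = 1 - norm a"
          have h: "0 < h" using a by (simp add: h_def)
          define f where "f z = (of_real h / (1 - cnj a * z))^N" for z
          have nz: "1 - cnj a * z \<noteq> 0" if "z \<in> disc" for z
            using one_minus_norm_le_norm_one_minus_cnj_mult[OF a that] h unfolding h_def by force
          have hol: "f holomorphic_on disc" unfolding f_def using nz by (intro holomorphic_intros) auto
          let ?T = "\<lambda>k. tent a (2^(k+1) * h)"
          have d: "0 < 2^(k+1) * h" for k using h by simp
          have [measurable]: "?T k \<in> sets (lebesgue_on disc)" for k by (rule tent_measurable[OF d])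
          have "(\<integral>\<^sup>+z. ennreal (norm (f z) powr p) \<partial>weighted \<omega>) \<le>
            (\<integral>\<^sup>+z. (\<Sum>k. ennreal (\<delta> * (1 / \<delta>)^k) * indicator (?T k) z) \<partial>weighted \<omega>)"
            using test_function_powr_le_dyadic_sum[OF a _ p(1), of _ N]
            by (intro nn_integral_mono) (simp add: f_def h_def \<delta>_def)
          also have "\<dots> = (\<Sum>k. (\<integral>\<^sup>+z. ennreal (\<delta> * (1 / \<delta>)^k) * indicator (?T k) z \<partial>weighted \<omega>))"
            by (rule nn_integral_suminf) measurable
          also have "\<dots> = (\<Sum>k. ennreal (\<delta> * (1 / \<delta>)^k) * emeasure (weighted \<omega>) (?T k))"
            by (intro suminf_cong nn_integral_cmult_indicator) (simp only: sets_weighted tent_measurable[OF d])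
          also have "\<dots> \<le> (\<Sum>k. ennreal (\<delta> * K^2 * m * (1/2)^k))"
          proof (intro suminf_le)
            fix k
            have "\<delta> * (1 / \<delta>)^k * mass \<omega> (?T k) \<le> \<delta> * (1 / \<delta>)^k * (K^(k+1+1) * m)"
              using K(2)[OF a, of "k+1"] \<delta> unfolding m_def S h_def by (intro mult_left_mono) auto
            also have "\<dots> = \<delta> * K^2 * m * (K / \<delta>)^k"
            proof -
              have "(K / \<delta>)^k = (1 / \<delta>)^k * K^k" by (simp only: power_mult_distrib[symmetric]) simp
              then show ?thesis by (simp only: power_add power_one_right power2_eq_square mult_ac)
            qed
            also have "\<dots> \<le> \<delta> * K^2 * m * (1/2)^k"
              using \<delta> K(1) m by (intro mult_left_mono power_mono) (auto simp: field_simps)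
            finally have "ennreal (\<delta> * (1 / \<delta>)^k * mass \<omega> (?T k)) \<le> ennreal (\<delta> * K^2 * m * (1/2)^k)"
              by (rule ennreal_leI)
            then show "ennreal (\<delta> * (1 / \<delta>)^k) * emeasure (weighted \<omega>) (?T k) \<le> ennreal (\<delta> * K^2 * m * (1/2)^k)"
              using \<delta> unfolding W.emeasure_eq_measure by (subst ennreal_mult[symmetric]) auto
          qed auto
          also have "\<dots> = ennreal (\<Sum>k. \<delta> * K^2 * m * (1/2)^k)"
            using m \<delta> by (intro suminf_ennreal2 summable_mult summable_geometric) auto
          also have "(\<Sum>k. \<delta> * K^2 * m * (1/2)^k) = A * m"
            by (subst suminf_mult) (auto simp: suminf_geometric summable_geometric A_def)
          finally have up: "(\<integral>\<^sup>+z. ennreal (norm (f z) powr p) \<partial>weighted \<omega>) \<le> ennreal (A * m)" .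
          have nf: "Lp_norm (weighted \<omega>) p f \<le> ennreal ((A * m) powr (1/p))"
          proof -
            have "Lp_norm (weighted \<omega>) p f = epowr (\<integral>\<^sup>+z. ennreal (norm (f z) powr p) \<partial>weighted \<omega>) (1/p)"
              by (simp add: Lp_norm_def eLp_norm_def)
            also have "\<dots> \<le> epowr (ennreal (A * m)) (1/p)" using p by (intro epowr_mono up) auto
            finally show ?thesis using A m by simp
          qed
          also have "\<dots> < \<infinity>" by simp
          finally have fB: "f \<in> bergman p \<omega>" using hol by (simp add: bergman_def)
          have "Lp_norm \<mu> q f \<le> ennreal (r * (A * m) powr (1/p))"
            using order_trans[OF D[OF fB] mult_left_mono[OF nf]] real by (simp add: ennreal_mult)
          then have "epowr (Lp_norm \<mu> q f) q \<le> epowr (ennreal (r * (A * m) powr (1/p))) q"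
            using q by (intro epowr_mono) auto
          then have I: "(\<integral>\<^sup>+z. ennreal (norm (f z) powr q) \<partial>\<mu>) \<le> ennreal (r powr q * (A * m) powr (q/p))"
            using q real by (simp add: Lp_norm_def eLp_norm_def epowr_inverse powr_mult powr_powr)
          have lower: "ennreal ((1 / 3^N) powr q) * indicator S z \<le> ennreal (norm (f z) powr q)" for z
          proof (cases "z \<in> S")
            case True
            then have z: "z \<in> disc" using carleson_square_subset_disc[of a] by (auto simp: S)
            have "norm (z - cis (Arg a)) \<le> 2 * h"
              using carleson_square_subset_cball[OF a] True unfolding S h_def by (auto simp: dist_norm norm_minus_commute)
            then have "norm (1 - cnj a * z) \<le> 3 * h"
              using norm_one_minus_cnj_mult_le[OF a z] by (simp add: h_def)
            moreover have "0 < norm (1 - cnj a * z)" using nz[OF z] by simp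
            ultimately have "1 / 3 \<le> h / norm (1 - cnj a * z)" using h by (simp add: field_simps)
            then have "(1 / 3)^N \<le> (h / norm (1 - cnj a * z))^N" by (intro power_mono) auto
            also have "\<dots> = norm (f z)" using h by (simp add: f_def norm_power norm_divide)
            finally have "(1 / 3^N) powr q \<le> norm (f z) powr q" using q by (intro powr_mono2) (auto simp: power_one_over)
            then show ?thesis using True by (simp add: ennreal_leI)
          qed simp
          have "ennreal ((1 / 3^N) powr q) * emeasure \<mu> S = (\<integral>\<^sup>+z. ennreal ((1 / 3^N) powr q) * indicator S z \<partial>\<mu>)"
            using carleson_square_sets_disc[OF a] \<mu>s by (intro nn_integral_cmult_indicator[symmetric]) (simp add: S)
          also have "\<dots> \<le> (\<integral>\<^sup>+z. ennreal (norm (f z) powr q) \<partial>\<mu>)" by (intro nn_integral_mono lower)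
          also note I
          finally have "ennreal ((3^N) powr q) * (ennreal ((1 / 3^N) powr q) * emeasure \<mu> S) \<le> ennreal ((3^N) powr q) * ennreal (r powr q * (A * m) powr (q/p))"
            by (rule mult_left_mono) simp
          moreover have "ennreal ((3^N) powr q) * (ennreal ((1 / 3^N) powr q) * emeasure \<mu> S) = emeasure \<mu> S"
          proof -
            have "(3^N) powr q * (1 / 3^N) powr q = (1::real)" by (subst powr_mult[symmetric]) auto
            then show ?thesis by (simp add: mult.assoc[symmetric] ennreal_mult[symmetric])
          qed
          moreover have "ennreal ((3^N) powr q) * ennreal (r powr q * (A * m) powr (q/p)) = ennreal c * epowr D q * ennreal (m powr (q/p))"
          proof -
            have "(A * m) powr (q/p) = A powr (q/p) * m powr (q/p)" by (simp add: powr_mult)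
            then show ?thesis using real by (simp add: c_def ennreal_mult[symmetric] mult_ac)
          qed
          ultimately have "emeasure \<mu> S \<le> ennreal c * epowr D q * ennreal (m powr (q/p))" by simp
          then have "emeasure \<mu> S / ennreal (m powr (q/p)) \<le> ennreal c * epowr D q"
            using m by (simp add: ennreal_divide_le_iff)
          then show "emeasure \<mu> S / epowr (emeasure (weighted \<omega>) S) (q / p) \<le> ennreal c * epowr D q"
            using m by (simp add: W.emeasure_eq_measure m_def)
        qed
      qed
    qed
  qed
qed

section \<open>The equivalence\<close>

lemma comparable_on_of_le_le:
  assumes c: "0 < c" "\<And>m. m \<in> A \<Longrightarrow> X m \<le> ennreal c * Y m" and d: "0 < d" "\<And>m. m \<in> A \<Longrightarrow> Y m \<le> ennreal d * X m"
  shows "comparable_on A X Y"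
  unfolding comparable_on_def
proof (intro exI conjI ballI)
  show "0 < 1 / d" "0 < c" using c d by auto
  fix m assume m: "m \<in> A"
  have "ennreal (1/d) * Y m \<le> ennreal (1/d) * (ennreal d * X m)" by (intro mult_left_mono d(2)[OF m]) simp
  also have "\<dots> = X m" using d(1) by (simp add: mult.assoc[symmetric] ennreal_mult[symmetric])
  finally show "ennreal (1/d) * Y m \<le> X m" .
  show "X m \<le> ennreal c * Y m" by (rule c(2)[OF m])
qed

theorem theorem3:
  fixes p q :: real and \<omega> :: "complex \<Rightarrow> real"
  assumes "0 < p" and "p \<le> q" and "\<omega> \<in> B_infty_D_hat"
  shows "(\<forall>\<mu>\<in>disc_borel_measures.
            (carleson_measure q p \<omega> \<mu> \<longleftrightarrow> (\<forall>\<alpha>>1/p. maximal_bounded q p \<omega> \<alpha> \<mu>)) \<and>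
            ((\<forall>\<alpha>>1/p. maximal_bounded q p \<omega> \<alpha> \<mu>) \<longleftrightarrow> carleson_sup q p \<omega> \<mu> < \<infinity>)) \<and>
         (\<forall>\<alpha>>1/p.
            comparable_on disc_borel_measures
              (\<lambda>\<mu>. epowr (embedding_norm q p \<omega> \<mu>) q) (\<lambda>\<mu>. epowr (maximal_norm q p \<omega> \<alpha> \<mu>) q) \<and>
            comparable_on disc_borel_measures
              (\<lambda>\<mu>. epowr (maximal_norm q p \<omega> \<alpha> \<mu>) q) (carleson_sup q p \<omega>))"
proof -
  have q: "0 < q" using assms by simp
  obtain \<nu> where \<nu>: "\<nu> \<in> D_hat" and \<omega>: "\<omega> \<in> B_infty \<nu>" using assms(3) by (auto simp: B_infty_D_hat_def)
  have w: "weight \<omega>" using \<omega> by (auto simp: B_infty_def)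
  let ?X = "\<lambda>\<mu>. epowr (embedding_norm q p \<omega> \<mu>) q" and ?Y = "\<lambda>\<alpha> \<mu>. epowr (maximal_norm q p \<omega> \<alpha> \<mu>) q"
    and ?Z = "carleson_sup q p \<omega>"
  have fin: "x < \<infinity>" if "x \<le> ennreal c * y" "y < \<infinity>" for x y :: ennreal and c
  proof -
    have "ennreal c * y < \<infinity>" using that(2) by (simp add: ennreal_mult_less_top)
    with that(1) show ?thesis by (rule le_less_trans)
  qed
  have epowr_fin: "epowr x q < \<infinity> \<longleftrightarrow> x < \<infinity>" for x by (cases x) auto
  have cycle: "\<exists>a>0. \<exists>b>0. \<exists>c>0. \<forall>\<mu>\<in>disc_borel_measures.
      ?X \<mu> \<le> ennreal a * ?Y \<alpha> \<mu> \<and> ?Y \<alpha> \<mu> \<le> ennreal b * ?Z \<mu> \<and> ?Z \<mu> \<le> ennreal c * ?X \<mu>" if \<alpha>: "1/p < \<alpha>" for \<alpha>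
  proof -
    have \<alpha>0: "0 < \<alpha>" using \<alpha> assms(1) by (meson divide_pos_pos less_trans zero_less_one)
    obtain a where "0 < a" "\<And>\<mu>. \<mu> \<in> disc_borel_measures \<Longrightarrow> ?X \<mu> \<le> ennreal a * ?Y \<alpha> \<mu>"
      using embedding_norm_le_maximal_norm[OF assms(1) q \<nu> \<omega> \<alpha>0] by blast
    moreover obtain b where "0 < b" "\<And>\<mu>. \<mu> \<in> disc_borel_measures \<Longrightarrow> ?Y \<alpha> \<mu> \<le> ennreal b * ?Z \<mu>"
      using maximal_norm_le_carleson_sup[OF assms(1,2) \<nu> \<omega> \<alpha>] by blast
    moreover obtain c where "0 < c" "\<And>\<mu>. \<mu> \<in> disc_borel_measures \<Longrightarrow> ?Z \<mu> \<le> ennreal c * ?X \<mu>"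
      using carleson_sup_le_embedding_norm[OF assms(1,2) \<nu> \<omega>] by blast
    ultimately show ?thesis by blast
  qed
  have equiv: "(carleson_measure q p \<omega> \<mu> \<longleftrightarrow> ?Z \<mu> < \<infinity>) \<and> (maximal_bounded q p \<omega> \<alpha> \<mu> \<longleftrightarrow> ?Z \<mu> < \<infinity>)"
    if \<mu>: "\<mu> \<in> disc_borel_measures" and \<alpha>: "1/p < \<alpha>" for \<mu> \<alpha>
  proof -
    obtain a b c where abc: "?X \<mu> \<le> ennreal a * ?Y \<alpha> \<mu>" "?Y \<alpha> \<mu> \<le> ennreal b * ?Z \<mu>" "?Z \<mu> \<le> ennreal c * ?X \<mu>"
      using cycle[OF \<alpha>] \<mu> by blast
    have "?X \<mu> < \<infinity> \<longleftrightarrow> ?Z \<mu> < \<infinity>" "?Y \<alpha> \<mu> < \<infinity> \<longleftrightarrow> ?Z \<mu> < \<infinity>"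
      using fin[OF abc(1)] fin[OF abc(2)] fin[OF abc(3)] by blast+
    then show ?thesis
      unfolding carleson_measure_iff[OF assms(1) q \<mu>] maximal_bounded_iff[OF w \<mu>] epowr_fin by blast
  qed
  have ex: "1/p < 1/p + 1" by simp
  have "comparable_on disc_borel_measures ?X (?Y \<alpha>) \<and> comparable_on disc_borel_measures (?Y \<alpha>) ?Z" if \<alpha>: "1/p < \<alpha>" for \<alpha>
  proof -
    obtain a b c where abc: "0 < a" "0 < b" "0 < c"
      "\<And>\<mu>. \<mu> \<in> disc_borel_measures \<Longrightarrow> ?X \<mu> \<le> ennreal a * ?Y \<alpha> \<mu>"
      "\<And>\<mu>. \<mu> \<in> disc_borel_measures \<Longrightarrow> ?Y \<alpha> \<mu> \<le> ennreal b * ?Z \<mu>"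
      "\<And>\<mu>. \<mu> \<in> disc_borel_measures \<Longrightarrow> ?Z \<mu> \<le> ennreal c * ?X \<mu>"
      using cycle[OF \<alpha>] by blast
    have trans: "x \<le> ennreal (s * t) * z" if "x \<le> ennreal s * y" "y \<le> ennreal t * z" "0 < s" "0 < t" for x y z :: ennreal and s t
      using order_trans[OF that(1) mult_left_mono[OF that(2)]] that(3,4) by (simp add: ennreal_mult mult.assoc)
    have "comparable_on disc_borel_measures ?X (?Y \<alpha>)"
      by (rule comparable_on_of_le_le[OF abc(1,4) mult_pos_pos[OF abc(2,3)] trans[OF abc(5,6) abc(2,3)]])
    moreover have "comparable_on disc_borel_measures (?Y \<alpha>) ?Z"
      by (rule comparable_on_of_le_le[OF abc(2,5) mult_pos_pos[OF abc(3,1)] trans[OF abc(6,4) abc(3,1)]])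
    ultimately show ?thesis by blast
  qed
  moreover have "(carleson_measure q p \<omega> \<mu> \<longleftrightarrow> (\<forall>\<alpha>>1/p. maximal_bounded q p \<omega> \<alpha> \<mu>)) \<and>
      ((\<forall>\<alpha>>1/p. maximal_bounded q p \<omega> \<alpha> \<mu>) \<longleftrightarrow> ?Z \<mu> < \<infinity>)" if \<mu>: "\<mu> \<in> disc_borel_measures" for \<mu>
    using equiv[OF \<mu>] ex by blast
  ultimately show ?thesis by blast
qed

end
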